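(* For any admissible parameters $(\mathsf R,\mathsf S,\mathsf P,\mathsf k_1)$, index sets $\mathscr N_{\mathbf u}^M,\mathscr N_\theta^M$ and initial condition $\mathbf X_0^M=(\mathbf u_0^M,\theta_0^M)$, a unique smooth solution $\mathbf X^M(t)=(\mathbf u^M(t),\theta^M(t))$ of the truncated ODE model with $\mathbf X^M(0)=\mathbf X_0^M$ exists. The following statements hold: (a) The potential energy equation $$\frac{d}{dt}\Big\langle\big(1-\tfrac{x_3}{\pi}\big)\theta\Big\rangle=\Big\langle\big(1-\tfrac{x_3}{\pi}\big)\partial_{x_3}^2\theta\Big\rangle-\frac1\pi\langle u_3\theta\rangle$$ holds with $\mathbf u,\theta$ replaced by $\mathbf u^M,\theta^M$ if and only if the Energy Balance Criterion is satisfied. (b) If this potential energy equation holds (with $\mathbf u,\theta$ replaced by $\mathbf u^M,\theta^M$), then there exists a forward invariant ball depending only on $\mathsf P,\mathsf R,\mathsf k_1$ and $|\mathscr N_\theta^M|$ which monotonically attracts all solutions lying outside. Thus all solutions are global and the semigroup $\mathcal S^M(t)$, defined by $\mathcal S^M(t)[\mathbf X_0^M]:=\mathbf X^M(t)$, admits a compact global attractor $\mathscr A^M$.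
   Context: Parameters $(\mathsf R,\mathsf S,\mathsf P,\mathsf k_1)$ are admissible if $\mathsf R,\mathsf S\ge0$ and $\mathsf P,\mathsf k_1>0$. $\Omega=[0,2\pi/\mathsf k_1]\times[0,\pi]$ with coordinates $\mathbf x=(x_1,x_3)$; all functions are periodic in $x_1$ and independent of $x_2$ (so $\partial_{x_2}=0$); velocity fields have three components $\mathbf u=(u_1,u_2,u_3)$. $\langle f\rangle:=\int_\Omega f\,d\mathbf x$; $\hat{\mathbf e}^j$ are the unit vectors. Basis. Let $|\mathcal K\mathbf m|=(\mathsf k_1^2m_1^2+m_3^2)^{1/2}$, $V=(\pi^2/(2\mathsf k_1))^{1/2}$, $\eta^{\mathbf m}=\eta^{m_1}\eta^{m_3}$ with $\eta^m=1$ if $m>0$, $\eta^0=1/\sqrt2$. An index is $\mathbf n=(m_1,m_3,p_1,c)$, with wave vector $\mathbf m=(m_1,m_3)$, phase $p_1\in\{1,2\}$ and component $c\in\{1,2\}$. Set $f^{(\mathbf m,1,1)}=\frac{\eta^{\mathbf m}}V\cos(\mathsf k_1m_1x_1)\sin(m_3x_3)$, $f^{(\mathbf m,2,1)}=\frac{\eta^{\mathbf m}}V\sin(\mathsf k_1m_1x_1)\sin(m_3x_3)$, $\mathbf v^{(\mathbf m,1,1)}=\frac{\eta^{\mathbf m}}{|\mathcal K\mathbf m|V}\big(m_3\sin(\mathsf k_1m_1x_1)\cos(m_3x_3),\,0,\,-\mathsf k_1m_1\cos(\mathsf k_1m_1x_1)\sin(m_3x_3)\big)$, $\mathbf v^{(\mathbf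 m,2,1)}=\frac{\eta^{\mathbf m}}{|\mathcal K\mathbf m|V}\big(m_3\cos(\mathsf k_1m_1x_1)\cos(m_3x_3),\,0,\,\mathsf k_1m_1\sin(\mathsf k_1m_1x_1)\sin(m_3x_3)\big)$, $\mathbf v^{(\mathbf m,1,2)}=\frac{\eta^{\mathbf m}}V\hat{\mathbf e}^2\sin(\mathsf k_1m_1x_1)\cos(m_3x_3)$, $\mathbf v^{(\mathbf m,2,2)}=\frac{\eta^{\mathbf m}}V\hat{\mathbf e}^2\cos(\mathsf k_1m_1x_1)\cos(m_3x_3)$. $\mathscr N_\theta$ is the set of $(m_1,m_3,p_1,1)$ with $m_1\ge0$, $m_3\ge1$ integers, $p_1\in\{1,2\}$ if $m_1>0$ and $p_1=1$ if $m_1=0$. $\mathscr N_{\mathbf u}$ is the set of $(m_1,m_3,p_1,c)$ with $(m_1,m_3)\in\mathbb Z_{\ge0}^2\setminus\{\mathbf 0\}$, $p_1\in\{1,2\}$ if $m_1>0$ and $p_1=2$ if $m_1=0$, $c\in\{1,2\}$ if $m_3>0$ and $c=2$ if $m_3=0$. These functions are orthonormal in $L^2(\Omega)$. Truncated ODE model. The index sets $\mathscr N_{\mathbf u}^M\subseteq\mathscr N_{\mathbf u}$, $\mathscr N_\theta^M\subseteq\mathscr N_\theta$ are finite. With $\mathcal P^M_{\mathbf u}[\mathbf w]=\sum_{\mathbf n\in\mathscr N^M_{\mathbf u}}\langle\mathbf w\cdot\mathbf v^{\mathbf n}\rangle\mathbf v^{\mathbf n}$ and $\mathcal P^M_\theta[g]=\sum_{\mathbf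 n\in\mathscr N^M_\theta}\langle gf^{\mathbf n}\rangle f^{\mathbf n}$, the truncated model is the system of ODEs for the coefficients of $\mathbf u^M=\sum_{\mathbf n\in\mathscr N_{\mathbf u}^M}u^{\mathbf n,M}(t)\mathbf v^{\mathbf n}$, $\theta^M=\sum_{\mathbf n\in\mathscr N_\theta^M}\theta^{\mathbf n,M}(t)f^{\mathbf n}$ given by $$\partial_t\mathbf u^M=\mathsf P\Delta\mathbf u^M+\mathsf P\mathsf R\,\mathcal P^M_{\mathbf u}[\theta^M\hat{\mathbf e}^3]-\mathsf P\mathsf S\,\mathcal P^M_{\mathbf u}[\hat{\mathbf e}^3\times\mathbf u^M]-\mathcal P^M_{\mathbf u}[\mathbf u^M\cdot\nabla\mathbf u^M],$$ $$\partial_t\theta^M=\Delta\theta^M+\mathcal P^M_\theta[u_3^M]-\mathcal P^M_\theta[\mathbf u^M\cdot\nabla\theta^M].$$ Initial conditions $(\mathbf u_0^M,\theta_0^M)$ are of the same finite form, i.e. $\mathbf u_0^M\in\mathrm{span}\{\mathbf v^{\mathbf n}:\mathbf n\in\mathscr N_{\mathbf u}^M\}$, $\theta_0^M\in\mathrm{span}\{f^{\mathbf n}:\mathbf n\in\mathscr N_\theta^M\}$. Energy Balance Criterion. For any pair $\mathbf n'=(m_1',m_3',p',c')\in\mathscr N_{\mathbf u}^M$, $\mathbf n''=(m_1'',m_3'',p'',c'')\in\mathscr N_\theta^M$ satisfying $m_1'=m_1''>0$, $p'=p''$, $c'=c''=1$ and $m_3'=m_3''$, one must have $(0,2m_3',1,1)\in\mathscr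 N_\theta^M$. On the other hand, if any such pair satisfies $m_1'=m_1''>0$, $p'=p''$, $c'=c''=1$ and $m_3'\ne m_3''$, then one can have $(0,|m_3'-m_3''|,1,1)\in\mathscr N_\theta^M$ if and only if $(0,m_3'+m_3'',1,1)\in\mathscr N_\theta^M$. Global attractor. For a semigroup of operators $\mathcal S(t)$ on a Banach space $B$, a subset $Y\subset B$ is functionally invariant if $\mathcal S(t)Y=Y$ for all $t>0$, and $Y$ attracts $Z\subset B$ if $\lim_{t\to\infty}\inf_{y\in Y}\|\mathcal S(t)z_0-y\|_B=0$ for all $z_0\in Z$. A set $\mathscr A\subset B$ is the global attractor for $\mathcal S(t)$ if it is the maximal functionally invariant set which attracts all bounded subsets of $B$.
   Formalization: The global attractor is the maximal bounded functionally invariant set attracting all bounded sets; without "bounded" the claim fails: for N_u empty and N_θ={(0,1,1,1)}, θ'=−θ, and the whole noncompact line is functionally invariant and attracting. *)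

theory Defs
  imports "HOL-Analysis.Analysis"
begin

section \<open>Domain, fields and differential operators\<close>

text \<open>
  A point is \<open>x = (x1, x3)\<close>; nothing depends on \<open>x2\<close>.  Fields are functions on the whole plane:
  those occurring below are trigonometric polynomials, so their periodic extension is canonical.
  A state is a pair of a velocity field and a temperature field.
\<close>

type_synonym point = "real \<times> real"
type_synonym vfield = "point \<Rightarrow> real ^ 3"
type_synonym sfield = "point \<Rightarrow> real"
type_synonym state = "vfield \<times> sfield"

definition admissible :: "real \<Rightarrow> real \<Rightarrow> real \<Rightarrow> real \<Rightarrow> bool" where
  "admissible R S P k1 \<longleftrightarrow> R \<ge> 0 \<and> S \<ge> 0 \<and> P > 0 \<and> k1 > 0"

definition Omega :: "real \<Rightarrow> point set" where
  "Omega k1 = {0 .. 2 * pi / k1} \<times> {0 .. pi}"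

definition avg :: "real \<Rightarrow> sfield \<Rightarrow> real" where
  "avg k1 g = integral (Omega k1) g"

definition d1 :: "(point \<Rightarrow> 'a::real_normed_vector) \<Rightarrow> point \<Rightarrow> 'a" where
  "d1 g = (\<lambda>(x1, x3). vector_derivative (\<lambda>s. g (s, x3)) (at x1))"

definition d3 :: "(point \<Rightarrow> 'a::real_normed_vector) \<Rightarrow> point \<Rightarrow> 'a" where
  "d3 g = (\<lambda>(x1, x3). vector_derivative (\<lambda>s. g (x1, s)) (at x3))"

definition laplacian :: "(point \<Rightarrow> 'a::real_normed_vector) \<Rightarrow> point \<Rightarrow> 'a" where
  "laplacian g = (\<lambda>x. d1 (d1 g) x + d3 (d3 g) x)"

definition advect :: "vfield \<Rightarrow> (point \<Rightarrow> 'a::real_normed_vector) \<Rightarrow> point \<Rightarrow> 'a" where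
  "advect u g = (\<lambda>x. (u x $ 1) *\<^sub>R d1 g x + (u x $ 3) *\<^sub>R d3 g x)"

definition e3 :: "real ^ 3" where
  "e3 = axis 3 1"

section \<open>The basis\<close>

text \<open>An index is \<open>(m1, m3, p, c)\<close>: wave vector, phase and component.\<close>

type_synonym idx = "nat \<times> nat \<times> nat \<times> nat"

definition eta :: "nat \<Rightarrow> real" where
  "eta m = (if m = 0 then 1 / sqrt 2 else 1)"

definition eta2 :: "nat \<Rightarrow> nat \<Rightarrow> real" where
  "eta2 m1 m3 = eta m1 * eta m3"

definition Vol :: "real \<Rightarrow> real" where
  "Vol k1 = sqrt (pi\<^sup>2 / (2 * k1))"

definition Kabs :: "real \<Rightarrow> nat \<Rightarrow> nat \<Rightarrow> real" where
  "Kabs k1 m1 m3 = sqrt (k1\<^sup>2 * (real m1)\<^sup>2 + (real m3)\<^sup>2)"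

text \<open>In both definitions the value for a phase or component outside \<open>{1, 2}\<close> is never used.\<close>

definition temp_mode :: "real \<Rightarrow> idx \<Rightarrow> sfield" where
  "temp_mode k1 = (\<lambda>(m1, m3, p, c) (x1, x3).
     eta2 m1 m3 / Vol k1 *
       ((if p = 1 then cos (k1 * real m1 * x1) else sin (k1 * real m1 * x1)) * sin (real m3 * x3)))"

definition vel_mode :: "real \<Rightarrow> idx \<Rightarrow> vfield" where
  "vel_mode k1 = (\<lambda>(m1, m3, p, c) (x1, x3).
     if c = 1 then
       (eta2 m1 m3 / (Kabs k1 m1 m3 * Vol k1)) *\<^sub>R
         (if p = 1
          then vector [real m3 * sin (k1 * real m1 * x1) * cos (real m3 * x3), 0,
                       - k1 * real m1 * cos (k1 * real m1 * x1) * sin (real m3 * x3)]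
          else vector [real m3 * cos (k1 * real m1 * x1) * cos (real m3 * x3), 0,
                       k1 * real m1 * sin (k1 * real m1 * x1) * sin (real m3 * x3)])
     else
       (eta2 m1 m3 / Vol k1 *
         ((if p = 1 then sin (k1 * real m1 * x1) else cos (k1 * real m1 * x1)) * cos (real m3 * x3)))
         *\<^sub>R axis 2 1)"

definition temp_indices :: "idx set" where
  "temp_indices = {(m1, m3, p, c). m3 \<ge> 1 \<and> c = 1 \<and>
     (if m1 > 0 then p \<in> {1, 2} else p = 1)}"

definition vel_indices :: "idx set" where
  "vel_indices = {(m1, m3, p, c). (m1, m3) \<noteq> (0, 0) \<and>
     (if m1 > 0 then p \<in> {1, 2} else p = 2) \<and>
     (if m3 > 0 then c \<in> {1, 2} else c = 2)}"

definition index_sets :: "idx set \<Rightarrow> idx set \<Rightarrow> bool" where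
  "index_sets Nu Nt \<longleftrightarrow> finite Nu \<and> Nu \<subseteq> vel_indices \<and> finite Nt \<and> Nt \<subseteq> temp_indices"

definition vel_coeff :: "real \<Rightarrow> vfield \<Rightarrow> idx \<Rightarrow> real" where
  "vel_coeff k1 w n = avg k1 (\<lambda>x. w x \<bullet> vel_mode k1 n x)"

definition temp_coeff :: "real \<Rightarrow> sfield \<Rightarrow> idx \<Rightarrow> real" where
  "temp_coeff k1 g n = avg k1 (\<lambda>x. g x * temp_mode k1 n x)"

definition vel_sum :: "real \<Rightarrow> idx set \<Rightarrow> (idx \<Rightarrow> real) \<Rightarrow> vfield" where
  "vel_sum k1 N a = (\<lambda>x. \<Sum>n\<in>N. a n *\<^sub>R vel_mode k1 n x)"

definition temp_sum :: "real \<Rightarrow> idx set \<Rightarrow> (idx \<Rightarrow> real) \<Rightarrow> sfield" where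
  "temp_sum k1 N b = (\<lambda>x. \<Sum>n\<in>N. b n * temp_mode k1 n x)"

definition proj_u :: "real \<Rightarrow> idx set \<Rightarrow> vfield \<Rightarrow> vfield" where
  "proj_u k1 N w = vel_sum k1 N (vel_coeff k1 w)"

definition proj_t :: "real \<Rightarrow> idx set \<Rightarrow> sfield \<Rightarrow> sfield" where
  "proj_t k1 N g = temp_sum k1 N (temp_coeff k1 g)"

definition phase_space :: "real \<Rightarrow> idx set \<Rightarrow> idx set \<Rightarrow> state set" where
  "phase_space k1 Nu Nt = range (vel_sum k1 Nu) \<times> range (temp_sum k1 Nt)"

section \<open>The truncated model\<close>

definition rhs_u :: "real \<Rightarrow> real \<Rightarrow> real \<Rightarrow> real \<Rightarrow> idx set \<Rightarrow> state \<Rightarrow> vfield" where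
  "rhs_u R S P k1 Nu = (\<lambda>(u, \<theta>) x.
     P *\<^sub>R laplacian u x
     + (P * R) *\<^sub>R proj_u k1 Nu (\<lambda>y. \<theta> y *\<^sub>R e3) x
     - (P * S) *\<^sub>R proj_u k1 Nu (\<lambda>y. cross3 e3 (u y)) x
     - proj_u k1 Nu (advect u u) x)"

definition rhs_t :: "real \<Rightarrow> idx set \<Rightarrow> state \<Rightarrow> sfield" where
  "rhs_t k1 Nt = (\<lambda>(u, \<theta>) x.
     laplacian \<theta> x + proj_t k1 Nt (\<lambda>y. u y $ 3) x - proj_t k1 Nt (advect u \<theta>) x)"

text \<open>The half-open interval \<open>[0, T)\<close>, where \<open>T = \<infinity>\<close> is allowed.\<close>

definition time_interval :: "ereal \<Rightarrow> real set" where
  "time_interval T = {t. 0 \<le> t \<and> ereal t < T}"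

text \<open>
  The model is a system of ODEs for the coefficients with respect to the orthonormal basis; the
  functions \<open>a'\<close> and \<open>b'\<close> are the time derivatives of the coefficients, so that \<open>vel_sum k1 Nu (a' t)\<close>
  and \<open>temp_sum k1 Nt (b' t)\<close> are the time derivatives of the two fields.
\<close>

definition solves :: "real \<Rightarrow> real \<Rightarrow> real \<Rightarrow> real \<Rightarrow> idx set \<Rightarrow> idx set
    \<Rightarrow> ereal \<Rightarrow> (real \<Rightarrow> state) \<Rightarrow> bool" where
  "solves R S P k1 Nu Nt T X \<longleftrightarrow>
     (\<forall>t\<in>time_interval T. X t \<in> phase_space k1 Nu Nt) \<and>
     (\<exists>a' b'. \<forall>t\<in>time_interval T.
        (\<forall>n\<in>Nu. ((\<lambda>s. vel_coeff k1 (fst (X s)) n) has_real_derivative a' t n)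
                   (at t within time_interval T)) \<and>
        (\<forall>n\<in>Nt. ((\<lambda>s. temp_coeff k1 (snd (X s)) n) has_real_derivative b' t n)
                   (at t within time_interval T)) \<and>
        vel_sum k1 Nu (a' t) = rhs_u R S P k1 Nu (X t) \<and>
        temp_sum k1 Nt (b' t) = rhs_t k1 Nt (X t))"

text \<open>Derivatives at the initial time are one-sided.\<close>

definition smooth_in_time :: "real set \<Rightarrow> (real \<Rightarrow> real) \<Rightarrow> bool" where
  "smooth_in_time J g \<longleftrightarrow> (\<exists>D. D (0::nat) = g \<and>
     (\<forall>k. \<forall>t\<in>J. (D k has_real_derivative D (Suc k) t) (at t within J)))"

definition smooth_curve :: "real \<Rightarrow> idx set \<Rightarrow> idx set \<Rightarrow> ereal \<Rightarrow> (real \<Rightarrow> state) \<Rightarrow> bool" where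
  "smooth_curve k1 Nu Nt T X \<longleftrightarrow>
     (\<forall>n\<in>Nu. smooth_in_time (time_interval T) (\<lambda>t. vel_coeff k1 (fst (X t)) n)) \<and>
     (\<forall>n\<in>Nt. smooth_in_time (time_interval T) (\<lambda>t. temp_coeff k1 (snd (X t)) n))"

section \<open>Potential energy equation and Energy Balance Criterion\<close>

text \<open>The equation is required along every solution, i.e. for every initial condition.\<close>

definition potential_energy_equation ::
    "real \<Rightarrow> real \<Rightarrow> real \<Rightarrow> real \<Rightarrow> idx set \<Rightarrow> idx set \<Rightarrow> bool" where
  "potential_energy_equation R S P k1 Nu Nt \<longleftrightarrow>
     (\<forall>T X. solves R S P k1 Nu Nt T X \<longrightarrow>
       (\<forall>t\<in>time_interval T.
          ((\<lambda>s. avg k1 (\<lambda>x. (1 - snd x / pi) * snd (X s) x)) has_real_derivative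
             (avg k1 (\<lambda>x. (1 - snd x / pi) * d3 (d3 (snd (X t))) x)
              - 1 / pi * avg k1 (\<lambda>x. (fst (X t) x $ 3) * snd (X t) x)))
          (at t within time_interval T)))"

definition energy_balance_criterion :: "idx set \<Rightarrow> idx set \<Rightarrow> bool" where
  "energy_balance_criterion Nu Nt \<longleftrightarrow>
     (\<forall>m1' m3' p' c' m1'' m3'' p'' c''.
        (m1', m3', p', c') \<in> Nu \<and> (m1'', m3'', p'', c'') \<in> Nt \<and>
        m1' = m1'' \<and> m1'' > 0 \<and> p' = p'' \<and> c' = 1 \<and> c'' = 1 \<longrightarrow>
        (m3' = m3'' \<longrightarrow> (0, 2 * m3', 1, 1) \<in> Nt) \<and>
        (m3' \<noteq> m3'' \<longrightarrow>
           ((0, nat \<bar>int m3' - int m3''\<bar>, 1, 1) \<in> Nt \<longleftrightarrow> (0, m3' + m3'', 1, 1) \<in> Nt)))"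

section \<open>Invariance, attraction, attractors\<close>

text \<open>
  The phase space carries the metric of \<open>L\<^sup>2(\<Omega>)\<close>.  The distance is also used for states outside the
  phase space, where it is meaningful only for square integrable ones, because \<open>integral\<close> returns
  \<open>0\<close> for a non-integrable function.
\<close>

definition L2_dist :: "real \<Rightarrow> state \<Rightarrow> state \<Rightarrow> real" where
  "L2_dist k1 X Y = sqrt (avg k1 (\<lambda>x. (norm (fst X x - fst Y x))\<^sup>2 + (snd X x - snd Y x)\<^sup>2))"

definition L2_state :: "real \<Rightarrow> state \<Rightarrow> bool" where
  "L2_state k1 X \<longleftrightarrow>
     set_borel_measurable lborel (Omega k1) (fst X) \<and>
     set_borel_measurable lborel (Omega k1) (snd X) \<and>
     set_integrable lborel (Omega k1) (\<lambda>x. (norm (fst X x))\<^sup>2) \<and>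
     set_integrable lborel (Omega k1) (\<lambda>x. (snd X x)\<^sup>2)"

definition dist_to :: "('a \<Rightarrow> 'a \<Rightarrow> real) \<Rightarrow> 'a \<Rightarrow> 'a set \<Rightarrow> real" where
  "dist_to d z Y = (INF y\<in>Y. d z y)"

definition forward_invariant :: "real \<Rightarrow> real \<Rightarrow> real \<Rightarrow> real \<Rightarrow> idx set \<Rightarrow> idx set
    \<Rightarrow> state set \<Rightarrow> bool" where
  "forward_invariant R S P k1 Nu Nt B \<longleftrightarrow>
     (\<forall>T X. solves R S P k1 Nu Nt T X \<and> X 0 \<in> B \<longrightarrow> (\<forall>t\<in>time_interval T. X t \<in> B))"

definition monotonically_attracts :: "real \<Rightarrow> real \<Rightarrow> real \<Rightarrow> real \<Rightarrow> idx set \<Rightarrow> idx set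
    \<Rightarrow> state set \<Rightarrow> bool" where
  "monotonically_attracts R S P k1 Nu Nt B \<longleftrightarrow> B \<noteq> {} \<and>
     (\<forall>T X. solves R S P k1 Nu Nt T X \<longrightarrow>
        (\<forall>s\<in>time_interval T. \<forall>t\<in>time_interval T. s < t \<and> X s \<notin> B \<longrightarrow>
           dist_to (L2_dist k1) (X t) B < dist_to (L2_dist k1) (X s) B)) \<and>
     (\<forall>X. solves R S P k1 Nu Nt \<infinity> X \<longrightarrow>
        ((\<lambda>t. dist_to (L2_dist k1) (X t) B) \<longlongrightarrow> 0) at_top)"

definition flow :: "real \<Rightarrow> real \<Rightarrow> real \<Rightarrow> real \<Rightarrow> idx set \<Rightarrow> idx set
    \<Rightarrow> real \<Rightarrow> state \<Rightarrow> state" where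
  "flow R S P k1 Nu Nt t X0 =
     (THE Y. \<exists>X. solves R S P k1 Nu Nt \<infinity> X \<and> X 0 = X0 \<and> Y = X t)"

definition semigroup_on :: "'a set \<Rightarrow> (real \<Rightarrow> 'a \<Rightarrow> 'a) \<Rightarrow> bool" where
  "semigroup_on M F \<longleftrightarrow>
     (\<forall>t\<ge>0. F t ` M \<subseteq> M) \<and> (\<forall>x\<in>M. F 0 x = x) \<and>
     (\<forall>s\<ge>0. \<forall>t\<ge>0. \<forall>x\<in>M. F (s + t) x = F s (F t x))"

definition functionally_invariant :: "(real \<Rightarrow> 'a \<Rightarrow> 'a) \<Rightarrow> 'a set \<Rightarrow> bool" where
  "functionally_invariant F Y \<longleftrightarrow> (\<forall>t>0. F t ` Y = Y)"

text \<open>Attraction is pointwise in \<open>Z\<close>.  An infimum over the empty set counts as infinite.\<close>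

definition attracts :: "('a \<Rightarrow> 'a \<Rightarrow> real) \<Rightarrow> (real \<Rightarrow> 'a \<Rightarrow> 'a) \<Rightarrow> 'a set \<Rightarrow> 'a set \<Rightarrow> bool" where
  "attracts d F Y Z \<longleftrightarrow> Y \<noteq> {} \<and> (\<forall>z\<in>Z. ((\<lambda>t. dist_to d (F t z) Y) \<longlongrightarrow> 0) at_top)"

text \<open>
  \<open>A\<close> is the largest bounded functionally invariant set attracting all bounded sets.  Without
  boundedness the largest such set may be the whole space: for instance the solution operators
  \<open>\<theta>\<^sub>0 \<mapsto> exp (- t) \<theta>\<^sub>0\<close> on the line, which arise from a single temperature mode, are surjective.
\<close>

definition global_attractor ::
    "'a set \<Rightarrow> ('a \<Rightarrow> 'a \<Rightarrow> real) \<Rightarrow> (real \<Rightarrow> 'a \<Rightarrow> 'a) \<Rightarrow> 'a set \<Rightarrow> bool" where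
  "global_attractor M d F A \<longleftrightarrow>
     (let attracting_invariant = (\<lambda>Y. Metric_space.mbounded M d Y \<and> functionally_invariant F Y \<and>
            (\<forall>Z. Metric_space.mbounded M d Z \<longrightarrow> attracts d F Y Z))
      in attracting_invariant A \<and> (\<forall>Y. attracting_invariant Y \<longrightarrow> Y \<subseteq> A))"

text \<open>
  The part of the \<open>L\<^sup>2(\<Omega>)\<close>-ball with centre \<open>C\<close> and radius \<open>r\<close> that lies in the phase space.  The centre
  need not lie in the phase space; if \<open>C\<close> is square integrable and the set contains a point at
  distance less than \<open>r\<close> from \<open>C\<close>, it is a closed ball of positive radius in the phase space, centred
  at the orthogonal projection of \<open>C\<close>.
\<close>

definition phase_ball :: "real \<Rightarrow> idx set \<Rightarrow> idx set \<Rightarrow> state \<Rightarrow> real \<Rightarrow> state set" where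
  "phase_ball k1 Nu Nt C r = {Y \<in> phase_space k1 Nu Nt. L2_dist k1 Y C \<le> r}"

end

theory Submission
  imports Defs
begin

text \<open>
  The nonlinear terms and the Coriolis term conserve the energy, so the \<open>L\<^sup>2\<close>-norm of the coefficients
  grows at most exponentially and solutions exist for all times, for every choice of the index sets:
  one cuts the quadratic vector field off outside a large ball, solves the resulting globally Lipschitz
  equation and observes that the solution never reaches the cutoff.

  Tested against \<open>1 - x\<^sub>3/\<pi>\<close>, whose sine coefficients are \<open>1/m\<close>, the projected advection term equals
  \<open>-2/\<pi>\<close> times the sum of \<open>\<langle>u\<^sub>3 \<theta> cos (m x\<^sub>3)\<rangle>\<close> over the modes \<open>(0, m, 1, 1)\<close> in the model.  The potential
  energy equation therefore says that the bilinear form \<open>\<langle>u\<^sub>3 \<theta> \<psi>\<rangle>\<close> with \<open>\<psi> = 1 + 2 \<Sum> cos (m x\<^sub>3)\<close> vanishes,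
  and evaluating it on pairs of basis functions yields the Energy Balance Criterion.

  Given this equation, the squared distance to \<open>(0, - \<pi> (1 + P R) (1 - x\<^sub>3/\<pi>))\<close> is a Lyapunov function:
  the heat flux terms cancel, and the remaining boundary term is linear in the finitely many modes
  independent of \<open>x\<^sub>1\<close>, hence absorbed by the dissipation up to a constant proportional to their number.
\<close>

section \<open>Ordinary differential equations with polynomial right-hand side\<close>

text \<open>Two requirements shape the development. The number of unknowns is the size of arbitrary
  finite index sets and cannot be read off a type; the differential equation is therefore posed on
  families indexed by a finite set, and existence is obtained in one Banach space that houses all
  dimensions. Secondly, the ball may depend on the index sets only through the number of temperature
  modes. Its center is for this reason the full affine profile and not its projection to the model.
  By Pythagoras, the distance of this center from the phase space enters the squared radius as an
  additive constant, and it is at most the norm of the center. The boundary term respects the same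
  restriction: the weight contributes 1/m and the Laplacian m^2 to the mode (0, m, 1, 1), so the
  linear term is a fixed constant times m times the coefficient. The dissipation is quadratic in
  just this product, hence every mode costs the same constant whatever its wave number, and only the
  number of modes counts.\<close>

lemma lipschitz_ode_exists:
  fixes f :: "'a::banach \<Rightarrow> 'a"
  assumes lip: "\<And>x y. norm (f x - f y) \<le> L * norm (x - y)" and L: "L > 0" and T: "0 \<le> T"
  obtains x where "x 0 = x0"
    "\<And>t. t \<in> {0..T} \<Longrightarrow> (x has_vector_derivative f (x t)) (at t within {0..T})"
proof -
  \<comment> \<open>Bounded continuous functions are total on the line; freezing time outside [0, T]
    extends the Picard operator to all of it.\<close>
  define u where "u t = max 0 (min T t)" for t :: real
  have u: "u t \<in> {0..T}" for t using T by (auto simp: u_def)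
  have u_id: "u t = t" if "t \<in> {0..T}" for t using that by (auto simp: u_def)
  have contu: "continuous_on UNIV u" unfolding u_def by (intro continuous_intros)
  have contf: "continuous_on UNIV f"
  proof (rule continuous_on_iff[THEN iffD2], intro ballI allI impI)
    fix x and e :: real assume "e > 0"
    show "\<exists>d>0. \<forall>x'\<in>UNIV. dist x' x < d \<longrightarrow> dist (f x') (f x) < e"
    proof (intro exI[of _ "e / L"] conjI ballI impI)
      show "e / L > 0" using L \<open>e > 0\<close> by simp
      fix y assume "dist y x < e / L"
      then have "L * norm (y - x) < e" using L by (simp add: dist_norm field_simps)
      then show "dist (f y) (f x) < e" using lip[of y x] by (simp add: dist_norm)
    qed
  qed
  \<comment> \<open>The unknown is z(t) = exp(-2Lt) x(t). With this exponential weight the Picard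
    operator contracts on all of [0, T], however large T is, and no short-time solutions have to be
    glued.\<close>
  define h where "h z s = f (exp (2 * L * s) *\<^sub>R apply_bcontfun z s)" for z :: "real \<Rightarrow>\<^sub>C 'a" and s
  have conth: "continuous_on S (h z)" for S z
    unfolding h_def
    by (rule continuous_on_compose2[OF contf]) (auto intro!: continuous_intros)
  have inth: "h z integrable_on {0..b}" for z b
    by (intro integrable_continuous_interval conth)
  define g where "g z t = exp (- (2 * L * t)) *\<^sub>R (x0 + integral {0..t} (h z))" for z t
  have contg: "continuous_on {0..T} (g z)" for z
    unfolding g_def by (intro continuous_intros indefinite_integral_continuous_1 inth)
  have contgu: "continuous_on UNIV (\<lambda>t. g z (u t))" for z
    by (rule continuous_on_compose2[OF contg contu]) (use u in auto)
  have gb: "(\<lambda>t. g z (u t)) \<in> bcontfun" for z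
  proof -
    have "compact (g z ` {0..T})" by (intro compact_continuous_image contg) auto
    then have "bounded (g z ` {0..T})" by (rule compact_imp_bounded)
    then have "bounded (range (\<lambda>t. g z (u t)))" by (rule bounded_subset) (use u in auto)
    then show ?thesis using contgu by (simp add: bcontfun_def)
  qed
  define G where "G z = Bcontfun (\<lambda>t. g z (u t))" for z
  have G: "apply_bcontfun (G z) t = g z (u t)" for z t
    unfolding G_def using gb by (simp add: Bcontfun_inverse)
  \<comment> \<open>The factor 1/2 is L/(2L): integrating L exp(2Ls) up to t gives less than
    exp(2Lt)/2, and the outer weight exp(-2Lt) removes the exponential.\<close>
  have "dist (G z) (G w) \<le> 1 / 2 * dist z w" for z w
  proof (rule dist_bound)
    fix t
    define D where "D = dist z w"
    have D: "D \<ge> 0" "norm (apply_bcontfun z s - apply_bcontfun w s) \<le> D" for s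
      unfolding D_def dist_norm[symmetric] by (auto intro: dist_bounded)
    define v where "v = u t"
    have v: "0 \<le> v" using u[of t] by (auto simp: v_def)
    have "((\<lambda>s. exp (2 * L * s) * D / 2) has_vector_derivative L * D * exp (2 * L * s)) (at s within {0..v})" for s
      unfolding has_real_derivative_iff_has_vector_derivative[symmetric]
      by (auto intro!: derivative_eq_intros)
    from fundamental_theorem_of_calculus[OF v this]
    have I: "((\<lambda>s. L * D * exp (2 * L * s)) has_integral (exp (2 * L * v) * D / 2 - D / 2)) {0..v}"
      by simp
    have hd: "norm (h z s - h w s) \<le> L * D * exp (2 * L * s)" for s
    proof -
      have "norm (h z s - h w s) \<le> L * norm (exp (2 * L * s) *\<^sub>R apply_bcontfun z s - exp (2 * L * s) *\<^sub>R apply_bcontfun w s)"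
        unfolding h_def by (rule lip)
      also have "\<dots> = L * (exp (2 * L * s) * norm (apply_bcontfun z s - apply_bcontfun w s))"
        by (simp add: scaleR_diff_right[symmetric])
      also have "\<dots> \<le> L * (exp (2 * L * s) * D)"
        using L D(2) by (intro mult_left_mono) auto
      finally show ?thesis by (simp add: mult_ac)
    qed
    have "norm (integral {0..v} (\<lambda>s. h z s - h w s)) \<le> integral {0..v} (\<lambda>s. L * D * exp (2 * L * s))"
      by (rule integral_norm_bound_integral) (use hd in \<open>auto intro!: integrable_diff inth has_integral_integrable[OF I]\<close>)
    also have "\<dots> = exp (2 * L * v) * D / 2 - D / 2" using I by (rule integral_unique)
    finally have *: "norm (integral {0..v} (h z) - integral {0..v} (h w)) \<le> exp (2 * L * v) * D / 2"
      using D(1) by (simp add: integral_diff[OF inth inth])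
    have "dist (apply_bcontfun (G z) t) (apply_bcontfun (G w) t)
        = exp (- (2 * L * v)) * norm (integral {0..v} (h z) - integral {0..v} (h w))"
      unfolding G g_def v_def[symmetric] dist_norm by (simp add: scaleR_diff_right[symmetric])
    also have "\<dots> \<le> exp (- (2 * L * v)) * (exp (2 * L * v) * D / 2)"
      using * by (intro mult_left_mono) auto
    also have "\<dots> = 1 / 2 * D" by (simp add: exp_minus field_simps)
    finally show "dist (apply_bcontfun (G z) t) (apply_bcontfun (G w) t) \<le> 1 / 2 * dist z w"
      by (simp add: D_def)
  qed
  then obtain z where z: "G z = z"
    using banach_fix_type[of "1 / 2" G] by auto
  define x where "x t = x0 + integral {0..t} (h z)" for t
  have xz: "exp (2 * L * t) *\<^sub>R apply_bcontfun z t = x t" if "t \<in> {0..T}" for t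
  proof -
    have "apply_bcontfun z t = exp (- (2 * L * t)) *\<^sub>R x t"
      using G[of z t] u_id[OF that] by (simp add: z g_def x_def)
    then show ?thesis by (simp add: exp_minus)
  qed
  have "(x has_vector_derivative f (x t)) (at t within {0..T})" if t: "t \<in> {0..T}" for t
  proof -
    have "((\<lambda>t. integral {0..t} (h z)) has_vector_derivative h z t) (at t within {0..T})"
      by (rule integral_has_vector_derivative[OF conth t])
    then have "(x has_vector_derivative h z t) (at t within {0..T})"
      unfolding x_def by (auto intro!: derivative_eq_intros)
    then show ?thesis using xz[OF t] by (simp add: h_def)
  qed
  moreover have "x 0 = x0" by (simp add: x_def)
  ultimately show ?thesis using that by blast
qed

section \<open>Polynomial fields made globally Lipschitz\<close>

definition bounded_lipschitz :: "'i set \<Rightarrow> (('i \<Rightarrow> real) \<Rightarrow> real) \<Rightarrow> bool" where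
  "bounded_lipschitz I g \<longleftrightarrow>
     (\<exists>L M. \<forall>x y. \<bar>g x\<bar> \<le> M \<and> \<bar>g x - g y\<bar> \<le> L * (\<Sum>i\<in>I. \<bar>x i - y i\<bar>))"

lemma bounded_lipschitzE:
  assumes "bounded_lipschitz I g"
  obtains L M where "L \<ge> 0" "M \<ge> 0" "\<And>x. \<bar>g x\<bar> \<le> M"
    "\<And>x y. \<bar>g x - g y\<bar> \<le> L * (\<Sum>i\<in>I. \<bar>x i - y i\<bar>)"
proof -
  from assms obtain L M where LM: "\<And>x. \<bar>g x\<bar> \<le> M" "\<And>x y. \<bar>g x - g y\<bar> \<le> L * (\<Sum>i\<in>I. \<bar>x i - y i\<bar>)"
    unfolding bounded_lipschitz_def by blast
  show ?thesis
  proof (rule that[of "max 0 L" "max 0 M"])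
    show "\<bar>g x - g y\<bar> \<le> max 0 L * (\<Sum>i\<in>I. \<bar>x i - y i\<bar>)" for x y
      by (rule order_trans[OF LM(2)]) (intro mult_right_mono sum_nonneg, auto)
    show "\<bar>g x\<bar> \<le> max 0 M" for x using LM(1)[of x] by simp
  qed auto
qed

lemma bounded_lipschitz_const: "bounded_lipschitz I (\<lambda>_. c)"
  unfolding bounded_lipschitz_def by (rule exI[of _ 0], rule exI[of _ "\<bar>c\<bar>"]) auto

lemma bounded_lipschitz_add:
  assumes "bounded_lipschitz I g" "bounded_lipschitz I h"
  shows "bounded_lipschitz I (\<lambda>x. g x + h x)"
proof -
  from assms(1) obtain L M where g: "L \<ge> 0" "M \<ge> 0" "\<And>x. \<bar>g x\<bar> \<le> M"
    "\<And>x y. \<bar>g x - g y\<bar> \<le> L * (\<Sum>i\<in>I. \<bar>x i - y i\<bar>)" by (rule bounded_lipschitzE) blast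
  from assms(2) obtain L' M' where h: "L' \<ge> 0" "M' \<ge> 0" "\<And>x. \<bar>h x\<bar> \<le> M'"
    "\<And>x y. \<bar>h x - h y\<bar> \<le> L' * (\<Sum>i\<in>I. \<bar>x i - y i\<bar>)" by (rule bounded_lipschitzE) blast
  have "\<bar>g x + h x\<bar> \<le> M + M' \<and> \<bar>(g x + h x) - (g y + h y)\<bar> \<le> (L + L') * (\<Sum>i\<in>I. \<bar>x i - y i\<bar>)" for x y
    using g(3)[of x] h(3)[of x] g(4)[of x y] h(4)[of x y] by (auto simp: distrib_right)
  then show ?thesis unfolding bounded_lipschitz_def by blast
qed

text \<open>This is where boundedness has to accompany the Lipschitz condition: splitting the
  difference of products as g x (h x - h y) + (g x - g y) h y needs bounds on both factors.\<close>

lemma bounded_lipschitz_mult: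
  assumes "bounded_lipschitz I g" "bounded_lipschitz I h"
  shows "bounded_lipschitz I (\<lambda>x. g x * h x)"
proof -
  from assms(1) obtain L M where g: "L \<ge> 0" "M \<ge> 0" "\<And>x. \<bar>g x\<bar> \<le> M"
    "\<And>x y. \<bar>g x - g y\<bar> \<le> L * (\<Sum>i\<in>I. \<bar>x i - y i\<bar>)" by (rule bounded_lipschitzE) blast
  from assms(2) obtain L' M' where h: "L' \<ge> 0" "M' \<ge> 0" "\<And>x. \<bar>h x\<bar> \<le> M'"
    "\<And>x y. \<bar>h x - h y\<bar> \<le> L' * (\<Sum>i\<in>I. \<bar>x i - y i\<bar>)" by (rule bounded_lipschitzE) blast
  have "\<bar>g x * h x\<bar> \<le> M * M' \<and>
      \<bar>g x * h x - g y * h y\<bar> \<le> (M * L' + L * M') * (\<Sum>i\<in>I. \<bar>x i - y i\<bar>)" for x y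
  proof
    show "\<bar>g x * h x\<bar> \<le> M * M'" unfolding abs_mult by (intro mult_mono g h abs_ge_zero)
    define s where "s = (\<Sum>i\<in>I. \<bar>x i - y i\<bar>)"
    have s: "s \<ge> 0" unfolding s_def by (intro sum_nonneg) auto
    have "g x * h x - g y * h y = g x * (h x - h y) + (g x - g y) * h y" by (simp add: algebra_simps)
    also have "\<bar>\<dots>\<bar> \<le> \<bar>g x\<bar> * \<bar>h x - h y\<bar> + \<bar>g x - g y\<bar> * \<bar>h y\<bar>"
      unfolding abs_mult[symmetric] by (rule abs_triangle_ineq)
    also have "\<dots> \<le> M * (L' * s) + (L * s) * M'"
      using g h s by (intro add_mono mult_mono) (auto simp: s_def)
    finally show "\<bar>g x * h x - g y * h y\<bar> \<le> (M * L' + L * M') * s" by (simp add: algebra_simps)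
  qed
  then show ?thesis unfolding bounded_lipschitz_def by blast
qed

definition clamp_to :: "real \<Rightarrow> real \<Rightarrow> real" where
  "clamp_to r s = max (- r) (min r s)"

lemma clamp_to_id: "\<bar>s\<bar> \<le> r \<Longrightarrow> clamp_to r s = s"
  by (auto simp: clamp_to_def)

lemma clamp_to_lipschitz: "\<bar>clamp_to r s - clamp_to r t\<bar> \<le> \<bar>s - t\<bar>"
  by (auto simp: clamp_to_def max_def min_def)

lemma bounded_lipschitz_clamp:
  assumes "finite I" "i \<in> I"
  shows "bounded_lipschitz I (\<lambda>x. clamp_to r (x i))"
proof -
  have "\<bar>clamp_to r (x i) - clamp_to r (y i)\<bar> \<le> 1 * (\<Sum>i\<in>I. \<bar>x i - y i\<bar>)" for x y
    using order_trans[OF clamp_to_lipschitz[of r "x i" "y i"]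
      member_le_sum[of i I "\<lambda>i. \<bar>x i - y i\<bar>"]] assms by auto
  moreover have "\<bar>clamp_to r (x i)\<bar> \<le> \<bar>r\<bar>" for x by (auto simp: clamp_to_def)
  ultimately show ?thesis unfolding bounded_lipschitz_def by blast
qed

text \<open>Clamping the coordinates alone would make a polynomial Lipschitz but could destroy the
  energy inequality. Multiplying in addition by this scalar, which vanishes once the absolute sum
  reaches \<open>r + 1\<close>, leaves a multiple of the original field with a factor in [0, 1], and
  that preserves the energy estimate.\<close>

definition cutoff :: "'i set \<Rightarrow> real \<Rightarrow> ('i \<Rightarrow> real) \<Rightarrow> real" where
  "cutoff I r x = max 0 (min 1 (r + 1 - (\<Sum>i\<in>I. \<bar>x i\<bar>)))"

lemma bounded_lipschitz_cutoff: "bounded_lipschitz I (cutoff I r)"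
proof -
  have "\<bar>cutoff I r x - cutoff I r y\<bar> \<le> 1 * (\<Sum>i\<in>I. \<bar>x i - y i\<bar>)" for x y
  proof -
    have "\<bar>cutoff I r x - cutoff I r y\<bar> \<le> \<bar>(\<Sum>i\<in>I. \<bar>x i\<bar>) - (\<Sum>i\<in>I. \<bar>y i\<bar>)\<bar>"
      by (auto simp: cutoff_def max_def min_def)
    also have "\<dots> \<le> (\<Sum>i\<in>I. \<bar>\<bar>x i\<bar> - \<bar>y i\<bar>\<bar>)"
      unfolding sum_subtractf[symmetric] by (rule sum_abs)
    also have "\<dots> \<le> (\<Sum>i\<in>I. \<bar>x i - y i\<bar>)" by (intro sum_mono) auto
    finally show ?thesis by simp
  qed
  moreover have "\<bar>cutoff I r x\<bar> \<le> 1" for x by (auto simp: cutoff_def)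
  ultimately show ?thesis unfolding bounded_lipschitz_def by blast
qed

text \<open>Closure rules suffice as a description of polynomials: local Lipschitz bounds,
  dependence on the coordinates in \<open>I\<close> only, and the fact that derivatives along
  solutions are again polynomial all follow by induction.\<close>

inductive polyfun :: "'i set \<Rightarrow> (('i \<Rightarrow> real) \<Rightarrow> real) \<Rightarrow> bool" for I where
  const: "polyfun I (\<lambda>_. c)"
| coord: "i \<in> I \<Longrightarrow> polyfun I (\<lambda>x. x i)"
| add: "polyfun I p \<Longrightarrow> polyfun I q \<Longrightarrow> polyfun I (\<lambda>x. p x + q x)"
| mult: "polyfun I p \<Longrightarrow> polyfun I q \<Longrightarrow> polyfun I (\<lambda>x. p x * q x)"

lemma polyfun_sum:
  assumes "\<And>j. j \<in> J \<Longrightarrow> polyfun I (p j)"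
  shows "polyfun I (\<lambda>x. \<Sum>j\<in>J. p j x)"
proof (cases "finite J")
  case True
  then show ?thesis using assms
    by (induction J rule: finite_induct) (auto intro: polyfun.intros)
qed (simp add: polyfun.const)

lemma polyfun_cmult: "polyfun I p \<Longrightarrow> polyfun I (\<lambda>x. c * p x)"
  by (rule polyfun.mult[OF polyfun.const])

lemma polyfun_diff:
  assumes "polyfun I p" "polyfun I q" shows "polyfun I (\<lambda>x. p x - q x)"
  using polyfun.add[OF assms(1) polyfun_cmult[OF assms(2), of "-1"]] by simp

lemma polyfun_bounded_lipschitz:
  assumes "finite I" "polyfun I p"
  shows "bounded_lipschitz I (\<lambda>x. p (\<lambda>i. clamp_to r (x i)))"
  using assms(2)
  by induction (auto intro: bounded_lipschitz_const bounded_lipschitz_clamp[OF assms(1)]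
      bounded_lipschitz_add bounded_lipschitz_mult)

lemma polyfun_cong: "polyfun I p \<Longrightarrow> (\<And>i. i \<in> I \<Longrightarrow> x i = y i) \<Longrightarrow> p x = p y"
  by (induction rule: polyfun.induct) auto

lemma polyfun_locally_lipschitz:
  assumes "finite I" "polyfun I p"
  obtains L where "L \<ge> 0" "\<And>x y. (\<And>i. i \<in> I \<Longrightarrow> \<bar>x i\<bar> \<le> r) \<Longrightarrow> (\<And>i. i \<in> I \<Longrightarrow> \<bar>y i\<bar> \<le> r) \<Longrightarrow>
    \<bar>p x - p y\<bar> \<le> L * (\<Sum>i\<in>I. \<bar>x i - y i\<bar>)"
proof -
  from bounded_lipschitzE[OF polyfun_bounded_lipschitz[OF assms, of r]]
  obtain L where L: "L \<ge> 0"
    "\<And>x y. \<bar>p (\<lambda>i. clamp_to r (x i)) - p (\<lambda>i. clamp_to r (y i))\<bar> \<le> L * (\<Sum>i\<in>I. \<bar>x i - y i\<bar>)" by metis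
  show ?thesis
  proof (rule that[OF L(1)])
    fix x y assume *: "\<And>i. i \<in> I \<Longrightarrow> \<bar>x i\<bar> \<le> r" "\<And>i. i \<in> I \<Longrightarrow> \<bar>y i\<bar> \<le> r"
    have "p (\<lambda>i. clamp_to r (x i)) = p x" "p (\<lambda>i. clamp_to r (y i)) = p y"
      using * by (auto intro!: polyfun_cong[OF assms(2)] clamp_to_id)
    then show "\<bar>p x - p y\<bar> \<le> L * (\<Sum>i\<in>I. \<bar>x i - y i\<bar>)" using L(2)[of x y] by simp
  qed
qed

text \<open>The product of \<open>g\<close> with the decaying exponential is nonincreasing, whatever
  the signs of \<open>g\<close> and \<open>K\<close>. A positive \<open>K\<close> yields growth
  bounds, a negative one the decay towards the absorbing ball.\<close>

lemma gronwall:
  fixes g g' :: "real \<Rightarrow> real"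
  assumes "\<And>t. t \<in> {a..b} \<Longrightarrow> (g has_real_derivative g' t) (at t within {a..b})"
    and "\<And>t. t \<in> {a..b} \<Longrightarrow> g' t \<le> K * g t" and t: "t \<in> {a..b}"
  shows "g t \<le> g a * exp (K * (t - a))"
proof -
  have D: "((\<lambda>t. g t * exp (- (K * (t - a)))) has_real_derivative (g' s - K * g s) * exp (- (K * (s - a)))) (at s within {a..b})"
    if "s \<in> {a..b}" for s
    using assms(1)[OF that] by (auto intro!: derivative_eq_intros simp: algebra_simps)
  have c: "continuous_on {a..t} (\<lambda>t. g t * exp (- (K * (t - a))))"
    by (rule continuous_on_subset[OF DERIV_continuous_on[OF D]]) (use t in auto)
  have "g t * exp (- (K * (t - a))) \<le> g a * exp (- (K * (a - a)))"
  proof (rule DERIV_nonpos_imp_decreasing_open[OF _ _ c])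
    fix s assume s: "a < s" "s < t"
    then have "s \<in> interior {a..b}" using t by auto
    then have "at s within {a..b} = at s" by (rule at_within_interior)
    then have "((\<lambda>t. g t * exp (- (K * (t - a)))) has_real_derivative (g' s - K * g s) * exp (- (K * (s - a)))) (at s)"
      using D[of s] s t by auto
    moreover have "(g' s - K * g s) * exp (- (K * (s - a))) \<le> 0"
      using assms(2)[of s] s t by (intro mult_nonpos_nonneg) auto
    ultimately show "\<exists>y. ((\<lambda>t. g t * exp (- (K * (t - a)))) has_real_derivative y) (at s) \<and> y \<le> 0" by blast
  qed (use t in auto)
  then have "g t * exp (- (K * (t - a))) * exp (K * (t - a)) \<le> g a * exp (K * (t - a))" by (intro mult_right_mono) auto
  then show ?thesis by (simp add: exp_minus mult.assoc)
qed

section \<open>A Banach space containing every finite number of coordinates\<close>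

lemma bounded_linear_apply_bcontfun:
  "bounded_linear (\<lambda>c :: 'a::topological_space \<Rightarrow>\<^sub>C 'b::real_normed_vector. apply_bcontfun c k)"
  by (rule bounded_linear_intro[of _ 1]) (auto intro: norm_bounded)

instance bcontfun :: (metric_space, banach) banach ..

text \<open>The hat functions at the natural numbers embed the coordinate vectors over any finite
  index set into the bounded continuous functions; countability of the index type assigns a natural
  number to each coordinate.\<close>

definition tent :: "nat \<Rightarrow> real \<Rightarrow>\<^sub>C real" where
  "tent k = Bcontfun (\<lambda>s. max 0 (1 - \<bar>s - real k\<bar>))"

lemma apply_tent: "apply_bcontfun (tent k) s = max 0 (1 - \<bar>s - real k\<bar>)"
proof -
  have "(\<lambda>s. max 0 (1 - \<bar>s - real k\<bar>)) \<in> bcontfun"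
    by (rule bcontfun_normI[of _ 1]) (auto intro!: continuous_intros)
  then show ?thesis unfolding tent_def by (simp add: Bcontfun_inverse)
qed

lemma apply_tent_nat: "apply_bcontfun (tent k) (real j) = (if j = k then 1 else 0)"
  by (cases "j < k") (auto simp: apply_tent)

lemma norm_tent: "norm (tent k) \<le> 1"
  by (rule norm_bound) (auto simp: apply_tent)

text \<open>The inequality \<open>energy\<close> is what rules out blow-up in finite time for a
  superlinear field: along a solution the squared norm grows at most like exp(2 \<kappa> t).\<close>

locale poly_ode =
  fixes I :: "'i::countable set" and F :: "('i \<Rightarrow> real) \<Rightarrow> 'i \<Rightarrow> real" and \<kappa> :: real
  assumes finI: "finite I"
    and poly: "\<And>i. i \<in> I \<Longrightarrow> polyfun I (\<lambda>x. F x i)"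
    and energy: "\<And>x. (\<Sum>i\<in>I. x i * F x i) \<le> \<kappa> * (\<Sum>i\<in>I. (x i)\<^sup>2)"
begin

definition is_sol :: "real set \<Rightarrow> (real \<Rightarrow> 'i \<Rightarrow> real) \<Rightarrow> bool" where
  "is_sol J x \<longleftrightarrow>
     (\<forall>t\<in>J. \<forall>i\<in>I. ((\<lambda>s. x s i) has_real_derivative F (x t) i) (at t within J))"

lemma is_sol_subset: "is_sol J x \<Longrightarrow> J' \<subseteq> J \<Longrightarrow> is_sol J' x"
  unfolding is_sol_def by (meson DERIV_subset subsetD)

lemma F_cong: "i \<in> I \<Longrightarrow> (\<And>j. j \<in> I \<Longrightarrow> x j = y j) \<Longrightarrow> F x i = F y i"
  by (rule polyfun_cong[OF poly])

lemma square_le_sum: "i \<in> I \<Longrightarrow> (x i)\<^sup>2 \<le> (\<Sum>i\<in>I. (x i :: real)\<^sup>2)"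
  by (rule member_le_sum) (use finI in auto)

lemma exists_on_interval:
  assumes T: "0 \<le> T"
  obtains x where "\<And>i. i \<in> I \<Longrightarrow> x 0 i = x0 i" "is_sol {0..T} x"
proof -
  define \<kappa>' where "\<kappa>' = max \<kappa> 0"
  \<comment> \<open>The energy estimate will bound the Euclidean norm by \<open>r1\<close> up to
    time \<open>T\<close>; every coordinate is then at most \<open>r1\<close> in absolute value and
    the absolute sum at most \<open>r\<close>, where the cutoff still equals 1. Replacing \<kappa>
    by its positive part makes the bound at time \<open>T\<close> valid at all earlier
    times.\<close>
  define r1 where "r1 = sqrt ((\<Sum>i\<in>I. (x0 i)\<^sup>2) * exp (2 * \<kappa>' * T))"
  define r where "r = card I * r1"
  define g where "g i x = F (\<lambda>j. clamp_to (r + 1) (x j)) i * cutoff I r x" for i and x :: "'i \<Rightarrow> real"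
  have bl: "bounded_lipschitz I (g i)" if "i \<in> I" for i
    unfolding g_def
    by (rule bounded_lipschitz_mult[OF polyfun_bounded_lipschitz[OF finI poly[OF that]]
          bounded_lipschitz_cutoff])
  have "\<forall>i\<in>I. \<exists>p. fst p \<ge> 0 \<and> snd p \<ge> 0 \<and> (\<forall>x. \<bar>g i x\<bar> \<le> snd p) \<and>
      (\<forall>x y. \<bar>g i x - g i y\<bar> \<le> fst p * (\<Sum>i\<in>I. \<bar>x i - y i\<bar>))"
    by (intro ballI, rule bounded_lipschitzE[OF bl], assumption) auto
  from bchoice[OF this] obtain p where
    p: "\<And>i. i \<in> I \<Longrightarrow> fst (p i) \<ge> 0 \<and> snd (p i) \<ge> 0 \<and> (\<forall>x. \<bar>g i x\<bar> \<le> snd (p i)) \<and>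
      (\<forall>x y. \<bar>g i x - g i y\<bar> \<le> fst (p i) * (\<Sum>i\<in>I. \<bar>x i - y i\<bar>))"
    by blast
  define L M where "L i = fst (p i)" and "M i = snd (p i)" for i
  have LM: "\<And>i. i \<in> I \<Longrightarrow> L i \<ge> 0" "\<And>i. i \<in> I \<Longrightarrow> M i \<ge> 0"
      "\<And>i x. i \<in> I \<Longrightarrow> \<bar>g i x\<bar> \<le> M i"
      "\<And>i x y. i \<in> I \<Longrightarrow> \<bar>g i x - g i y\<bar> \<le> L i * (\<Sum>i\<in>I. \<bar>x i - y i\<bar>)"
    unfolding L_def M_def using p by blast+
  text \<open>A Banach space is needed in which the coordinates are bounded functionals; the functions
    \<^term>\<open>tent k\<close> with evaluation at the integers serve as a biorthogonal system.\<close>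
  define co where "co c i = apply_bcontfun c (real (to_nat i))" for c :: "real \<Rightarrow>\<^sub>C real" and i :: 'i
  have co_tents: "co (\<Sum>i\<in>I. h i *\<^sub>R tent (to_nat i)) j = h j" if "j \<in> I" for h j
  proof -
    have "co (\<Sum>i\<in>I. h i *\<^sub>R tent (to_nat i)) j = (\<Sum>i\<in>I. h i * apply_bcontfun (tent (to_nat i)) (real (to_nat j)))"
      unfolding co_def by (simp add: linear_sum[OF bounded_linear.linear[OF bounded_linear_apply_bcontfun]])
    also have "\<dots> = (\<Sum>i\<in>I. if j = i then h i else 0)"
      by (intro sum.cong) (auto simp: apply_tent_nat)
    finally show ?thesis using that finI by simp
  qed
  define f where "f c = (\<Sum>i\<in>I. g i (co c) *\<^sub>R tent (to_nat i))" for c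
  define LL where "LL = 1 + (\<Sum>i\<in>I. L i) * card I"
  have LL: "LL > 0" unfolding LL_def using LM by (intro add_pos_nonneg mult_nonneg_nonneg sum_nonneg) auto
  have lip: "norm (f c - f d) \<le> LL * norm (c - d)" for c d
  proof -
    have s: "(\<Sum>i\<in>I. \<bar>co c i - co d i\<bar>) \<le> card I * norm (c - d)"
      unfolding co_def by (rule sum_bounded_above) (use norm_bounded[of "c - d"] in auto)
    have "norm (f c - f d) \<le> (\<Sum>i\<in>I. norm ((g i (co c) - g i (co d)) *\<^sub>R tent (to_nat i)))"
      unfolding f_def sum_subtractf[symmetric] scaleR_diff_left[symmetric] by (rule norm_sum)
    also have "\<dots> \<le> (\<Sum>i\<in>I. L i * (card I * norm (c - d)))"
    proof (rule sum_mono)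
      fix i assume i: "i \<in> I"
      have "norm ((g i (co c) - g i (co d)) *\<^sub>R tent (to_nat i)) \<le> \<bar>g i (co c) - g i (co d)\<bar> * 1"
        unfolding norm_scaleR real_norm_def by (intro mult_left_mono norm_tent) auto
      also have "\<dots> \<le> L i * (card I * norm (c - d))"
        using order_trans[OF LM(4)[OF i] mult_left_mono[OF s LM(1)[OF i]]] by simp
      finally show "norm ((g i (co c) - g i (co d)) *\<^sub>R tent (to_nat i)) \<le> L i * (card I * norm (c - d))" .
    qed
    also have "\<dots> \<le> LL * norm (c - d)" 
      unfolding sum_distrib_right[symmetric] by (simp add: LL_def distrib_right mult.assoc)
    finally show ?thesis .
  qed
  obtain X where X: "X 0 = (\<Sum>i\<in>I. x0 i *\<^sub>R tent (to_nat i))"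
    "\<And>t. t \<in> {0..T} \<Longrightarrow> (X has_vector_derivative f (X t)) (at t within {0..T})"
    using lipschitz_ode_exists[OF lip LL T] by metis
  define y where "y t = co (X t)" for t
  have y0: "y 0 i = x0 i" if "i \<in> I" for i by (simp add: y_def X co_tents[OF that])
  have y': "((\<lambda>s. y s i) has_real_derivative g i (y t)) (at t within {0..T})"
    if "i \<in> I" "t \<in> {0..T}" for i t
  proof -
    have "((\<lambda>s. co (X s) i) has_vector_derivative co (f (X t)) i) (at t within {0..T})"
      unfolding co_def
      by (rule bounded_linear.has_vector_derivative[OF bounded_linear_apply_bcontfun X(2)[OF that(2)]])
    moreover have "co (f (X t)) i = g i (y t)" unfolding f_def y_def by (rule co_tents[OF that(1)])
    ultimately show ?thesis by (simp add: y_def has_real_derivative_iff_has_vector_derivative)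
  qed
  define e where "e t = (\<Sum>i\<in>I. (y t i)\<^sup>2)" for t
  \<comment> \<open>Wherever the cutoff is nonzero, no coordinate exceeds \<open>r + 1\<close> and
    clamping does nothing. Hence the energy inequality can be applied before it is known that the
    cutoff equals 1, which avoids a circular argument.\<close>
  have gy: "g i (y t) = cutoff I r (y t) * F (y t) i" if "i \<in> I" for i t
  proof (cases "cutoff I r (y t) = 0")
    case False
    then have *: "(\<Sum>i\<in>I. \<bar>y t i\<bar>) \<le> r + 1" by (auto simp: cutoff_def)
    have "clamp_to (r + 1) (y t j) = y t j" if "j \<in> I" for j
      by (rule clamp_to_id, rule order_trans[OF _ *], rule member_le_sum) (use that finI in auto)
    then have "F (\<lambda>j. clamp_to (r + 1) (y t j)) i = F (y t) i" by (intro F_cong that) auto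
    then show ?thesis by (simp add: g_def)
  qed (simp add: g_def)
  have growth: "e t \<le> e 0 * exp (2 * \<kappa>' * t)" if "t \<in> {0..T}" for t
  proof (rule gronwall[where a = 0, unfolded diff_zero, OF _ _ that])
    fix s assume s: "s \<in> {0..T}"
    show "(e has_real_derivative (\<Sum>i\<in>I. 2 * y s i * g i (y s))) (at s within {0..T})"
      unfolding e_def by (auto intro!: derivative_eq_intros y' s sum.cong)
    have c: "0 \<le> cutoff I r (y s)" "cutoff I r (y s) \<le> 1" by (auto simp: cutoff_def)
    have "(\<Sum>i\<in>I. 2 * y s i * g i (y s)) = 2 * (cutoff I r (y s) * (\<Sum>i\<in>I. y s i * F (y s) i))"
      unfolding sum_distrib_left by (intro sum.cong) (auto simp: gy)
    also have "(\<Sum>i\<in>I. y s i * F (y s) i) \<le> \<kappa>' * e s"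
      unfolding e_def \<kappa>'_def by (rule order_trans[OF energy]) (intro mult_right_mono sum_nonneg, auto)
    then have "2 * (cutoff I r (y s) * (\<Sum>i\<in>I. y s i * F (y s) i)) \<le> 2 * (cutoff I r (y s) * (\<kappa>' * e s))"
      using c by (intro mult_left_mono) auto
    also have "\<dots> \<le> 2 * (1 * (\<kappa>' * e s))"
      using c by (intro mult_left_mono mult_right_mono mult_nonneg_nonneg) (auto simp: \<kappa>'_def e_def intro: sum_nonneg)
    finally show "(\<Sum>i\<in>I. 2 * y s i * g i (y s)) \<le> 2 * \<kappa>' * e s" by simp
  qed
  have e0: "e 0 = (\<Sum>i\<in>I. (x0 i)\<^sup>2)" unfolding e_def by (intro sum.cong) (auto simp: y0)
  have e: "e t \<le> (\<Sum>i\<in>I. (x0 i)\<^sup>2) * exp (2 * \<kappa>' * T)" if "t \<in> {0..T}" for t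
  proof -
    have "(\<Sum>i\<in>I. (x0 i)\<^sup>2) * exp (2 * \<kappa>' * t) \<le> (\<Sum>i\<in>I. (x0 i)\<^sup>2) * exp (2 * \<kappa>' * T)"
      using that by (intro mult_left_mono sum_nonneg) (auto simp: \<kappa>'_def mult_left_mono)
    then show ?thesis using that e0 growth
      by (auto intro: order_trans[OF growth])
  qed
  have c1: "cutoff I r (y t) = 1" if t: "t \<in> {0..T}" for t
  proof -
    have "\<bar>y t i\<bar> \<le> r1" if "i \<in> I" for i
      unfolding r1_def using square_le_sum[OF that, of "y t"] e[OF t]
      by (intro real_le_rsqrt) (auto simp: e_def)
    then have "(\<Sum>i\<in>I. \<bar>y t i\<bar>) \<le> r" unfolding r_def by (intro sum_bounded_above) auto
    then show ?thesis by (auto simp: cutoff_def)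
  qed
  have "is_sol {0..T} y" unfolding is_sol_def using y' gy c1 by auto
  then show ?thesis using that y0 by blast
qed

lemma sol_continuous: "is_sol J x \<Longrightarrow> i \<in> I \<Longrightarrow> continuous_on J (\<lambda>t. x t i)"
  unfolding is_sol_def by (intro DERIV_continuous_on) auto

text \<open>The squared distance is used because it is differentiable, so that Gronwall applies. The
  constant \<open>K\<close> depends on the bound \<open>r\<close> alone, neither on the solutions
  nor on \<open>T\<close>; this serves uniqueness as well as the Lipschitz continuity of the flow on
  the absorbing ball.\<close>

lemma sol_distance:
  obtains K where "\<And>T x y t. is_sol {0..T} x \<Longrightarrow> is_sol {0..T} y \<Longrightarrow>
      (\<And>s i. s \<in> {0..T} \<Longrightarrow> i \<in> I \<Longrightarrow> \<bar>x s i\<bar> \<le> r \<and> \<bar>y s i\<bar> \<le> r) \<Longrightarrow> t \<in> {0..T} \<Longrightarrow>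
      (\<Sum>i\<in>I. (x t i - y t i)\<^sup>2) \<le> (\<Sum>i\<in>I. (x 0 i - y 0 i)\<^sup>2) * exp (K * t)"
proof -
  have "\<exists>L. L \<ge> 0 \<and> (\<forall>x y. (\<forall>j\<in>I. \<bar>x j\<bar> \<le> r) \<longrightarrow> (\<forall>j\<in>I. \<bar>y j\<bar> \<le> r) \<longrightarrow>
    \<bar>F x i - F y i\<bar> \<le> L * (\<Sum>i\<in>I. \<bar>x i - y i\<bar>))" if "i \<in> I" for i
    using polyfun_locally_lipschitz[OF finI poly[OF that], of r] by metis
  then obtain L where L: "\<And>i. i \<in> I \<Longrightarrow> L i \<ge> 0" "\<And>i x y. i \<in> I \<Longrightarrow> (\<forall>j\<in>I. \<bar>x j\<bar> \<le> r) \<Longrightarrow> (\<forall>j\<in>I. \<bar>y j\<bar> \<le> r) \<Longrightarrow>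
    \<bar>F x i - F y i\<bar> \<le> L i * (\<Sum>i\<in>I. \<bar>x i - y i\<bar>)"
    by metis
  define LL where "LL = (\<Sum>i\<in>I. L i)"
  have LL: "LL \<ge> 0" "\<And>i. i \<in> I \<Longrightarrow> L i \<le> LL"
    unfolding LL_def using L finI by (auto intro: sum_nonneg member_le_sum)
  show ?thesis
  proof (rule that[of "2 * LL * card I"])
    fix T x y t
    assume xy: "is_sol {0..T} x" "is_sol {0..T} y"
      "\<And>s i. s \<in> {0..T} \<Longrightarrow> i \<in> I \<Longrightarrow> \<bar>x s i\<bar> \<le> r \<and> \<bar>y s i\<bar> \<le> r" and t: "t \<in> {0..T}"
    show "(\<Sum>i\<in>I. (x t i - y t i)\<^sup>2) \<le> (\<Sum>i\<in>I. (x 0 i - y 0 i)\<^sup>2) * exp (2 * LL * card I * t)"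
    proof (rule gronwall[where a = 0, unfolded diff_zero, OF _ _ t])
      fix s assume s: "s \<in> {0..T}"
      define d where "d i = x s i - y s i" for i
      show "((\<lambda>t. \<Sum>i\<in>I. (x t i - y t i)\<^sup>2) has_real_derivative
          (\<Sum>i\<in>I. 2 * d i * (F (x s) i - F (y s) i))) (at s within {0..T})"
        using xy(1,2) s unfolding is_sol_def d_def
        by (auto intro!: derivative_eq_intros sum.cong)
      have "2 * d i * (F (x s) i - F (y s) i) \<le> 2 * \<bar>d i\<bar> * (LL * (\<Sum>i\<in>I. \<bar>d i\<bar>))" if i: "i \<in> I" for i
      proof -
        have "2 * d i * (F (x s) i - F (y s) i) \<le> 2 * \<bar>d i\<bar> * \<bar>F (x s) i - F (y s) i\<bar>"
          using abs_ge_self[of "d i * (F (x s) i - F (y s) i)"] by (simp add: abs_mult)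
        also have "\<dots> \<le> 2 * \<bar>d i\<bar> * (L i * (\<Sum>i\<in>I. \<bar>d i\<bar>))"
          unfolding d_def using xy(3)[OF s] by (intro mult_left_mono L(2)[OF i]) auto
        also have "\<dots> \<le> 2 * \<bar>d i\<bar> * (LL * (\<Sum>i\<in>I. \<bar>d i\<bar>))"
          using LL(2)[OF i] by (intro mult_left_mono mult_right_mono sum_nonneg) auto
        finally show ?thesis .
      qed
      then have "(\<Sum>i\<in>I. 2 * d i * (F (x s) i - F (y s) i)) \<le> (\<Sum>i\<in>I. 2 * \<bar>d i\<bar> * (LL * (\<Sum>i\<in>I. \<bar>d i\<bar>)))"
        by (rule sum_mono)
      also have "\<dots> = 2 * LL * (\<Sum>i\<in>I. \<bar>d i\<bar>)\<^sup>2"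
        by (simp add: sum_distrib_right[symmetric] sum_distrib_left[symmetric] power2_eq_square mult_ac)
      also have "\<dots> \<le> 2 * LL * ((\<Sum>i\<in>I. \<bar>d i\<bar>\<^sup>2) * card I)"
        using LL by (intro mult_left_mono sum_squared_le_sum_of_squares) auto
      finally show "(\<Sum>i\<in>I. 2 * d i * (F (x s) i - F (y s) i)) \<le> 2 * LL * card I * (\<Sum>i\<in>I. (x s i - y s i)\<^sup>2)"
        by (simp add: d_def mult_ac)
    qed
  qed
qed

lemma sol_bounded:
  assumes "is_sol {0..T} x"
  obtains r where "\<And>s i. s \<in> {0..T} \<Longrightarrow> i \<in> I \<Longrightarrow> \<bar>x s i\<bar> \<le> r"
proof -
  have "\<exists>r. \<forall>s\<in>{0..T}. \<bar>x s i\<bar> \<le> r" if "i \<in> I" for i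
  proof -
    have "compact ((\<lambda>s. x s i) ` {0..T})"
      by (intro compact_continuous_image sol_continuous[OF assms that]) auto
    then show ?thesis using compact_imp_bounded by (fastforce simp: bounded_iff)
  qed
  then obtain r where r: "\<And>i s. i \<in> I \<Longrightarrow> s \<in> {0..T} \<Longrightarrow> \<bar>x s i\<bar> \<le> r i" by metis
  have "\<bar>x s i\<bar> \<le> (\<Sum>i\<in>I. \<bar>r i\<bar>)" if "i \<in> I" "s \<in> {0..T}" for i s
    using r[OF that] member_le_sum[OF that(1), of "\<lambda>i. \<bar>r i\<bar>"] finI by force
  then show ?thesis using that by blast
qed

lemma sol_unique:
  assumes "is_sol {0..T} x" "is_sol {0..T} y" "\<And>i. i \<in> I \<Longrightarrow> x 0 i = y 0 i" "t \<in> {0..T}" "i \<in> I"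
  shows "x t i = y t i"
proof -
  obtain r1 where r1: "\<And>s i. s \<in> {0..T} \<Longrightarrow> i \<in> I \<Longrightarrow> \<bar>x s i\<bar> \<le> r1" by (rule sol_bounded[OF assms(1)]) blast
  obtain r2 where r2: "\<And>s i. s \<in> {0..T} \<Longrightarrow> i \<in> I \<Longrightarrow> \<bar>y s i\<bar> \<le> r2" by (rule sol_bounded[OF assms(2)]) blast
  have r: "\<bar>x s i\<bar> \<le> max r1 r2 \<and> \<bar>y s i\<bar> \<le> max r1 r2" if "s \<in> {0..T}" "i \<in> I" for s i
    using r1[OF that] r2[OF that] by auto
  obtain K where "\<And>T x y t. is_sol {0..T} x \<Longrightarrow> is_sol {0..T} y \<Longrightarrow>
      (\<And>s i. s \<in> {0..T} \<Longrightarrow> i \<in> I \<Longrightarrow> \<bar>x s i\<bar> \<le> max r1 r2 \<and> \<bar>y s i\<bar> \<le> max r1 r2) \<Longrightarrow> t \<in> {0..T} \<Longrightarrow>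
      (\<Sum>i\<in>I. (x t i - y t i)\<^sup>2) \<le> (\<Sum>i\<in>I. (x 0 i - y 0 i)\<^sup>2) * exp (K * t)"
    by (rule sol_distance[of "max r1 r2"]) blast
  from this[OF assms(1,2) r assms(4)]
  have K: "(\<Sum>i\<in>I. (x t i - y t i)\<^sup>2) \<le> (\<Sum>i\<in>I. (x 0 i - y 0 i)\<^sup>2) * exp (K * t)" .
  have K0: "(\<Sum>i\<in>I. (x 0 i - y 0 i)\<^sup>2) = 0" using assms(3) by simp
  then have "(x t i - y t i)\<^sup>2 \<le> 0" using K[unfolded K0] square_le_sum[OF assms(5), of "\<lambda>i. x t i - y t i"] by linarith
  then show ?thesis by simp
qed

lemma exists_global:
  obtains x where "\<And>i. i \<in> I \<Longrightarrow> x 0 i = x0 i" "is_sol {0..} x"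
proof -
  have "\<forall>T. \<exists>x. T \<ge> 0 \<longrightarrow> (\<forall>i\<in>I. x 0 i = x0 i) \<and> is_sol {0..T} x"
    using exists_on_interval by metis
  then obtain y where y: "\<And>T i. T \<ge> 0 \<Longrightarrow> i \<in> I \<Longrightarrow> y T 0 i = x0 i" "\<And>T. T \<ge> 0 \<Longrightarrow> is_sol {0..T} (y T)"
    by metis
  \<comment> \<open>At time t the solution on [0, t + 1] is taken, so that t is not the right end of
    its interval and the derivative is the one within the half line; by uniqueness all these
    solutions agree.\<close>
  define x where "x t = y (t + 1) t" for t
  have xy: "x s i = y T s i" if "0 \<le> s" "s \<le> T" "i \<in> I" for s T i
  proof -
    define T' where "T' = min T (s + 1)"
    have "is_sol {0..T'} (y (s + 1))" "is_sol {0..T'} (y T)"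
      using that by (auto intro!: is_sol_subset[OF y(2)] simp: T'_def)
    then show ?thesis unfolding x_def
      by (rule sol_unique) (use that y(1) in \<open>auto simp: T'_def\<close>)
  qed
  have "((\<lambda>s. x s i) has_real_derivative F (x t) i) (at t within {0..})" if t: "0 \<le> t" and i: "i \<in> I" for t i
  proof -
    have *: "((\<lambda>s. y (t + 1) s i) has_real_derivative F (y (t + 1) t) i) (at t within {0..t + 1})"
      using y(2)[of "t + 1"] t i unfolding is_sol_def by auto
    have eq: "at t within {0..t + 1} = at t within {0..}"
      by (rule at_within_nhd[of _ "{..<t+1}"]) auto
    have "F (y (t + 1) t) i = F (x t) i" by (simp add: x_def)
    with * have "((\<lambda>s. y (t + 1) s i) has_real_derivative F (x t) i) (at t within {0..t + 1})" by simp
    then have "((\<lambda>s. x s i) has_real_derivative F (x t) i) (at t within {0..t + 1})"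
      by (rule has_field_derivative_transform_within[of _ _ _ _ 1]) (use t i xy in auto)
    then show ?thesis by (simp add: eq)
  qed
  then have "is_sol {0..} x" unfolding is_sol_def by auto
  moreover have "x 0 i = x0 i" if "i \<in> I" for i by (simp add: x_def y that)
  ultimately show ?thesis using that by blast
qed

text \<open>Since the field is polynomial, the derivative of a polynomial along a solution is
  another polynomial along that solution; iterating this produces all higher derivatives.\<close>

lemma sol_smooth:
  assumes "is_sol J x" "i \<in> I"
  shows "smooth_in_time J (\<lambda>t. x t i)"
proof -
  have der: "\<exists>q. polyfun I q \<and> (\<forall>t\<in>J. ((\<lambda>t. p (x t)) has_real_derivative q (x t)) (at t within J))"
    if "polyfun I p" for p
    using that
  proof induction
    case (const c)
    then show ?case by (intro exI[of _ "\<lambda>_. 0"]) (auto intro: polyfun.const)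
  next
    case (coord i)
    then show ?case using assms(1) poly
      by (intro exI[of _ "\<lambda>z. F z i"]) (auto simp: is_sol_def)
  next
    case (add p q)
    then obtain p' q' where "polyfun I p'" "polyfun I q'"
      "\<forall>t\<in>J. ((\<lambda>t. p (x t)) has_real_derivative p' (x t)) (at t within J)"
      "\<forall>t\<in>J. ((\<lambda>t. q (x t)) has_real_derivative q' (x t)) (at t within J)" by blast
    then show ?case
      by (intro exI[of _ "\<lambda>z. p' z + q' z"]) (auto intro: polyfun.intros DERIV_add)
  next
    case (mult p q)
    then obtain p' q' where "polyfun I p'" "polyfun I q'"
      "\<forall>t\<in>J. ((\<lambda>t. p (x t)) has_real_derivative p' (x t)) (at t within J)"
      "\<forall>t\<in>J. ((\<lambda>t. q (x t)) has_real_derivative q' (x t)) (at t within J)" by blast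
    then show ?case using mult.hyps
      by (intro exI[of _ "\<lambda>z. p' z * q z + q' z * p z"]) (auto intro: polyfun.intros DERIV_mult)
  qed
  have "\<exists>P. \<forall>k::nat. (polyfun I (P k) \<and> (k = 0 \<longrightarrow> P k = (\<lambda>z. z i))) \<and>
      (\<forall>t\<in>J. ((\<lambda>t. P k (x t)) has_real_derivative P (Suc k) (x t)) (at t within J))"
    by (rule dependent_nat_choice) (use der polyfun.coord[OF assms(2)] in auto)
  then obtain P where "P 0 = (\<lambda>z. z i)"
    "\<And>k t. t \<in> J \<Longrightarrow> ((\<lambda>t. P k (x t)) has_real_derivative P (Suc k) (x t)) (at t within J)" by auto
  then show ?thesis unfolding smooth_in_time_def by (intro exI[of _ "\<lambda>k t. P k (x t)"]) auto
qed

end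

section \<open>Global attractors of semigroups with a compact absorbing set\<close>

lemma dist_to_le:
  assumes "\<And>x y. d x y \<ge> 0" "y \<in> Y"
  shows "dist_to d z Y \<le> d z y"
  unfolding dist_to_def by (rule cINF_lower[OF bdd_belowI2[of _ 0] assms(2)]) (rule assms(1))

lemma dist_to_ge: "Y \<noteq> {} \<Longrightarrow> (\<And>y. y \<in> Y \<Longrightarrow> r \<le> d z y) \<Longrightarrow> r \<le> dist_to d z Y"
  unfolding dist_to_def by (rule cINF_greatest)

text \<open>The attractor is the intersection of the sets \<open>F t B\<close>, which are compact
  and decrease with t because \<open>B\<close> is mapped into itself. A bounded invariant set equals
  its own image at late times; being absorbed by \<open>B\<close>, it lies in every
  \<open>F s B\<close>, and this gives maximality.\<close>

theorem (in Metric_space) global_attractor_exists: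
  assumes sg: "semigroup_on M F" and B: "compactin mtopology B" "B \<noteq> {}"
    and inv: "\<And>t. t \<ge> 0 \<Longrightarrow> F t ` B \<subseteq> B"
    and lip: "\<And>t. t \<ge> 0 \<Longrightarrow> \<exists>L. \<forall>x\<in>B. \<forall>y\<in>B. d (F t x) (F t y) \<le> L * d x y"
    and absorb: "\<And>Z. mbounded Z \<Longrightarrow> \<exists>\<tau>\<ge>0. \<forall>z\<in>Z. \<forall>t\<ge>\<tau>. F t z \<in> B"
  shows "\<exists>A. compactin mtopology A \<and> global_attractor M d F A"
proof -
  have BM: "B \<subseteq> M" using compactin_subset_topspace[OF B(1)] by simp
  have add: "F (s + t) x = F s (F t x)" if "s \<ge> 0" "t \<ge> 0" "x \<in> M" for s t x
    using sg that unfolding semigroup_on_def by blast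
  have FM: "F t x \<in> M" if "t \<ge> 0" "x \<in> M" for t x
    using sg that unfolding semigroup_on_def by blast
  have F_lim: "limitin mtopology (\<lambda>n. F t (\<sigma> n)) (F t l) sequentially"
    if t: "t \<ge> 0" and \<sigma>: "\<And>n. \<sigma> n \<in> B" and l: "l \<in> B" "limitin mtopology \<sigma> l sequentially" for t \<sigma> l
  proof -
    obtain L where L: "\<And>x y. x \<in> B \<Longrightarrow> y \<in> B \<Longrightarrow> d (F t x) (F t y) \<le> L * d x y"
      using lip[OF t] by blast
    have "(\<lambda>n. d (\<sigma> n) l) \<longlonglongrightarrow> 0" using l(2) by (simp add: limitin_metric_dist_null)
    then have "(\<lambda>n. L * d (\<sigma> n) l) \<longlonglongrightarrow> L * 0" by (intro tendsto_intros)
    then have lim0: "(\<lambda>n. L * d (\<sigma> n) l) \<longlonglongrightarrow> 0" by simp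
    have "(\<lambda>n. d (F t (\<sigma> n)) (F t l)) \<longlonglongrightarrow> 0"
      by (rule tendsto_sandwich[OF _ _ tendsto_const lim0]) (auto intro: L \<sigma> l always_eventually)
    moreover have "F t (\<sigma> n) \<in> M" "F t l \<in> M" for n using FM[OF t] \<sigma> l(1) BM by auto
    ultimately show ?thesis by (simp add: limitin_metric_dist_null)
  qed
  have comp: "compactin mtopology (F t ` B)" if t: "t \<ge> 0" for t
    unfolding compactin_sequentially
  proof (intro conjI allI impI)
    show "F t ` B \<subseteq> M" using inv[OF t] BM by blast
    fix \<sigma> :: "nat \<Rightarrow> 'a" assume "range \<sigma> \<subseteq> F t ` B"
    then have "\<forall>n. \<exists>b\<in>B. \<sigma> n = F t b" by blast
    then obtain b where b: "\<And>n. b n \<in> B" "\<And>n. \<sigma> n = F t (b n)" by metis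
    then obtain l r where lr: "l \<in> B" "strict_mono r" "limitin mtopology (b \<circ> r) l sequentially"
      using B(1) unfolding compactin_sequentially by (metis image_subsetI)
    have "limitin mtopology (\<lambda>n. F t ((b \<circ> r) n)) (F t l) sequentially"
      by (rule F_lim[OF t _ lr(1,3)]) (simp add: b)
    then show "\<exists>l r. l \<in> F t ` B \<and> strict_mono r \<and> limitin mtopology (\<sigma> \<circ> r) l sequentially"
      using lr by (intro exI[of _ "F t l"] exI[of _ r]) (auto simp: b o_def)
  qed
  have clos: "closedin mtopology (F t ` B)" if "t \<ge> 0" for t
    using compactin_imp_closedin[OF Hausdorff_space_mtopology comp[OF that]] .
  define A where "A = (\<Inter>t\<in>{0..}. F t ` B)"
  have closA: "closedin mtopology A" unfolding A_def by (rule closedin_INT) (auto intro: clos)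
  have F0: "F 0 ` B = B" using sg BM unfolding semigroup_on_def by force
  have AB: "A \<subseteq> B" unfolding A_def using F0 by auto
  have compA: "compactin mtopology A" by (rule closed_compactin[OF B(1) AB closA])
  have mono: "F t ` B \<subseteq> F s ` B" if "0 \<le> s" "s \<le> t" for s t
  proof
    fix y assume "y \<in> F t ` B"
    then obtain b where b: "b \<in> B" "y = F t b" by blast
    then have "y = F s (F (t - s) b)" using add[of s "t - s" b] that BM by auto
    then show "y \<in> F s ` B" using inv[of "t - s"] b that by auto
  qed
  \<comment> \<open>The compactness argument behind nonemptiness, surjectivity on the attractor and
    attraction alike: from some index on, the sequence stays in any given closed set
    \<open>F s B\<close>, so its limit points lie in all of them.\<close>
  have lim: "\<exists>l r. l \<in> A \<and> strict_mono r \<and> limitin mtopology (\<sigma> \<circ> r) l sequentially"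
    if \<sigma>: "\<And>n. \<sigma> n \<in> F (real n) ` B" for \<sigma> :: "nat \<Rightarrow> 'a"
  proof -
    have "\<sigma> n \<in> B" for n using \<sigma>[of n] inv[of "real n"] by auto
    then have "range \<sigma> \<subseteq> B" by blast
    then obtain l r where lr: "l \<in> B" "strict_mono r" "limitin mtopology (\<sigma> \<circ> r) l sequentially"
      using B(1) unfolding compactin_sequentially by blast
    have "l \<in> F s ` B" if s: "s \<ge> 0" for s
    proof (rule limitin_closedin[OF lr(3) clos[OF s]])
      show "\<forall>\<^sub>F n in sequentially. (\<sigma> \<circ> r) n \<in> F s ` B"
      proof (rule eventually_sequentiallyI[of "nat \<lceil>s\<rceil>"])
        fix n assume "n \<ge> nat \<lceil>s\<rceil>"
        then have "s \<le> real (r n)" using seq_suble[OF lr(2), of n] by linarith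
        then show "(\<sigma> \<circ> r) n \<in> F s ` B" using mono[OF s] \<sigma>[of "r n"] by auto
      qed
    qed simp
    then have "l \<in> A" unfolding A_def by blast
    then show ?thesis using lr by blast
  qed
  have A_ne: "A \<noteq> {}"
  proof -
    obtain b where "b \<in> B" using B(2) by blast
    then show ?thesis using lim[of "\<lambda>n. F (real n) b"] by blast
  qed
  have A_inv: "F t ` A = A" if t: "t > 0" for t
  proof
    show "F t ` A \<subseteq> A"
    proof (clarsimp simp: A_def)
      fix y s assume y: "\<forall>s\<in>{0..}. y \<in> F s ` B" and s: "0 \<le> (s :: real)"
      then obtain b where b: "b \<in> B" "y = F s b" by auto
      then have "F t y = F s (F t b)" using add[of s t b] add[of t s b] t s BM by (auto simp: add.commute)
      then show "F t y \<in> F s ` B" using inv[of t] b t by auto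
    qed
    \<comment> \<open>A preimage of y in \<open>B\<close> need not belong to the attractor.
      Preimages taken in \<open>F n B\<close> for each n have a limit point that does, and by
      continuity it is still mapped to y.\<close>
    show "A \<subseteq> F t ` A"
    proof
      fix y assume y: "y \<in> A"
      have "\<exists>b. b \<in> F (real n) ` B \<and> F t b = y" for n
      proof -
        have "y \<in> F (t + real n) ` B" using y t unfolding A_def by auto
        then obtain b where "b \<in> B" "y = F (t + real n) b" by blast
        then show ?thesis using add[of t "real n" b] t BM by (intro exI[of _ "F (real n) b"]) auto
      qed
      then obtain b where b: "\<And>n. b n \<in> F (real n) ` B" "\<And>n. F t (b n) = y" by metis
      obtain l r where lr: "l \<in> A" "strict_mono r" "limitin mtopology (b \<circ> r) l sequentially"
        using lim[OF b(1)] by blast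
      have bB: "(b \<circ> r) n \<in> B" for n using b(1)[of "r n"] inv[of "real (r n)"] by auto
      have "limitin mtopology (\<lambda>n. F t ((b \<circ> r) n)) (F t l) sequentially"
        by (rule F_lim[OF _ bB _ lr(3)]) (use t lr AB in auto)
      then have *: "limitin mtopology (\<lambda>n. y) (F t l) sequentially" by (simp add: b(2))
      have **: "limitin mtopology (\<lambda>n. y) y sequentially"
        using y AB BM by (auto simp: limitin_metric_dist_null)
      have "F t l = y" by (rule limitin_metric_unique[OF * **]) simp
      then show "y \<in> F t ` A" using lr(1) by blast
    qed
  qed
  have A_attr: "attracts d F A Z" if Z: "mbounded Z" for Z
    unfolding attracts_def
  proof (intro conjI ballI A_ne)
    fix z assume z: "z \<in> Z"
    then have zM: "z \<in> M" using mbounded_subset_mspace[OF Z] by blast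
    obtain \<tau> where \<tau>: "\<tau> \<ge> 0" "\<And>t. t \<ge> \<tau> \<Longrightarrow> F t z \<in> B" using absorb[OF Z] z by blast
    have pos: "0 \<le> dist_to d x A" for x by (rule dist_to_ge[OF A_ne]) simp
    show "((\<lambda>t. dist_to d (F t z) A) \<longlongrightarrow> 0) at_top"
    proof (rule ccontr)
      assume "\<not> ?thesis"
      then obtain e where e: "e > 0" "\<not> (\<forall>\<^sub>F t in at_top. dist_to d (F t z) A < e)"
        unfolding tendsto_iff using pos by (auto simp: dist_real_def)
      \<comment> \<open>The offset \<tau> guarantees that after removing the last n units of time
        the orbit is already in \<open>B\<close>, so the point at time \<open>t n\<close> belongs to
        \<open>F n B\<close>.\<close>
      have "\<exists>t\<ge>real n + \<tau>. e \<le> dist_to d (F t z) A" for n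
        using e(2) unfolding eventually_at_top_linorder by (meson not_le)
      then obtain t where t: "\<And>n. t n \<ge> real n + \<tau>" "\<And>n. e \<le> dist_to d (F (t n) z) A" by metis
      have "F (t n) z \<in> F (real n) ` B" for n
      proof -
        have "F (t n) z = F (real n) (F (t n - real n) z)"
          using add[of "real n" "t n - real n" z] t(1)[of n] \<tau>(1) zM by simp
        then show ?thesis using \<tau>(2)[of "t n - real n"] t(1)[of n] by auto
      qed
      from lim[OF this] obtain l r where lr: "l \<in> A"
        "limitin mtopology ((\<lambda>n. F (t n) z) \<circ> r) l sequentially" by blast
      then have "\<forall>\<^sub>F n in sequentially. d (F (t (r n)) z) l < e"
        using e(1) by (auto simp: limitin_metric eventually_conj_iff)
      then obtain n where "d (F (t (r n)) z) l < e" using eventually_happens' sequentially_bot by blast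
      moreover have "dist_to d (F (t (r n)) z) A \<le> d (F (t (r n)) z) l"
        by (rule dist_to_le[OF nonneg lr(1)])
      ultimately show False using t(2)[of "r n"] by linarith
    qed
  qed
  have "Y \<subseteq> A" if Y: "mbounded Y" "functionally_invariant F Y" for Y
  proof
    fix y assume y: "y \<in> Y"
    obtain \<tau> where \<tau>: "\<tau> \<ge> 0" "\<And>t z. z \<in> Y \<Longrightarrow> t \<ge> \<tau> \<Longrightarrow> F t z \<in> B" using absorb[OF Y(1)] by blast
    have "y \<in> F s ` B" if s: "s \<ge> 0" for s
    proof -
      \<comment> \<open>The additional 1 makes the time positive, as invariance speaks of positive
        times only.\<close>
      have "y \<in> F (s + (\<tau> + 1)) ` Y" using Y(2) y s \<tau>(1) unfolding functionally_invariant_def by auto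
      then obtain w where w: "w \<in> Y" "y = F (s + (\<tau> + 1)) w" by blast
      then have "y = F s (F (\<tau> + 1) w)"
        using add[of s "\<tau> + 1" w] s \<tau>(1) mbounded_subset_mspace[OF Y(1)] by auto
      then show ?thesis using \<tau>(2)[OF w(1), of "\<tau> + 1"] by auto
    qed
    then show "y \<in> A" unfolding A_def by blast
  qed
  then have "global_attractor M d F A"
    unfolding global_attractor_def Let_def functionally_invariant_def
    using compactin_imp_mbounded[OF compA] A_inv A_attr by (auto simp: functionally_invariant_def)
  then show ?thesis using compA by blast
qed

section \<open>Calculus of trigonometric polynomials\<close>

text \<open>One class serves as regularity assumption for all fields of the model: it contains the
  components of the modes, is closed under products and both partial derivatives, and its members
  are continuous and periodic in \<open>x1\<close>.\<close>

inductive trig_poly :: "real \<Rightarrow> sfield \<Rightarrow> bool" for k where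
  const: "trig_poly k (\<lambda>_. c)"
| sin1: "trig_poly k (\<lambda>x. sin (k * real m * fst x))"
| cos1: "trig_poly k (\<lambda>x. cos (k * real m * fst x))"
| sin3: "trig_poly k (\<lambda>x. sin (real m * snd x))"
| cos3: "trig_poly k (\<lambda>x. cos (real m * snd x))"
| add: "trig_poly k g \<Longrightarrow> trig_poly k h \<Longrightarrow> trig_poly k (\<lambda>x. g x + h x)"
| mult: "trig_poly k g \<Longrightarrow> trig_poly k h \<Longrightarrow> trig_poly k (\<lambda>x. g x * h x)"

lemma trig_poly_sum: "(\<And>j. j \<in> J \<Longrightarrow> trig_poly k (g j)) \<Longrightarrow> trig_poly k (\<lambda>x. \<Sum>j\<in>J. g j x)"
  by (induction J rule: infinite_finite_induct) (auto intro: trig_poly.intros)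

lemma trig_poly_minus: "trig_poly k g \<Longrightarrow> trig_poly k (\<lambda>x. - g x)"
  using trig_poly.mult[OF trig_poly.const[of k "-1"]] by simp

lemma trig_poly_continuous: "trig_poly k g \<Longrightarrow> continuous_on S g"
  by (induction rule: trig_poly.induct) (intro continuous_intros | assumption)+

lemma trig_poly_periodic:
  assumes "trig_poly k g" "k \<noteq> 0" shows "g (2 * pi / k, x3) = g (0, x3)"
  using assms(1)
proof induction
  case (sin1 m)
  have "sin (real m * (2 * pi)) = 0" by (metis sin_int_2pin mult.commute of_int_of_nat_eq)
  then show ?case using assms(2) by (simp add: mult_ac)
next
  case (cos1 m)
  have "cos (real m * (2 * pi)) = 1" by (metis cos_int_2pin mult.commute of_int_of_nat_eq)
  then show ?case using assms(2) by (simp add: mult_ac)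
qed auto

lemma d1_eqI:
  assumes "\<And>x1 x3. ((\<lambda>s. g (s, x3)) has_vector_derivative g' (x1, x3)) (at x1)"
  shows "d1 g = g'"
  using vector_derivative_at[OF assms] by (auto simp: d1_def fun_eq_iff)

lemma d3_eqI:
  assumes "\<And>x1 x3. ((\<lambda>s. g (x1, s)) has_vector_derivative g' (x1, x3)) (at x3)"
  shows "d3 g = g'"
  using vector_derivative_at[OF assms] by (auto simp: d3_def fun_eq_iff)

text \<open>The induction produces some partial derivatives within the class. Only then can they be
  identified with \<open>d1\<close> and \<open>d3\<close>, since \<open>vector_derivative\<close> is
  a choice that says nothing before differentiability is known.\<close>

lemma trig_poly_partial_derivatives:
  assumes "trig_poly k g"
  shows "trig_poly k (d1 g) \<and> trig_poly k (d3 g) \<and>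
    (\<forall>x1 x3. ((\<lambda>s. g (s, x3)) has_real_derivative d1 g (x1, x3)) (at x1)) \<and>
    (\<forall>x1 x3. ((\<lambda>s. g (x1, s)) has_real_derivative d3 g (x1, x3)) (at x3))"
proof -
  have "\<exists>g1 g3. trig_poly k g1 \<and> trig_poly k g3 \<and>
    (\<forall>x1 x3. ((\<lambda>s. g (s, x3)) has_real_derivative g1 (x1, x3)) (at x1)) \<and>
    (\<forall>x1 x3. ((\<lambda>s. g (x1, s)) has_real_derivative g3 (x1, x3)) (at x3))"
    using assms
  proof induction
    case (const c)
    then show ?case by (intro exI[of _ "\<lambda>_. 0"]) (auto intro: trig_poly.const)
  next
    case (sin1 m)
    show ?case
      by (rule exI[of _ "\<lambda>x. k * real m * cos (k * real m * fst x)"], rule exI[of _ "\<lambda>_. 0"])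
        (auto intro!: trig_poly.intros derivative_eq_intros)
  next
    case (cos1 m)
    show ?case
      by (rule exI[of _ "\<lambda>x. (- k * real m) * sin (k * real m * fst x)"], rule exI[of _ "\<lambda>_. 0"])
        (auto intro!: trig_poly_minus trig_poly.intros derivative_eq_intros)
  next
    case (sin3 m)
    show ?case
      by (rule exI[of _ "\<lambda>_. 0"], rule exI[of _ "\<lambda>x. real m * cos (real m * snd x)"])
        (auto intro!: trig_poly.intros derivative_eq_intros)
  next
    case (cos3 m)
    show ?case
      by (rule exI[of _ "\<lambda>_. 0"], rule exI[of _ "\<lambda>x. (- real m) * sin (real m * snd x)"])
        (auto intro!: trig_poly_minus trig_poly.intros derivative_eq_intros)
  next
    case (add g h)
    then obtain g1 g3 h1 h3 where "trig_poly k g1" "trig_poly k g3" "trig_poly k h1" "trig_poly k h3"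
      "\<And>x1 x3. ((\<lambda>s. g (s, x3)) has_real_derivative g1 (x1, x3)) (at x1)"
      "\<And>x1 x3. ((\<lambda>s. g (x1, s)) has_real_derivative g3 (x1, x3)) (at x3)"
      "\<And>x1 x3. ((\<lambda>s. h (s, x3)) has_real_derivative h1 (x1, x3)) (at x1)"
      "\<And>x1 x3. ((\<lambda>s. h (x1, s)) has_real_derivative h3 (x1, x3)) (at x3)" by blast
    then show ?case
      by (intro exI[of _ "\<lambda>x. g1 x + h1 x"] exI[of _ "\<lambda>x. g3 x + h3 x"])
        (auto intro!: trig_poly.intros DERIV_add)
  next
    case (mult g h)
    then obtain g1 g3 h1 h3 where "trig_poly k g1" "trig_poly k g3" "trig_poly k h1" "trig_poly k h3"
      "\<And>x1 x3. ((\<lambda>s. g (s, x3)) has_real_derivative g1 (x1, x3)) (at x1)"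
      "\<And>x1 x3. ((\<lambda>s. g (x1, s)) has_real_derivative g3 (x1, x3)) (at x3)"
      "\<And>x1 x3. ((\<lambda>s. h (s, x3)) has_real_derivative h1 (x1, x3)) (at x1)"
      "\<And>x1 x3. ((\<lambda>s. h (x1, s)) has_real_derivative h3 (x1, x3)) (at x3)" by blast
    then show ?case using mult.hyps
      by (intro exI[of _ "\<lambda>x. g1 x * h x + h1 x * g x"] exI[of _ "\<lambda>x. g3 x * h x + h3 x * g x"])
        (auto intro!: trig_poly.intros DERIV_mult)
  qed
  then obtain g1 g3 where g: "trig_poly k g1" "trig_poly k g3"
    "\<And>x1 x3. ((\<lambda>s. g (s, x3)) has_real_derivative g1 (x1, x3)) (at x1)"
    "\<And>x1 x3. ((\<lambda>s. g (x1, s)) has_real_derivative g3 (x1, x3)) (at x3)" by blast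
  moreover have "d1 g = g1" "d3 g = g3"
    using g(3,4) by (auto intro!: d1_eqI d3_eqI simp: has_real_derivative_iff_has_vector_derivative)
  ultimately show ?thesis by simp
qed

lemmas trig_poly_d1 = trig_poly_partial_derivatives[THEN conjunct1]
lemmas trig_poly_d3 = trig_poly_partial_derivatives[THEN conjunct2, THEN conjunct1]
lemmas has_d1 = trig_poly_partial_derivatives[THEN conjunct2, THEN conjunct2, THEN conjunct1, rule_format]
lemmas has_d3 = trig_poly_partial_derivatives[THEN conjunct2, THEN conjunct2, THEN conjunct2, rule_format]

lemma d1_mult:
  assumes "trig_poly k g" "trig_poly k h"
  shows "d1 (\<lambda>x. g x * h x) = (\<lambda>x. d1 g x * h x + d1 h x * g x)"
  by (rule d1_eqI) (use has_d1[OF assms(1)] has_d1[OF assms(2)] in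
    \<open>auto simp: has_real_derivative_iff_has_vector_derivative[symmetric] intro: DERIV_mult\<close>)

lemma d3_mult:
  assumes "trig_poly k g" "trig_poly k h"
  shows "d3 (\<lambda>x. g x * h x) = (\<lambda>x. d3 g x * h x + d3 h x * g x)"
  by (rule d3_eqI) (use has_d3[OF assms(1)] has_d3[OF assms(2)] in
    \<open>auto simp: has_real_derivative_iff_has_vector_derivative[symmetric] intro: DERIV_mult\<close>)

lemma d1_linear_sum:
  assumes "\<And>j. j \<in> J \<Longrightarrow> trig_poly k (g j)"
  shows "d1 (\<lambda>x. \<Sum>j\<in>J. c j * g j x) = (\<lambda>x. \<Sum>j\<in>J. c j * d1 (g j) x)"
  by (rule d1_eqI) (use has_d1[OF assms] in
    \<open>auto simp: has_real_derivative_iff_has_vector_derivative[symmetric] intro!: DERIV_sum DERIV_cmult\<close>)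

lemma d3_linear_sum:
  assumes "\<And>j. j \<in> J \<Longrightarrow> trig_poly k (g j)"
  shows "d3 (\<lambda>x. \<Sum>j\<in>J. c j * g j x) = (\<lambda>x. \<Sum>j\<in>J. c j * d3 (g j) x)"
  by (rule d3_eqI) (use has_d3[OF assms] in
    \<open>auto simp: has_real_derivative_iff_has_vector_derivative[symmetric] intro!: DERIV_sum DERIV_cmult\<close>)

section \<open>Vector fields, componentwise\<close>

definition vec_trig_poly :: "real \<Rightarrow> vfield \<Rightarrow> bool" where
  "vec_trig_poly k u \<longleftrightarrow> (\<forall>i. trig_poly k (\<lambda>x. u x $ i))"

lemma has_vector_derivative_vecI:
  fixes f :: "real \<Rightarrow> real ^ 'n"
  assumes "\<And>i. ((\<lambda>s. f s $ i) has_real_derivative f' $ i) (at t)"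
  shows "(f has_vector_derivative f') (at t)"
  unfolding has_vector_derivative_def
proof (subst has_derivative_componentwise_within, intro ballI)
  fix b :: "real ^ 'n" assume "b \<in> Basis"
  then obtain i where b: "b = axis i 1" by (auto simp: Basis_vec_def)
  show "((\<lambda>x. f x \<bullet> b) has_derivative (\<lambda>x. x *\<^sub>R f' \<bullet> b)) (at t)"
    using assms[of i] by (simp add: b inner_axis has_field_derivative_def mult.commute[of _ "f' $ i"])
qed

lemma d1_vec:
  assumes "vec_trig_poly k u"
  shows "d1 u = (\<lambda>x. \<chi> i. d1 (\<lambda>y. u y $ i) x)"
proof (intro d1_eqI has_vector_derivative_vecI)
  fix x1 x3 i
  have "trig_poly k (\<lambda>x. u x $ i)" using assms by (simp add: vec_trig_poly_def)
  from has_d1[OF this]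
  show "((\<lambda>s. u (s, x3) $ i) has_real_derivative (\<chi> i. d1 (\<lambda>y. u y $ i) (x1, x3)) $ i) (at x1)"
    by simp
qed

lemma d3_vec:
  assumes "vec_trig_poly k u"
  shows "d3 u = (\<lambda>x. \<chi> i. d3 (\<lambda>y. u y $ i) x)"
proof (intro d3_eqI has_vector_derivative_vecI)
  fix x1 x3 i
  have "trig_poly k (\<lambda>x. u x $ i)" using assms by (simp add: vec_trig_poly_def)
  from has_d3[OF this]
  show "((\<lambda>s. u (x1, s) $ i) has_real_derivative (\<chi> i. d3 (\<lambda>y. u y $ i) (x1, x3)) $ i) (at x3)"
    by simp
qed

lemma advect_vec_nth:
  assumes "vec_trig_poly k g"
  shows "advect u g x $ i = advect u (\<lambda>y. g y $ i) x"
  unfolding advect_def d1_vec[OF assms] d3_vec[OF assms] by simp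

lemma vec_trig_poly_d:
  assumes "vec_trig_poly k g" shows "vec_trig_poly k (d1 g)" "vec_trig_poly k (d3 g)"
  using assms trig_poly_d1 trig_poly_d3
  unfolding d1_vec[OF assms] d3_vec[OF assms] by (auto simp: vec_trig_poly_def)

lemma laplacian_vec_nth:
  assumes "vec_trig_poly k g"
  shows "laplacian g x $ i = laplacian (\<lambda>y. g y $ i) x"
proof -
  have "d1 (d1 g) x $ i = d1 (\<lambda>y. d1 g y $ i) x" "d3 (d3 g) x $ i = d3 (\<lambda>y. d3 g y $ i) x"
    using d1_vec[OF vec_trig_poly_d(1)[OF assms]] d3_vec[OF vec_trig_poly_d(2)[OF assms]] by simp_all
  moreover have "(\<lambda>y. d1 g y $ i) = d1 (\<lambda>y. g y $ i)" "(\<lambda>y. d3 g y $ i) = d3 (\<lambda>y. g y $ i)"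
    by (simp_all add: d1_vec[OF assms] d3_vec[OF assms])
  ultimately show ?thesis by (simp add: laplacian_def)
qed

lemma trig_poly_advect:
  assumes "vec_trig_poly k u" "trig_poly k g"
  shows "trig_poly k (advect u g)"
  using assms unfolding advect_def vec_trig_poly_def
  by (auto intro!: trig_poly.add trig_poly.mult trig_poly_d1 trig_poly_d3)

lemma trig_poly_inner:
  assumes "vec_trig_poly k u" "vec_trig_poly k v"
  shows "trig_poly k (\<lambda>x. u x \<bullet> v x)"
  using assms unfolding inner_vec_def vec_trig_poly_def by (auto intro!: trig_poly_sum trig_poly.mult)

lemma vec_trig_poly_advect:
  assumes "vec_trig_poly k u" "vec_trig_poly k g"
  shows "vec_trig_poly k (advect u g)"
  unfolding vec_trig_poly_def advect_vec_nth[OF assms(2)]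
  using assms by (auto simp: vec_trig_poly_def intro!: trig_poly_advect)

section \<open>Integration over the periodic cell and integration by parts\<close>

lemma Omega_cbox: "Omega k = cbox (0, 0) (2 * pi / k, pi)"
  unfolding Omega_def cbox_Pair_eq box_real by (rule refl)

lemma integrable_Omega: "continuous_on UNIV g \<Longrightarrow> (g :: sfield) integrable_on Omega k"
  unfolding Omega_cbox by (rule integrable_continuous, rule continuous_on_subset[of UNIV]) auto

lemma avg_add:
  assumes "continuous_on UNIV g" "continuous_on UNIV h"
  shows "avg k (\<lambda>x. g x + h x) = avg k g + avg k h"
  unfolding avg_def by (intro integral_add integrable_Omega assms)

lemma avg_cmult: "avg k (\<lambda>x. c * g x) = c * avg k g"
  unfolding avg_def by simp

lemma avg_linear_sum:
  assumes "finite J" "\<And>j. j \<in> J \<Longrightarrow> continuous_on UNIV (g j)"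
  shows "avg k (\<lambda>x. \<Sum>j\<in>J. c j * g j x) = (\<Sum>j\<in>J. c j * avg k (g j))"
  unfolding avg_def
  by (subst integral_sum) (auto intro!: integrable_Omega continuous_intros assms)

lemma avg_mono:
  assumes "continuous_on UNIV g" "continuous_on UNIV h" "\<And>x. g x \<le> h x"
  shows "avg k g \<le> avg k h"
  unfolding avg_def by (intro integral_le integrable_Omega assms)

lemma avg_iterated:
  assumes "continuous_on UNIV g"
  shows "avg k g = integral {0..2 * pi / k} (\<lambda>s. integral {0..pi} (\<lambda>t. g (s, t)))"
  unfolding avg_def Omega_cbox
  by (subst integral_prod_continuous) (auto intro: continuous_on_subset[OF assms])

lemma avg_product:
  assumes "continuous_on UNIV p" "continuous_on UNIV q"
  shows "avg k (\<lambda>x. p (fst x) * q (snd x)) = integral {0..2 * pi / k} p * integral {0..pi} q"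
proof -
  have "continuous_on UNIV (\<lambda>x :: point. p (fst x) * q (snd x))"
    by (intro continuous_intros continuous_on_compose2[OF assms(1)] continuous_on_compose2[OF assms(2)]) auto
  from avg_iterated[OF this] show ?thesis by simp
qed

lemma avg_d1:
  assumes "trig_poly k g" "k > 0"
  shows "avg k (d1 g) = 0"
proof -
  have c: "continuous_on UNIV (d1 g)" by (rule trig_poly_continuous[OF trig_poly_d1[OF assms(1)]])
  have cc: "continuous_on S (\<lambda>(s, t). d1 g (s, t))" for S
    using continuous_on_subset[OF c] by simp
  have "avg k (d1 g) = integral {0..2 * pi / k} (\<lambda>s. integral {0..pi} (\<lambda>t. d1 g (s, t)))"
    by (rule avg_iterated[OF c])
  also have "\<dots> = integral {0..pi} (\<lambda>t. integral {0..2 * pi / k} (\<lambda>s. d1 g (s, t)))"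
    using integral_swap_continuous[of 0 0 "2 * pi / k" pi "\<lambda>s t. d1 g (s, t)", OF cc] by simp
  finally have *: "avg k (d1 g) = integral {0..pi} (\<lambda>t. integral {0..2 * pi / k} (\<lambda>s. d1 g (s, t)))" .
  have "integral {0..2 * pi / k} (\<lambda>s. d1 g (s, t)) = 0" for t
  proof -
    have "((\<lambda>s. d1 g (s, t)) has_integral (g (2 * pi / k, t) - g (0, t))) {0..2 * pi / k}"
      by (rule fundamental_theorem_of_calculus)
        (use assms(2) has_d1[OF assms(1)] in \<open>auto intro: has_vector_derivative_at_within
          simp: has_real_derivative_iff_has_vector_derivative\<close>)
    then show ?thesis using trig_poly_periodic[OF assms(1)] assms(2) by (simp add: integral_unique)
  qed
  then show ?thesis by (simp add: *)
qed

lemma avg_d3: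
  assumes "trig_poly k g" "\<And>x1. g (x1, 0) = 0" "\<And>x1. g (x1, pi) = 0"
  shows "avg k (d3 g) = 0"
proof -
  have c: "continuous_on UNIV (d3 g)" by (rule trig_poly_continuous[OF trig_poly_d3[OF assms(1)]])
  have "integral {0..pi} (\<lambda>t. d3 g (s, t)) = 0" for s
  proof -
    have "((\<lambda>t. d3 g (s, t)) has_integral (g (s, pi) - g (s, 0))) {0..pi}"
      by (rule fundamental_theorem_of_calculus)
        (use has_d3[OF assms(1)] in \<open>auto intro: has_vector_derivative_at_within
          simp: has_real_derivative_iff_has_vector_derivative\<close>)
    then show ?thesis using assms(2,3) by (simp add: integral_unique)
  qed
  then show ?thesis by (simp add: avg_iterated[OF c])
qed

text \<open>Besides vanishing divergence this includes impermeable walls: \<open>u3 = 0\<close> at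
  \<open>x3 = 0\<close> and \<open>x3 = pi\<close> removes the boundary terms that periodicity in
  \<open>x1\<close> does not take care of.\<close>

definition incompressible :: "real \<Rightarrow> vfield \<Rightarrow> bool" where
  "incompressible k u \<longleftrightarrow> vec_trig_poly k u \<and>
     (\<forall>x. d1 (\<lambda>y. u y $ 1) x + d3 (\<lambda>y. u y $ 3) x = 0) \<and>
     (\<forall>x1. u (x1, 0) $ 3 = 0 \<and> u (x1, pi) $ 3 = 0)"

text \<open>For zero divergence, advection of g is the divergence of g u. Its \<open>x1\<close> part
  integrates to zero by periodicity and its \<open>x3\<close> part because u3 vanishes on the
  walls.\<close>

lemma avg_advect:
  assumes u: "incompressible k u" and g: "trig_poly k g" and k: "k > 0"
  shows "avg k (advect u g) = 0"
proof -
  have u1: "trig_poly k (\<lambda>y. u y $ 1)" and u3: "trig_poly k (\<lambda>y. u y $ 3)"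
    using u unfolding incompressible_def vec_trig_poly_def by auto
  have "advect u g x = d1 (\<lambda>y. u y $ 1 * g y) x + d3 (\<lambda>y. u y $ 3 * g y) x" for x
  proof -
    have "d1 (\<lambda>y. u y $ 1) x * g x + d3 (\<lambda>y. u y $ 3) x * g x = 0"
      using u unfolding distrib_right[symmetric] incompressible_def by (metis mult_zero_left)
    then show ?thesis
      unfolding advect_def d1_mult[OF u1 g] d3_mult[OF u3 g] real_scaleR_def by (simp only: mult.commute)
  qed
  then have "avg k (advect u g) = avg k (\<lambda>x. d1 (\<lambda>y. u y $ 1 * g y) x + d3 (\<lambda>y. u y $ 3 * g y) x)"
    by (metis)
  also have "\<dots> = avg k (d1 (\<lambda>y. u y $ 1 * g y)) + avg k (d3 (\<lambda>y. u y $ 3 * g y))"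
    by (intro avg_add trig_poly_continuous[of k] trig_poly_d1 trig_poly_d3 trig_poly.mult u1 u3 g)
  also have "\<dots> = 0"
    using avg_d1[OF trig_poly.mult[OF u1 g] k] avg_d3[OF trig_poly.mult[OF u3 g]] u
    by (simp add: incompressible_def)
  finally show ?thesis .
qed

lemma avg_advect_by_parts:
  assumes u: "incompressible k u" and g: "trig_poly k g" and h: "trig_poly k h" and k: "k > 0"
  shows "avg k (\<lambda>x. advect u g x * h x) = - avg k (\<lambda>x. g x * advect u h x)"
proof -
  have v: "vec_trig_poly k u" using u by (simp add: incompressible_def)
  have "advect u (\<lambda>y. g y * h y) = (\<lambda>x. advect u g x * h x + g x * advect u h x)"
    by (simp add: fun_eq_iff advect_def d1_mult[OF g h] d3_mult[OF g h] algebra_simps)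
  then have "avg k (\<lambda>x. advect u g x * h x + g x * advect u h x) = 0"
    using avg_advect[OF u trig_poly.mult[OF g h] k] by simp
  then show ?thesis
    by (subst (asm) avg_add)
      (auto intro!: trig_poly_continuous[of k] trig_poly.mult trig_poly_advect v g h)
qed

lemma avg_advect_self:
  assumes "incompressible k u" "trig_poly k g" "k > 0"
  shows "avg k (\<lambda>x. advect u g x * g x) = 0"
  using avg_advect_by_parts[OF assms(1,2,2,3)] by (simp add: mult.commute)

lemma avg_advect_vec_self:
  assumes u: "incompressible k u" and k: "k > 0"
  shows "avg k (\<lambda>x. advect u u x \<bullet> u x) = 0"
proof -
  have v: "vec_trig_poly k u" using u by (simp add: incompressible_def)
  then have c: "trig_poly k (\<lambda>y. u y $ i)" for i by (simp add: vec_trig_poly_def)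
  have "avg k (\<lambda>x. advect u u x \<bullet> u x)
      = avg k (\<lambda>x. \<Sum>i\<in>UNIV. 1 * (advect u (\<lambda>y. u y $ i) x * u x $ i))"
    by (simp add: inner_vec_def advect_vec_nth[OF v])
  also have "\<dots> = (\<Sum>i\<in>UNIV. 1 * avg k (\<lambda>x. advect u (\<lambda>y. u y $ i) x * u x $ i))"
    by (rule avg_linear_sum) (auto intro!: trig_poly_continuous[of k] trig_poly.mult trig_poly_advect v c)
  also have "\<dots> = 0" using avg_advect_self[OF u c k] by simp
  finally show ?thesis .
qed

section \<open>Integrals and derivatives of the basis functions\<close>

lemma has_integral_cos_period:
  assumes "k > 0"
  shows "((\<lambda>s. cos (k * of_int j * s)) has_integral (if j = 0 then 2 * pi / k else 0)) {0..2 * pi / k}"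
proof (cases "j = 0")
  case True
  then show ?thesis using has_integral_const_real[of "1::real" 0 "2 * pi / k"] assms by simp
next
  case False
  let ?F = "\<lambda>s. sin (k * of_int j * s) / (k * of_int j)"
  have "((\<lambda>s. cos (k * of_int j * s)) has_integral (?F (2 * pi / k) - ?F 0)) {0..2 * pi / k}"
    by (rule fundamental_theorem_of_calculus)
      (use False assms in \<open>auto intro!: derivative_eq_intros
        simp: has_real_derivative_iff_has_vector_derivative[symmetric]\<close>)
  moreover have "sin (k * of_int j * (2 * pi / k)) = 0"
    using sin_int_2pin[of j] assms by (simp add: mult_ac)
  ultimately show ?thesis using False by simp
qed

lemma has_integral_sin_period:
  assumes "k > 0"
  shows "((\<lambda>s. sin (k * of_int j * s)) has_integral 0) {0..2 * pi / k}"
proof (cases "j = 0")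
  case False
  let ?F = "\<lambda>s. - cos (k * of_int j * s) / (k * of_int j)"
  have "((\<lambda>s. sin (k * of_int j * s)) has_integral (?F (2 * pi / k) - ?F 0)) {0..2 * pi / k}"
    by (rule fundamental_theorem_of_calculus)
      (use False assms in \<open>auto intro!: derivative_eq_intros
        simp: has_real_derivative_iff_has_vector_derivative[symmetric]\<close>)
  moreover have "cos (k * of_int j * (2 * pi / k)) = 1"
    using cos_int_2pin[of j] assms by (simp add: mult_ac)
  ultimately show ?thesis using False by simp
qed simp

lemma has_integral_cos_half_period:
  "((\<lambda>s. cos (of_int j * s)) has_integral (if j = 0 then pi else 0)) {0..pi}"
proof (cases "j = 0")
  case True
  then show ?thesis using has_integral_const_real[of "1::real" 0 pi] by simp
next
  case False
  let ?F = "\<lambda>s. sin (of_int j * s) / of_int j"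
  have "((\<lambda>s. cos (of_int j * s)) has_integral (?F pi - ?F 0)) {0..pi}"
    by (rule fundamental_theorem_of_calculus)
      (use False in \<open>auto intro!: derivative_eq_intros
        simp: has_real_derivative_iff_has_vector_derivative[symmetric]\<close>)
  moreover have "sin (of_int j * pi) = 0" by (metis mult.commute sin_npi_int)
  ultimately show ?thesis using False by simp
qed

lemma integral_cos_cos_period:
  assumes "k > 0"
  shows "integral {0..2 * pi / k} (\<lambda>s. cos (k * real a * s) * cos (k * real b * s)) =
    (if a = b then (if a = 0 then 2 * pi / k else pi / k) else 0)"
proof -
  have eq: "cos (k * real a * s) * cos (k * real b * s) =
    (cos (k * of_int (int a - int b) * s) + cos (k * of_int (int a + int b) * s)) / 2" for s
    by (simp add: cos_times_cos algebra_simps)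
  show ?thesis unfolding eq
    by (rule integral_unique)
      (rule has_integral_eq_rhs[OF has_integral_divide[OF has_integral_add[OF
        has_integral_cos_period[OF assms] has_integral_cos_period[OF assms]]]], auto)
qed

lemma integral_sin_sin_period:
  assumes "k > 0"
  shows "integral {0..2 * pi / k} (\<lambda>s. sin (k * real a * s) * sin (k * real b * s)) =
    (if a = b \<and> a \<noteq> 0 then pi / k else 0)"
proof -
  have eq: "sin (k * real a * s) * sin (k * real b * s) =
    (cos (k * of_int (int a - int b) * s) - cos (k * of_int (int a + int b) * s)) / 2" for s
    by (simp add: sin_times_sin algebra_simps)
  show ?thesis unfolding eq
    by (rule integral_unique)
      (rule has_integral_eq_rhs[OF has_integral_divide[OF has_integral_diff[OF
        has_integral_cos_period[OF assms] has_integral_cos_period[OF assms]]]], auto)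
qed

lemma integral_sin_cos_period:
  assumes "k > 0"
  shows "integral {0..2 * pi / k} (\<lambda>s. sin (k * real a * s) * cos (k * real b * s)) = 0"
    and "integral {0..2 * pi / k} (\<lambda>s. cos (k * real b * s) * sin (k * real a * s)) = 0"
proof -
  have eq: "sin (k * real a * s) * cos (k * real b * s) =
    (sin (k * of_int (int a + int b) * s) + sin (k * of_int (int a - int b) * s)) / 2" for s
    using sin_times_cos[of "k * real a * s" "k * real b * s"] by (simp add: algebra_simps)
  show *: "integral {0..2 * pi / k} (\<lambda>s. sin (k * real a * s) * cos (k * real b * s)) = 0"
    unfolding eq
    by (rule integral_unique)
      (rule has_integral_eq_rhs[OF has_integral_divide[OF has_integral_add[OF
        has_integral_sin_period[OF assms] has_integral_sin_period[OF assms]]]], auto)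
  then show "integral {0..2 * pi / k} (\<lambda>s. cos (k * real b * s) * sin (k * real a * s)) = 0"
    by (simp add: mult.commute)
qed

lemma integral_cos_cos_half_period:
  "integral {0..pi} (\<lambda>s. cos (real a * s) * cos (real b * s)) =
    (if a = b then (if a = 0 then pi else pi / 2) else 0)"
proof -
  have eq: "cos (real a * s) * cos (real b * s) =
    (cos (of_int (int a - int b) * s) + cos (of_int (int a + int b) * s)) / 2" for s
    by (simp add: cos_times_cos algebra_simps)
  show ?thesis unfolding eq
    by (rule integral_unique)
      (rule has_integral_eq_rhs[OF has_integral_divide[OF has_integral_add[OF
        has_integral_cos_half_period has_integral_cos_half_period]]], auto)
qed

lemma integral_sin_sin_half_period:
  "integral {0..pi} (\<lambda>s. sin (real a * s) * sin (real b * s)) = (if a = b \<and> a \<noteq> 0 then pi / 2 else 0)"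
proof -
  have eq: "sin (real a * s) * sin (real b * s) =
    (cos (of_int (int a - int b) * s) - cos (of_int (int a + int b) * s)) / 2" for s
    by (simp add: sin_times_sin algebra_simps)
  show ?thesis unfolding eq
    by (rule integral_unique)
      (rule has_integral_eq_rhs[OF has_integral_divide[OF has_integral_diff[OF
        has_integral_cos_half_period has_integral_cos_half_period]]], auto)
qed

text \<open>The source of the two wave numbers in the Energy Balance Criterion: a cosine of positive
  wave number meets the product of two sines only at the difference and at the sum of their wave
  numbers, with opposite signs.\<close>

lemma integral_sin_sin_cos_half_period:
  assumes "m > 0"
  shows "((\<lambda>s. sin (real a * s) * sin (real b * s) * cos (real m * s)) has_integral
    pi / 4 * ((if m = nat \<bar>int a - int b\<bar> then 1 else 0) - (if m = a + b then 1 else 0))) {0..pi}"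
proof -
  have id: "sin x * sin y * cos z =
    (cos (x - y - z) + cos (x - y + z)) / 4 - (cos (x + y - z) + cos (x + y + z)) / 4" for x y z :: real
    by (simp add: cos_add cos_diff sin_add sin_diff algebra_simps add_divide_distrib diff_divide_distrib)
  have eq: "sin (real a * s) * sin (real b * s) * cos (real m * s) =
    (cos (of_int (int a - int b - int m) * s) + cos (of_int (int a - int b + int m) * s)) / 4 -
    (cos (of_int (int a + int b - int m) * s) + cos (of_int (int a + int b + int m) * s)) / 4" for s
    unfolding id by (simp add: algebra_simps)
  show ?thesis unfolding eq
    by (rule has_integral_eq_rhs[OF has_integral_diff[OF
        has_integral_divide[OF has_integral_add[OF has_integral_cos_half_period has_integral_cos_half_period]]
        has_integral_divide[OF has_integral_add[OF has_integral_cos_half_period has_integral_cos_half_period]]]])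
      (use assms in auto)
qed

lemma has_integral_linear_times_sin:
  assumes "m > 0"
  shows "((\<lambda>s. (1 - s / pi) * sin (real m * s)) has_integral 1 / real m) {0..pi}"
proof -
  let ?F = "\<lambda>s. - ((1 - s / pi) * cos (real m * s)) / real m - sin (real m * s) / (pi * (real m)\<^sup>2)"
  have "((\<lambda>s. (1 - s / pi) * sin (real m * s)) has_integral (?F pi - ?F 0)) {0..pi}"
    by (rule fundamental_theorem_of_calculus)
      (use assms in \<open>auto intro!: derivative_eq_intros simp: field_simps power2_eq_square
        has_real_derivative_iff_has_vector_derivative[symmetric]\<close>)
  moreover have "sin (real m * pi) = 0" by simp
  ultimately show ?thesis using assms by simp
qed

text \<open>Profiles in \<open>x1\<close> for both phases at once: \<open>phase_T\<close> belongs to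
  the first two velocity components, \<open>phase_U\<close> to the third and, up to a sign for p =
  1, to the temperature. The signs are arranged so that U' = T and T' = -U for either phase, which
  makes one computation cover both.\<close>

definition phase_T :: "nat \<Rightarrow> real \<Rightarrow> real" where
  "phase_T p s = (if p = 1 then sin s else cos s)"

definition phase_U :: "nat \<Rightarrow> real \<Rightarrow> real" where
  "phase_U p s = (if p = 1 then - cos s else sin s)"

lemma DERIV_phase_T [derivative_intros]:
  "(f has_real_derivative f') (at s) \<Longrightarrow> ((\<lambda>s. phase_T p (f s)) has_real_derivative - phase_U p (f s) * f') (at s)"
  by (cases "p = 1") (auto simp: phase_T_def phase_U_def intro!: derivative_eq_intros)

lemma DERIV_phase_U [derivative_intros]:
  "(f has_real_derivative f') (at s) \<Longrightarrow> ((\<lambda>s. phase_U p (f s)) has_real_derivative phase_T p (f s) * f') (at s)"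
  by (cases "p = 1") (auto simp: phase_T_def phase_U_def intro!: derivative_eq_intros)

lemma continuous_on_phase_T [continuous_intros]:
  fixes f :: "'a::t2_space \<Rightarrow> real"
  shows "continuous_on S f \<Longrightarrow> continuous_on S (\<lambda>s. phase_T p (f s))"
  unfolding phase_T_def by (cases "p = 1") (auto intro!: continuous_intros)

lemma continuous_on_phase_U [continuous_intros]:
  fixes f :: "'a::t2_space \<Rightarrow> real"
  shows "continuous_on S f \<Longrightarrow> continuous_on S (\<lambda>s. phase_U p (f s))"
  unfolding phase_U_def by (cases "p = 1") (auto intro!: continuous_intros)

lemma trig_poly_phase:
  "trig_poly k (\<lambda>x. phase_T p (k * real m * fst x))" "trig_poly k (\<lambda>x. phase_U p (k * real m * fst x))"
  by (cases "p = 1"; auto simp: phase_T_def phase_U_def intro!: trig_poly_minus trig_poly.intros)+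

lemma integral_phase_T:
  assumes "k > 0"
  shows "integral {0..2 * pi / k} (\<lambda>s. phase_T p (k * real a * s) * phase_T q (k * real b * s)) =
    (if a = b \<and> (p = 1 \<longleftrightarrow> q = 1) then (if a = 0 then (if p = 1 then 0 else 2 * pi / k) else pi / k) else 0)"
  unfolding phase_T_def
  by (cases "p = 1"; cases "q = 1"; simp only: simp_thms if_True if_False
      integral_cos_cos_period[OF assms] integral_sin_sin_period[OF assms] integral_sin_cos_period[OF assms]; simp)

lemma integral_phase_U:
  assumes "k > 0"
  shows "integral {0..2 * pi / k} (\<lambda>s. phase_U p (k * real a * s) * phase_U q (k * real b * s)) =
    (if a = b \<and> (p = 1 \<longleftrightarrow> q = 1) then (if a = 0 then (if p = 1 then 2 * pi / k else 0) else pi / k) else 0)"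
  unfolding phase_U_def
  by (cases "p = 1"; cases "q = 1"; simp only: simp_thms if_True if_False minus_mult_minus
      mult_minus_left mult_minus_right integral_neg
      integral_cos_cos_period[OF assms] integral_sin_sin_period[OF assms] integral_sin_cos_period[OF assms]; simp)

lemma vel_mode_nth:
  "vel_mode k (a, j, p, c) x $ 1 = (if c = 1 then eta2 a j / (Kabs k a j * Vol k) * real j else 0) *
      phase_T p (k * real a * fst x) * cos (real j * snd x)"
  "vel_mode k (a, j, p, c) x $ 2 = (if c = 1 then 0 else eta2 a j / Vol k) *
      phase_T p (k * real a * fst x) * cos (real j * snd x)"
  "vel_mode k (a, j, p, c) x $ 3 = (if c = 1 then eta2 a j / (Kabs k a j * Vol k) * (k * real a) else 0) *
      phase_U p (k * real a * fst x) * sin (real j * snd x)"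
  by (cases x; auto simp: vel_mode_def phase_T_def phase_U_def axis_def)+

lemma temp_mode_phase:
  "temp_mode k (a, j, p, c) x = (if p = 1 then - 1 else 1) * (eta2 a j / Vol k) *
     phase_U p (k * real a * fst x) * sin (real j * snd x)"
  by (cases x) (auto simp: temp_mode_def phase_U_def)

lemma trig_poly_temp_mode: "trig_poly k (temp_mode k n)"
proof -
  obtain a j p c where n: "n = (a, j, p, c)" by (metis prod_cases4)
  show ?thesis unfolding n temp_mode_phase[abs_def]
    by (intro trig_poly.mult trig_poly.sin3 trig_poly_phase trig_poly.const)
qed

lemma vec_trig_poly_vel_mode: "vec_trig_poly k (vel_mode k n)"
proof -
  obtain a j p c where n: "n = (a, j, p, c)" by (metis prod_cases4)
  have "trig_poly k (\<lambda>x. vel_mode k n x $ i)" for i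
    using exhaust_3[of i] unfolding n
    by (auto simp only: vel_mode_nth intro!: trig_poly.mult trig_poly.sin3 trig_poly.cos3 trig_poly_phase trig_poly.const)
  then show ?thesis by (simp add: vec_trig_poly_def)
qed

lemma d_phase_T_cos:
  "d1 (\<lambda>x. A * phase_T p (w * fst x) * cos (j * snd x)) = (\<lambda>x. (- A * w) * phase_U p (w * fst x) * cos (j * snd x))"
  "d3 (\<lambda>x. A * phase_T p (w * fst x) * cos (j * snd x)) = (\<lambda>x. (- A * j) * phase_T p (w * fst x) * sin (j * snd x))"
  "d1 (\<lambda>x. A * phase_U p (w * fst x) * cos (j * snd x)) = (\<lambda>x. (A * w) * phase_T p (w * fst x) * cos (j * snd x))"
  "d3 (\<lambda>x. A * phase_T p (w * fst x) * sin (j * snd x)) = (\<lambda>x. (A * j) * phase_T p (w * fst x) * cos (j * snd x))"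
  by (rule d1_eqI d3_eqI; auto intro!: derivative_eq_intros
      simp: has_real_derivative_iff_has_vector_derivative[symmetric])+

lemma d_phase_U_sin:
  "d1 (\<lambda>x. A * phase_U p (w * fst x) * sin (j * snd x)) = (\<lambda>x. (A * w) * phase_T p (w * fst x) * sin (j * snd x))"
  "d3 (\<lambda>x. A * phase_U p (w * fst x) * sin (j * snd x)) = (\<lambda>x. (A * j) * phase_U p (w * fst x) * cos (j * snd x))"
  "d1 (\<lambda>x. A * phase_T p (w * fst x) * sin (j * snd x)) = (\<lambda>x. (- A * w) * phase_U p (w * fst x) * sin (j * snd x))"
  "d3 (\<lambda>x. A * phase_U p (w * fst x) * cos (j * snd x)) = (\<lambda>x. (- A * j) * phase_U p (w * fst x) * sin (j * snd x))"
  by (rule d1_eqI d3_eqI; auto intro!: derivative_eq_intros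
      simp: has_real_derivative_iff_has_vector_derivative[symmetric])+

lemma laplacian_phase:
  "laplacian (\<lambda>x. A * phase_T p (w * fst x) * cos (j * snd x)) x =
     - (w\<^sup>2 + j\<^sup>2) * (A * phase_T p (w * fst x) * cos (j * snd x))"
  "laplacian (\<lambda>x. A * phase_U p (w * fst x) * sin (j * snd x)) x =
     - (w\<^sup>2 + j\<^sup>2) * (A * phase_U p (w * fst x) * sin (j * snd x))"
  unfolding laplacian_def d_phase_T_cos d_phase_U_sin by (simp_all add: power2_eq_square algebra_simps)

text \<open>The square of \<open>Kabs\<close>, that is, the eigenvalue of the negative Laplacian on
  the mode.\<close>

definition wave2 :: "real \<Rightarrow> idx \<Rightarrow> real" where
  "wave2 k = (\<lambda>(m1, m3, p, c). k\<^sup>2 * (real m1)\<^sup>2 + (real m3)\<^sup>2)"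

lemma laplacian_vel_mode: "laplacian (vel_mode k n) x = - wave2 k n *\<^sub>R vel_mode k n x"
proof -
  obtain a j p c where n: "n = (a, j, p, c)" by (metis prod_cases4)
  have "laplacian (vel_mode k n) x $ i = (- wave2 k n *\<^sub>R vel_mode k n x) $ i" for i
    using exhaust_3[of i]
    by (auto simp: laplacian_vec_nth[OF vec_trig_poly_vel_mode] n vel_mode_nth laplacian_phase
        wave2_def power_mult_distrib)
  then show ?thesis by (simp add: vec_eq_iff)
qed

lemma laplacian_temp_mode: "laplacian (temp_mode k n) x = - wave2 k n * temp_mode k n x"
proof -
  obtain a j p c where n: "n = (a, j, p, c)" by (metis prod_cases4)
  show ?thesis unfolding n temp_mode_phase[abs_def] laplacian_phase
    by (simp add: wave2_def power_mult_distrib)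
qed

lemma d3_d3_temp_mode: "d3 (d3 (temp_mode k (a, j, p, c))) x = - (real j)\<^sup>2 * temp_mode k (a, j, p, c) x"
  unfolding temp_mode_phase[abs_def] d_phase_U_sin by (simp add: power2_eq_square)

lemma incompressible_vel_mode: "incompressible k (vel_mode k n)"
proof -
  obtain a j p c where n: "n = (a, j, p, c)" by (metis prod_cases4)
  show ?thesis
    unfolding incompressible_def
  proof (intro conjI allI vec_trig_poly_vel_mode)
    show "d1 (\<lambda>y. vel_mode k n y $ 1) x + d3 (\<lambda>y. vel_mode k n y $ 3) x = 0" for x
      unfolding n vel_mode_nth d_phase_T_cos d_phase_U_sin by simp
  qed (auto simp: n vel_mode_nth)
qed

section \<open>Orthonormality of the modes\<close>

lemma avg_phase_T_cos:
  assumes "k > 0"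
  shows "avg k (\<lambda>x. (A * phase_T p (k * real a * fst x) * cos (real j * snd x)) *
      (B * phase_T q (k * real b * fst x) * cos (real l * snd x))) =
    A * B * (if a = b \<and> (p = 1 \<longleftrightarrow> q = 1) then (if a = 0 then (if p = 1 then 0 else 2 * pi / k) else pi / k) else 0) *
    (if j = l then (if j = 0 then pi else pi / 2) else 0)"
proof -
  have "avg k (\<lambda>x. (A * phase_T p (k * real a * fst x) * cos (real j * snd x)) *
      (B * phase_T q (k * real b * fst x) * cos (real l * snd x))) =
    A * B * avg k (\<lambda>x. (phase_T p (k * real a * fst x) * phase_T q (k * real b * fst x)) *
       (cos (real j * snd x) * cos (real l * snd x)))"
    unfolding avg_cmult[symmetric] by (simp add: mult_ac)
  also have "\<dots> = A * B * (integral {0..2 * pi / k} (\<lambda>s. phase_T p (k * real a * s) * phase_T q (k * real b * s)) *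
      integral {0..pi} (\<lambda>s. cos (real j * s) * cos (real l * s)))"
    by (subst avg_product) (auto intro!: continuous_intros)
  finally show ?thesis
    unfolding integral_phase_T[OF assms] integral_cos_cos_half_period by simp
qed

lemma avg_phase_U_sin:
  assumes "k > 0"
  shows "avg k (\<lambda>x. (A * phase_U p (k * real a * fst x) * sin (real j * snd x)) *
      (B * phase_U q (k * real b * fst x) * sin (real l * snd x))) =
    A * B * (if a = b \<and> (p = 1 \<longleftrightarrow> q = 1) then (if a = 0 then (if p = 1 then 2 * pi / k else 0) else pi / k) else 0) *
    (if j = l \<and> j \<noteq> 0 then pi / 2 else 0)"
proof -
  have "avg k (\<lambda>x. (A * phase_U p (k * real a * fst x) * sin (real j * snd x)) *
      (B * phase_U q (k * real b * fst x) * sin (real l * snd x))) =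
    A * B * avg k (\<lambda>x. (phase_U p (k * real a * fst x) * phase_U q (k * real b * fst x)) *
       (sin (real j * snd x) * sin (real l * snd x)))"
    unfolding avg_cmult[symmetric] by (simp add: mult_ac)
  also have "\<dots> = A * B * (integral {0..2 * pi / k} (\<lambda>s. phase_U p (k * real a * s) * phase_U q (k * real b * s)) *
      integral {0..pi} (\<lambda>s. sin (real j * s) * sin (real l * s)))"
    by (subst avg_product) (auto intro!: continuous_intros)
  finally show ?thesis
    unfolding integral_phase_U[OF assms] integral_sin_sin_half_period by simp
qed

lemma Vol_squared: "k > 0 \<Longrightarrow> (Vol k)\<^sup>2 = pi\<^sup>2 / (2 * k)"
  by (simp add: Vol_def)

lemma Vol_pos: "k > 0 \<Longrightarrow> Vol k > 0"
  by (simp add: Vol_def)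

lemma Kabs_squared: "(Kabs k a j)\<^sup>2 = k\<^sup>2 * (real a)\<^sup>2 + (real j)\<^sup>2"
  by (simp add: Kabs_def)

text \<open>A factor 1/2 for each vanishing wave number compensates for the integral of a constant
  profile, which is twice that of a squared sine or cosine.\<close>

lemma amplitude_squared:
  assumes "k > 0"
  shows "eta2 a j / Vol k * (eta2 a j / Vol k) =
    (if a = 0 then 1 / 2 else 1) * (if j = 0 then 1 / 2 else 1) * (2 * k / pi\<^sup>2)"
proof -
  have e: "eta m * eta m = (if m = 0 then 1 / 2 else 1)" for m
    by (simp add: eta_def)
  have "eta2 a j / Vol k * (eta2 a j / Vol k) = (eta a * eta a) * (eta j * eta j) / (Vol k)\<^sup>2"
    by (simp add: eta2_def power2_eq_square)
  then show ?thesis by (simp add: e Vol_squared[OF assms])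
qed

lemma avg_temp_modes:
  assumes k: "k > 0" and n: "n \<in> temp_indices" "n' \<in> temp_indices"
  shows "avg k (\<lambda>x. temp_mode k n x * temp_mode k n' x) = (if n = n' then 1 else 0)"
proof -
  obtain a j p c where n1: "n = (a, j, p, c)" by (metis prod_cases4)
  obtain b l q e where n2: "n' = (b, l, q, e)" by (metis prod_cases4)
  let ?A = "\<lambda>p a j. (if p = 1 then - 1 else 1) * (eta2 a j / Vol k)"
  have avg: "avg k (\<lambda>x. temp_mode k n x * temp_mode k n' x) = ?A p a j * ?A q b l *
      (if a = b \<and> (p = 1 \<longleftrightarrow> q = 1) then (if a = 0 then (if p = 1 then 2 * pi / k else 0) else pi / k) else 0) *
      (if j = l \<and> j \<noteq> 0 then pi / 2 else 0)"
    unfolding n1 n2 temp_mode_phase by (rule avg_phase_U_sin[OF k])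
  show ?thesis
  proof (cases "n = n'")
    case True
    have "?A p a j * ?A p a j = eta2 a j / Vol k * (eta2 a j / Vol k)" by simp
    then have "?A p a j * ?A p a j = (if a = 0 then 1 / 2 else 1) * (2 * k / pi\<^sup>2)"
      using n unfolding amplitude_squared[OF k] by (simp add: n1 temp_indices_def)
    moreover have "a = b" "j = l" "p = q" "j \<noteq> 0" "a = 0 \<Longrightarrow> p = 1"
      using True n by (auto simp: n1 n2 temp_indices_def)
    ultimately show ?thesis using True k unfolding avg by (auto simp: power2_eq_square)
  next
    case False
    then have "\<not> (a = b \<and> (p = 1 \<longleftrightarrow> q = 1) \<and> j = l)"
      using n by (auto simp: n1 n2 temp_indices_def split: if_splits)
    then show ?thesis using False unfolding avg by auto
  qed
qed

text \<open>Distinct modes are orthogonal because of their profile in \<open>x1\<close>, their wave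
  number in \<open>x3\<close>, or else because they occupy different components. For c = 1 and
  positive wave number in \<open>x1\<close>, the first and third component contribute multiples of
  j^2 and (k a)^2, whose sum is cancelled by the square of \<open>Kabs\<close>.\<close>

lemma avg_vel_modes:
  assumes k: "k > 0" and n: "n \<in> vel_indices" "n' \<in> vel_indices"
  shows "avg k (\<lambda>x. vel_mode k n x \<bullet> vel_mode k n' x) = (if n = n' then 1 else 0)"
proof -
  obtain a j p c where n1: "n = (a, j, p, c)" by (metis prod_cases4)
  obtain b l q e where n2: "n' = (b, l, q, e)" by (metis prod_cases4)
  have tp: "trig_poly k (\<lambda>x. vel_mode k m x $ i)" for m i
    using vec_trig_poly_vel_mode[of k m] by (simp add: vec_trig_poly_def)
  let ?T = "if a = b \<and> (p = 1 \<longleftrightarrow> q = 1) then (if a = 0 then (if p = 1 then 0 else 2 * pi / k) else pi / k) else 0"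
  let ?U = "if a = b \<and> (p = 1 \<longleftrightarrow> q = 1) then (if a = 0 then (if p = 1 then 2 * pi / k else 0) else pi / k) else 0"
  let ?C = "if j = l then (if j = 0 then pi else pi / 2) else 0"
  let ?S = "if j = l \<and> j \<noteq> 0 then pi / 2 else 0"
  let ?A = "\<lambda>a j c. if c = (1::nat) then eta2 a j / (Kabs k a j * Vol k) * real j else 0"
  let ?B = "\<lambda>a j c. if c = (1::nat) then 0 else eta2 a j / Vol k"
  let ?D = "\<lambda>a j c. if c = (1::nat) then eta2 a j / (Kabs k a j * Vol k) * (k * real a) else 0"
  have "avg k (\<lambda>x. vel_mode k n x \<bullet> vel_mode k n' x) = avg k (\<lambda>x. (vel_mode k n x $ 1 * vel_mode k n' x $ 1 +
      vel_mode k n x $ 2 * vel_mode k n' x $ 2) + vel_mode k n x $ 3 * vel_mode k n' x $ 3)"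
    by (simp add: inner_vec_def sum_3)
  also have "\<dots> = avg k (\<lambda>x. vel_mode k n x $ 1 * vel_mode k n' x $ 1) +
      avg k (\<lambda>x. vel_mode k n x $ 2 * vel_mode k n' x $ 2) + avg k (\<lambda>x. vel_mode k n x $ 3 * vel_mode k n' x $ 3)"
    by (simp add: avg_add trig_poly_continuous[of k] trig_poly.add trig_poly.mult tp)
  also have "\<dots> = ?A a j c * ?A b l e * ?T * ?C + ?B a j c * ?B b l e * ?T * ?C + ?D a j c * ?D b l e * ?U * ?S"
    unfolding n1 n2 vel_mode_nth avg_phase_T_cos[OF k] avg_phase_U_sin[OF k] ..
  finally have avg: "avg k (\<lambda>x. vel_mode k n x \<bullet> vel_mode k n' x) =
    ?A a j c * ?A b l e * ?T * ?C + ?B a j c * ?B b l e * ?T * ?C + ?D a j c * ?D b l e * ?U * ?S" .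
  show ?thesis
  proof (cases "n = n'")
    case True
    then have eq: "b = a" "l = j" "q = p" "e = c" by (auto simp: n1 n2)
    \<comment> \<open>The index conditions exclude the modes that vanish identically or have no
      normalisation: sine profiles of wave number 0, c = 1 with j = 0, and the zero wave
      vector.\<close>
    have p: "a = 0 \<Longrightarrow> p \<noteq> 1" "j = 0 \<Longrightarrow> c \<noteq> 1" "j = 0 \<Longrightarrow> a \<noteq> 0"
      using n by (auto simp: n1 vel_indices_def split: if_splits)
    show ?thesis
    proof (cases "c = 1")
      case c: True
      have K: "Kabs k a j * Kabs k a j = k\<^sup>2 * (real a)\<^sup>2 + (real j)\<^sup>2"
        using Kabs_squared[of k a j] by (simp add: power2_eq_square)
      have Kp: "k\<^sup>2 * (real a)\<^sup>2 + (real j)\<^sup>2 > 0" 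
        by (rule add_nonneg_pos) (use p(2) c in auto)
      have r: "eta2 a j / (Kabs k a j * Vol k) * s * (eta2 a j / (Kabs k a j * Vol k) * s) =
          s\<^sup>2 * (if a = 0 then 1 / 2 else 1) * (2 * k / pi\<^sup>2) / (k\<^sup>2 * (real a)\<^sup>2 + (real j)\<^sup>2)" for s
      proof -
        have "eta2 a j / (Kabs k a j * Vol k) * s * (eta2 a j / (Kabs k a j * Vol k) * s) =
          s\<^sup>2 * (eta2 a j / Vol k * (eta2 a j / Vol k)) / (Kabs k a j * Kabs k a j)"
          by (simp add: power2_eq_square mult_ac)
        moreover have "j \<noteq> 0" using p(2) c by auto
        ultimately show ?thesis unfolding amplitude_squared[OF k] K by simp
      qed
      show ?thesis
      proof (cases "a = 0")
        case a: True
        have "avg k (\<lambda>x. vel_mode k n x \<bullet> vel_mode k n' x) =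
            (eta2 a j / (Kabs k a j * Vol k) * real j * (eta2 a j / (Kabs k a j * Vol k) * real j)) *
            (2 * pi / k * (pi / 2))"
          using a c p unfolding avg eq by auto
        also have "\<dots> = 1" unfolding r using a p(2) c k by (auto simp: power2_eq_square)
        finally show ?thesis using True by simp
      next
        case a: False
        have "avg k (\<lambda>x. vel_mode k n x \<bullet> vel_mode k n' x) =
            (eta2 a j / (Kabs k a j * Vol k) * real j * (eta2 a j / (Kabs k a j * Vol k) * real j)) *
              (pi / k * (pi / 2)) +
            (eta2 a j / (Kabs k a j * Vol k) * (k * real a) * (eta2 a j / (Kabs k a j * Vol k) * (k * real a))) *
              (pi / k * (pi / 2))"
          using a c p unfolding avg eq by auto
        also have "\<dots> = ((real j)\<^sup>2 + (k * real a)\<^sup>2) * (2 * k / pi\<^sup>2) /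
            (k\<^sup>2 * (real a)\<^sup>2 + (real j)\<^sup>2) * (pi / k * (pi / 2))"
          unfolding r using a by (simp only: if_False mult_1_right distrib_right add_divide_distrib)
        also have "\<dots> = (2 * k / pi\<^sup>2) * (pi / k * (pi / 2))"
          using Kp by (simp add: power_mult_distrib add.commute)
        finally show ?thesis using True k by (simp add: power2_eq_square)
      qed
    next
      case c: False
      then have "avg k (\<lambda>x. vel_mode k n x \<bullet> vel_mode k n' x) =
        (if a = 0 then 1 / 2 else 1) * (if j = 0 then 1 / 2 else 1) * (2 * k / pi\<^sup>2) * ?T * ?C"
        unfolding avg eq amplitude_squared[OF k, symmetric] by simp
      then show ?thesis using True p k unfolding eq by (auto simp: power2_eq_square)
    qed
  next
    case False
    then consider "\<not> (a = b \<and> (p = 1 \<longleftrightarrow> q = 1))" | "j \<noteq> l" | "a = b" "j = l" "c \<noteq> e"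
      using n by (auto simp: n1 n2 vel_indices_def split: if_splits)
    then show ?thesis
    proof cases
      case 1
      then show ?thesis unfolding avg if_not_P[OF 1] using False by simp
    next
      case 2
      then have "\<not> (j = l \<and> j \<noteq> 0)" by simp
      then show ?thesis unfolding avg if_not_P[OF 2] if_not_P[OF \<open>\<not> (j = l \<and> j \<noteq> 0)\<close>] using False by simp
    next
      case 3
      then have "c = 1 \<and> e \<noteq> 1 \<or> c \<noteq> 1 \<and> e = 1"
        using n by (auto simp: n1 n2 vel_indices_def split: if_splits)
      then show ?thesis
        unfolding avg if_not_P[OF False]
        by (elim disjE conjE) (simp_all only: if_True if_False simp_thms mult_zero_left mult_zero_right add_0)
    qed
  qed
qed

section \<open>The truncated model in coordinates\<close>

lemma vel_sum_nth: "vel_sum k N a x $ i = (\<Sum>n\<in>N. a n * vel_mode k n x $ i)"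
  by (simp add: vel_sum_def)

lemma vec_trig_poly_nth: "vec_trig_poly k u \<Longrightarrow> trig_poly k (\<lambda>x. u x $ i)"
  by (simp add: vec_trig_poly_def)

lemma vec_trig_poly_linear_sum:
  "(\<And>j. j \<in> J \<Longrightarrow> vec_trig_poly k (w j)) \<Longrightarrow> vec_trig_poly k (\<lambda>x. \<Sum>j\<in>J. c j *\<^sub>R w j x)"
  by (auto simp: vec_trig_poly_def intro!: trig_poly_sum trig_poly.mult trig_poly.const)

lemma trig_poly_linear_sum:
  "(\<And>j. j \<in> J \<Longrightarrow> trig_poly k (g j)) \<Longrightarrow> trig_poly k (\<lambda>x. \<Sum>j\<in>J. c j * g j x)"
  by (intro trig_poly_sum trig_poly.mult trig_poly.const)

lemma vec_trig_poly_vel_sum: "vec_trig_poly k (vel_sum k N a)"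
  unfolding vel_sum_def by (intro vec_trig_poly_linear_sum vec_trig_poly_vel_mode)

lemma trig_poly_temp_sum: "trig_poly k (temp_sum k N b)"
  unfolding temp_sum_def by (intro trig_poly_linear_sum trig_poly_temp_mode)

lemma trig_poly_vel_mode_nth: "trig_poly k (\<lambda>x. vel_mode k n x $ i)"
  by (intro vec_trig_poly_nth vec_trig_poly_vel_mode)

lemma incompressible_vel_sum: "incompressible k (vel_sum k N a)"
  unfolding incompressible_def
proof (intro conjI allI vec_trig_poly_vel_sum)
  have m: "d1 (\<lambda>y. vel_mode k n y $ 1) x + d3 (\<lambda>y. vel_mode k n y $ 3) x = 0" for n x
    using incompressible_vel_mode[of k n] unfolding incompressible_def by blast
  show "d1 (\<lambda>y. vel_sum k N a y $ 1) x + d3 (\<lambda>y. vel_sum k N a y $ 3) x = 0" for x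
    unfolding vel_sum_nth d1_linear_sum[OF trig_poly_vel_mode_nth] d3_linear_sum[OF trig_poly_vel_mode_nth]
    by (simp add: sum.distrib[symmetric] distrib_left[symmetric] m)
  have "vel_mode k n (x1, 0) $ 3 = 0 \<and> vel_mode k n (x1, pi) $ 3 = 0" for n x1
    using incompressible_vel_mode[of k n] unfolding incompressible_def by blast
  then show "vel_sum k N a (x1, 0) $ 3 = 0" "vel_sum k N a (x1, pi) $ 3 = 0" for x1
    by (simp_all add: vel_sum_nth)
qed

lemma d1_vel_sum: "d1 (vel_sum k N a) x = (\<Sum>n\<in>N. a n *\<^sub>R d1 (vel_mode k n) x)"
  by (simp add: vec_eq_iff d1_vec[OF vec_trig_poly_vel_sum] d1_vec[OF vec_trig_poly_vel_mode]
      vel_sum_nth d1_linear_sum[OF trig_poly_vel_mode_nth])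

lemma d3_vel_sum: "d3 (vel_sum k N a) x = (\<Sum>n\<in>N. a n *\<^sub>R d3 (vel_mode k n) x)"
  by (simp add: vec_eq_iff d3_vec[OF vec_trig_poly_vel_sum] d3_vec[OF vec_trig_poly_vel_mode]
      vel_sum_nth d3_linear_sum[OF trig_poly_vel_mode_nth])

lemma advect_vel_sum:
  "advect (vel_sum k N a) g x = (\<Sum>n\<in>N. a n *\<^sub>R advect (vel_mode k n) g x)"
  by (simp add: advect_def vel_sum_nth scaleR_sum_left scaleR_sum_right sum.distrib scaleR_add_right)

lemma advect_into_vel_sum:
  "advect u (vel_sum k N a) x = (\<Sum>n\<in>N. a n *\<^sub>R advect u (vel_mode k n) x)"
  by (simp add: advect_def d1_vel_sum d3_vel_sum scaleR_sum_right sum.distrib scaleR_add_right mult.commute)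

lemma advect_into_temp_sum:
  "advect u (temp_sum k N b) x = (\<Sum>n\<in>N. b n * advect u (temp_mode k n) x)"
  by (simp add: advect_def temp_sum_def d1_linear_sum[OF trig_poly_temp_mode]
      d3_linear_sum[OF trig_poly_temp_mode] sum_distrib_left sum.distrib distrib_left mult_ac)

lemma laplacian_linear_sum:
  assumes "\<And>j. j \<in> J \<Longrightarrow> trig_poly k (g j)"
  shows "laplacian (\<lambda>x. \<Sum>j\<in>J. c j * g j x) x = (\<Sum>j\<in>J. c j * laplacian (g j) x)"
  unfolding laplacian_def
  by (simp add: d1_linear_sum[OF assms] d3_linear_sum[OF assms]
      d1_linear_sum[OF trig_poly_d1[OF assms]] d3_linear_sum[OF trig_poly_d3[OF assms]]
      sum.distrib distrib_left)

lemma laplacian_vel_sum: "laplacian (vel_sum k N a) = vel_sum k N (\<lambda>n. - wave2 k n * a n)"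
proof (rule ext)
  fix x
  have "laplacian (vel_sum k N a) x $ i = vel_sum k N (\<lambda>n. - wave2 k n * a n) x $ i" for i
  proof -
    have "laplacian (vel_sum k N a) x $ i = (\<Sum>n\<in>N. a n * laplacian (\<lambda>y. vel_mode k n y $ i) x)"
      unfolding laplacian_vec_nth[OF vec_trig_poly_vel_sum] vel_sum_nth
      by (rule laplacian_linear_sum[OF trig_poly_vel_mode_nth])
    also have "\<dots> = vel_sum k N (\<lambda>n. - wave2 k n * a n) x $ i"
      by (simp add: laplacian_vec_nth[OF vec_trig_poly_vel_mode, symmetric] laplacian_vel_mode vel_sum_nth mult_ac)
    finally show ?thesis .
  qed
  then show "laplacian (vel_sum k N a) x = vel_sum k N (\<lambda>n. - wave2 k n * a n) x"
    by (simp add: vec_eq_iff)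
qed

lemma laplacian_temp_sum: "laplacian (temp_sum k N b) = temp_sum k N (\<lambda>n. - wave2 k n * b n)"
  by (rule ext) (simp add: temp_sum_def laplacian_linear_sum[OF trig_poly_temp_mode] laplacian_temp_mode mult_ac)

lemma vel_coeff_linear_sum:
  assumes "finite J" "\<And>j. j \<in> J \<Longrightarrow> vec_trig_poly k (w j)"
  shows "vel_coeff k (\<lambda>x. \<Sum>j\<in>J. c j *\<^sub>R w j x) n = (\<Sum>j\<in>J. c j * vel_coeff k (w j) n)"
  unfolding vel_coeff_def inner_sum_left inner_scaleR_left
  by (rule avg_linear_sum[OF assms(1)])
    (intro trig_poly_continuous[of k] trig_poly_inner assms vec_trig_poly_vel_mode)

lemma temp_coeff_linear_sum:
  assumes "finite J" "\<And>j. j \<in> J \<Longrightarrow> trig_poly k (g j)"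
  shows "temp_coeff k (\<lambda>x. \<Sum>j\<in>J. c j * g j x) n = (\<Sum>j\<in>J. c j * temp_coeff k (g j) n)"
  unfolding temp_coeff_def sum_distrib_right mult.assoc
  by (rule avg_linear_sum[OF assms(1)])
    (intro trig_poly_continuous[of k] trig_poly.mult assms trig_poly_temp_mode)

lemma avg_inner_vel_sum:
  assumes "finite N" "vec_trig_poly k w"
  shows "avg k (\<lambda>x. w x \<bullet> vel_sum k N a x) = (\<Sum>n\<in>N. a n * vel_coeff k w n)"
  unfolding vel_coeff_def vel_sum_def inner_sum_right inner_scaleR_right
  by (rule avg_linear_sum[OF assms(1)])
    (intro trig_poly_continuous[of k] trig_poly_inner assms vec_trig_poly_vel_mode)

lemma avg_mult_temp_sum:
  assumes "finite N" "continuous_on UNIV g"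
  shows "avg k (\<lambda>x. g x * temp_sum k N b x) = (\<Sum>n\<in>N. b n * temp_coeff k g n)"
proof -
  have "avg k (\<lambda>x. g x * temp_sum k N b x) = avg k (\<lambda>x. \<Sum>n\<in>N. b n * (g x * temp_mode k n x))"
    by (simp add: temp_sum_def sum_distrib_left mult_ac)
  also have "\<dots> = (\<Sum>n\<in>N. b n * temp_coeff k g n)"
    unfolding temp_coeff_def
    by (rule avg_linear_sum[OF assms(1)])
      (intro continuous_intros assms trig_poly_continuous[of k] trig_poly_temp_mode)
  finally show ?thesis .
qed

lemma cross3_e3: "cross3 e3 u $ 1 = - u $ 2" "cross3 e3 u $ 2 = u $ 1" "cross3 e3 u $ 3 = 0"
  by (simp_all add: cross3_def e3_def axis_def)

lemma vec_trig_poly_cross3: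
  assumes "vec_trig_poly k u" shows "vec_trig_poly k (\<lambda>x. cross3 e3 (u x))"
proof -
  have "trig_poly k (\<lambda>x. cross3 e3 (u x) $ i)" for i
    using exhaust_3[of i] trig_poly_minus[OF vec_trig_poly_nth[OF assms, of 2]] vec_trig_poly_nth[OF assms, of 1]
    by (elim disjE) (simp_all add: cross3_e3 trig_poly.const)
  then show ?thesis by (simp add: vec_trig_poly_def)
qed

lemma cross3_vel_sum: "cross3 e3 (vel_sum k N a x) = (\<Sum>n\<in>N. a n *\<^sub>R cross3 e3 (vel_mode k n x))"
proof -
  have "cross3 e3 (vel_sum k N a x) $ i = (\<Sum>n\<in>N. a n *\<^sub>R cross3 e3 (vel_mode k n x)) $ i" for i
    using exhaust_3[of i] by (auto simp: cross3_e3 vel_sum_nth sum_negf)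
  then show ?thesis by (simp add: vec_eq_iff)
qed

lemma cross3_orthogonal: "cross3 e3 u \<bullet> u = 0"
  by (simp add: inner_vec_def sum_3 cross3_e3)

lemma vec_trig_poly_e3: "trig_poly k g \<Longrightarrow> vec_trig_poly k (\<lambda>x. g x *\<^sub>R e3)"
  by (auto simp: vec_trig_poly_def e3_def axis_def intro: trig_poly.const trig_poly.mult)

lemma inner_e3: "(s *\<^sub>R e3) \<bullet> u = u $ 3 * s"
  by (simp add: e3_def inner_axis' mult.commute)

lemma wave2_nonneg: "wave2 k n \<ge> 0"
  by (cases n) (simp add: wave2_def)

lemma vel_sum_combine:
  "vel_sum k N a x + vel_sum k N b x = vel_sum k N (\<lambda>n. a n + b n) x"
  "vel_sum k N a x - vel_sum k N b x = vel_sum k N (\<lambda>n. a n - b n) x"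
  "c *\<^sub>R vel_sum k N a x = vel_sum k N (\<lambda>n. c * a n) x"
  by (simp_all add: vel_sum_def sum.distrib sum_subtractf scaleR_sum_right algebra_simps)

lemma temp_sum_combine:
  "temp_sum k N a x + temp_sum k N b x = temp_sum k N (\<lambda>n. a n + b n) x"
  "temp_sum k N a x - temp_sum k N b x = temp_sum k N (\<lambda>n. a n - b n) x"
  by (simp_all add: temp_sum_def sum.distrib sum_subtractf algebra_simps)

section \<open>Fields and their coefficient vectors\<close>

locale truncated_model =
  fixes R S P k :: real and Nu Nt :: "idx set"
  assumes adm: "admissible R S P k" and idx: "index_sets Nu Nt"
begin

lemma RS: "R \<ge> 0" "S \<ge> 0" and P: "P > 0" and k: "k > 0"
  using adm by (auto simp: admissible_def)

lemma finNu: "finite Nu" and finNt: "finite Nt" and Nu: "Nu \<subseteq> vel_indices" and Nt: "Nt \<subseteq> temp_indices"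
  using idx by (auto simp: index_sets_def)

lemma vel_coeff_vel_sum: "n \<in> Nu \<Longrightarrow> vel_coeff k (vel_sum k Nu a) n = a n"
proof -
  assume n: "n \<in> Nu"
  have "vel_coeff k (vel_sum k Nu a) n = (\<Sum>m\<in>Nu. a m * vel_coeff k (vel_mode k m) n)"
    unfolding vel_sum_def by (rule vel_coeff_linear_sum[OF finNu vec_trig_poly_vel_mode])
  also have "\<dots> = (\<Sum>m\<in>Nu. if n = m then a m else 0)"
    unfolding vel_coeff_def
    by (intro sum.cong refl, subst avg_vel_modes[OF k]) (use n Nu in auto)
  finally show ?thesis using n finNu by simp
qed

lemma temp_coeff_temp_sum: "n \<in> Nt \<Longrightarrow> temp_coeff k (temp_sum k Nt b) n = b n"
proof -
  assume n: "n \<in> Nt"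
  have "temp_coeff k (temp_sum k Nt b) n = (\<Sum>m\<in>Nt. b m * temp_coeff k (temp_mode k m) n)"
    unfolding temp_sum_def by (rule temp_coeff_linear_sum[OF finNt trig_poly_temp_mode])
  also have "\<dots> = (\<Sum>m\<in>Nt. if n = m then b m else 0)"
    unfolding temp_coeff_def
    by (intro sum.cong refl, subst avg_temp_modes[OF k]) (use n Nt in auto)
  finally show ?thesis using n finNt by simp
qed

text \<open>Velocity and temperature coefficients form one vector over a disjoint union, to which
  the general theory of \<open>poly_ode\<close> applies. Entries outside \<open>I\<close> carry no
  meaning: \<open>state_of\<close> identifies vectors that agree on \<open>I\<close>.\<close>

definition I :: "(idx + idx) set" where "I = Nu <+> Nt"

abbreviation u_of :: "(idx + idx \<Rightarrow> real) \<Rightarrow> vfield" where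
  "u_of c \<equiv> vel_sum k Nu (\<lambda>n. c (Inl n))"

abbreviation \<theta>_of :: "(idx + idx \<Rightarrow> real) \<Rightarrow> sfield" where
  "\<theta>_of c \<equiv> temp_sum k Nt (\<lambda>n. c (Inr n))"

definition state_of :: "(idx + idx \<Rightarrow> real) \<Rightarrow> state" where
  "state_of c = (u_of c, \<theta>_of c)"

definition coords :: "state \<Rightarrow> idx + idx \<Rightarrow> real" where
  "coords X = (\<lambda>i. case i of Inl n \<Rightarrow> vel_coeff k (fst X) n | Inr n \<Rightarrow> temp_coeff k (snd X) n)"

definition F :: "(idx + idx \<Rightarrow> real) \<Rightarrow> idx + idx \<Rightarrow> real" where
  "F c = (\<lambda>i. case i of
      Inl n \<Rightarrow> - (P * wave2 k n) * c (Inl n) + P * R * vel_coeff k (\<lambda>y. \<theta>_of c y *\<^sub>R e3) n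
        - P * S * vel_coeff k (\<lambda>y. cross3 e3 (u_of c y)) n - vel_coeff k (advect (u_of c) (u_of c)) n
    | Inr n \<Rightarrow> - wave2 k n * c (Inr n) + temp_coeff k (\<lambda>y. u_of c y $ 3) n
        - temp_coeff k (advect (u_of c) (\<theta>_of c)) n)"

lemma finI: "finite I" unfolding I_def using finNu finNt by simp

lemma Inl_in_I [simp]: "Inl n \<in> I \<longleftrightarrow> n \<in> Nu" and Inr_in_I [simp]: "Inr n \<in> I \<longleftrightarrow> n \<in> Nt"
  by (auto simp: I_def)

lemma sum_I: "(\<Sum>i\<in>I. g i) = (\<Sum>n\<in>Nu. g (Inl n)) + (\<Sum>n\<in>Nt. g (Inr n))"
  unfolding I_def by (simp add: sum.Plus finNu finNt)

lemma coords_state_of: "i \<in> I \<Longrightarrow> coords (state_of c) i = c i"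
  by (auto simp: I_def coords_def state_of_def vel_coeff_vel_sum temp_coeff_temp_sum)

lemma state_of_cong: "(\<And>i. i \<in> I \<Longrightarrow> c i = d i) \<Longrightarrow> state_of c = state_of d"
proof -
  assume c: "\<And>i. i \<in> I \<Longrightarrow> c i = d i"
  have "c (Inl n) = d (Inl n)" if "n \<in> Nu" for n using c that by (auto simp: I_def)
  moreover have "c (Inr n) = d (Inr n)" if "n \<in> Nt" for n using c that by (auto simp: I_def)
  ultimately show ?thesis by (simp add: state_of_def vel_sum_def temp_sum_def cong: sum.cong)
qed

lemma state_of_in: "state_of c \<in> phase_space k Nu Nt"
  by (simp add: state_of_def phase_space_def)

lemma phase_spaceE:
  assumes "X \<in> phase_space k Nu Nt"
  obtains c where "X = state_of c"
proof -
  from assms obtain a b where "X = (vel_sum k Nu a, temp_sum k Nt b)"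
    by (auto simp: phase_space_def)
  then have "X = state_of (\<lambda>i. case i of Inl n \<Rightarrow> a n | Inr n \<Rightarrow> b n)" by (simp add: state_of_def)
  then show ?thesis by (rule that)
qed

lemma state_of_coords: "X \<in> phase_space k Nu Nt \<Longrightarrow> state_of (coords X) = X"
  by (elim phase_spaceE) (auto intro: state_of_cong coords_state_of)

lemma rhs_u_state_of: "rhs_u R S P k Nu (state_of c) = vel_sum k Nu (\<lambda>n. F c (Inl n))"
  by (rule ext) (simp add: rhs_u_def state_of_def laplacian_vel_sum proj_u_def vel_sum_combine F_def mult_ac)

lemma rhs_t_state_of: "rhs_t k Nt (state_of c) = temp_sum k Nt (\<lambda>n. F c (Inr n))"
  by (rule ext) (simp add: rhs_t_def state_of_def laplacian_temp_sum proj_t_def temp_sum_combine F_def)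

text \<open>Buoyancy, rotation and the forcing by u3 are linear in the state and advection is
  bilinear; expanding the state in modes leaves sums of coordinates and of products of two
  coordinates, with fixed integrals as coefficients.\<close>

lemma polyfun_F: "i \<in> I \<Longrightarrow> polyfun I (\<lambda>c. F c i)"
proof -
  assume i: "i \<in> I"
  have c1: "polyfun I (\<lambda>c. c (Inl n))" if "n \<in> Nu" for n
    using that by (auto simp: I_def intro: polyfun.coord)
  have c2: "polyfun I (\<lambda>c. c (Inr n))" if "n \<in> Nt" for n
    using that by (auto simp: I_def intro: polyfun.coord)
  note poly = polyfun.add polyfun_diff polyfun.mult polyfun.const polyfun_sum c1 c2
  show ?thesis
  proof (cases i)
    case (Inl n)
    then have n: "n \<in> Nu" using i by (auto simp: I_def)
    have 1: "vel_coeff k (\<lambda>y. \<theta>_of c y *\<^sub>R e3) n =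
        (\<Sum>m\<in>Nt. c (Inr m) * vel_coeff k (\<lambda>y. temp_mode k m y *\<^sub>R e3) n)" for c
      unfolding temp_sum_def scaleR_sum_left scaleR_scaleR[symmetric]
      by (rule vel_coeff_linear_sum[OF finNt]) (intro vec_trig_poly_e3 trig_poly_temp_mode)
    have 2: "vel_coeff k (\<lambda>y. cross3 e3 (u_of c y)) n =
        (\<Sum>m\<in>Nu. c (Inl m) * vel_coeff k (\<lambda>y. cross3 e3 (vel_mode k m y)) n)" for c
      unfolding cross3_vel_sum
      by (rule vel_coeff_linear_sum[OF finNu]) (intro vec_trig_poly_cross3 vec_trig_poly_vel_mode)
    have 3: "vel_coeff k (advect (u_of c) (u_of c)) n =
        (\<Sum>l\<in>Nu. c (Inl l) * (\<Sum>m\<in>Nu. c (Inl m) * vel_coeff k (advect (vel_mode k l) (vel_mode k m)) n))" for c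
    proof -
      have "advect (u_of c) (u_of c) = (\<lambda>x. \<Sum>l\<in>Nu. c (Inl l) *\<^sub>R advect (vel_mode k l) (u_of c) x)"
        by (rule ext) (rule advect_vel_sum)
      then have "vel_coeff k (advect (u_of c) (u_of c)) n =
          (\<Sum>l\<in>Nu. c (Inl l) * vel_coeff k (advect (vel_mode k l) (u_of c)) n)"
        by (simp add: vel_coeff_linear_sum[OF finNu] vec_trig_poly_advect vec_trig_poly_vel_mode vec_trig_poly_vel_sum)
      moreover have "advect (vel_mode k l) (u_of c) =
          (\<lambda>x. \<Sum>m\<in>Nu. c (Inl m) *\<^sub>R advect (vel_mode k l) (vel_mode k m) x)" for l
        by (rule ext) (rule advect_into_vel_sum)
      ultimately show ?thesis
        by (simp add: vel_coeff_linear_sum[OF finNu] vec_trig_poly_advect vec_trig_poly_vel_mode)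
    qed
    show ?thesis unfolding Inl F_def sum.case 1 2 3 using n by (intro poly)
  next
    case (Inr n)
    then have n: "n \<in> Nt" using i by (auto simp: I_def)
    have 1: "temp_coeff k (\<lambda>y. u_of c y $ 3) n =
        (\<Sum>m\<in>Nu. c (Inl m) * temp_coeff k (\<lambda>y. vel_mode k m y $ 3) n)" for c
      unfolding vel_sum_nth
      by (rule temp_coeff_linear_sum[OF finNu trig_poly_vel_mode_nth])
    have 2: "temp_coeff k (advect (u_of c) (\<theta>_of c)) n =
        (\<Sum>l\<in>Nu. c (Inl l) * (\<Sum>m\<in>Nt. c (Inr m) * temp_coeff k (advect (vel_mode k l) (temp_mode k m)) n))" for c
    proof -
      have "advect (u_of c) (\<theta>_of c) = (\<lambda>x. \<Sum>l\<in>Nu. c (Inl l) * advect (vel_mode k l) (\<theta>_of c) x)"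
        by (rule ext) (simp add: advect_vel_sum)
      then have "temp_coeff k (advect (u_of c) (\<theta>_of c)) n =
          (\<Sum>l\<in>Nu. c (Inl l) * temp_coeff k (advect (vel_mode k l) (\<theta>_of c)) n)"
        by (simp add: temp_coeff_linear_sum[OF finNu] trig_poly_advect vec_trig_poly_vel_mode trig_poly_temp_sum)
      moreover have "advect (vel_mode k l) (\<theta>_of c) =
          (\<lambda>x. \<Sum>m\<in>Nt. c (Inr m) * advect (vel_mode k l) (temp_mode k m) x)" for l
        by (rule ext) (rule advect_into_temp_sum)
      ultimately show ?thesis
        by (simp add: temp_coeff_linear_sum[OF finNt] trig_poly_advect vec_trig_poly_vel_mode trig_poly_temp_mode)
    qed
    show ?thesis unfolding Inr F_def sum.case 1 2 using n by (intro poly)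
  qed
qed

definition flux :: "(idx + idx \<Rightarrow> real) \<Rightarrow> real" where
  "flux c = avg k (\<lambda>x. u_of c x $ 3 * \<theta>_of c x)"

text \<open>Testing a projection against a field of the model undoes the projection. Advection then
  drops out by incompressibility, rotation by orthogonality, and the two couplings both give the
  vertical heat flux, buoyancy with weight P R and the forcing of the temperature with weight
  1.\<close>

lemma energy_identity:
  "(\<Sum>i\<in>I. c i * F c i) = - P * (\<Sum>n\<in>Nu. wave2 k n * (c (Inl n))\<^sup>2)
     - (\<Sum>n\<in>Nt. wave2 k n * (c (Inr n))\<^sup>2) + (P * R + 1) * flux c"
proof -
  have u: "(\<Sum>n\<in>Nu. c (Inl n) * vel_coeff k w n) = avg k (\<lambda>x. w x \<bullet> u_of c x)" if "vec_trig_poly k w" for w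
    using avg_inner_vel_sum[OF finNu that] by simp
  have t: "(\<Sum>n\<in>Nt. c (Inr n) * temp_coeff k g n) = avg k (\<lambda>x. g x * \<theta>_of c x)" if "trig_poly k g" for g
    using avg_mult_temp_sum[OF finNt trig_poly_continuous[OF that]] by simp
  have "(\<Sum>n\<in>Nu. c (Inl n) * F c (Inl n)) = - P * (\<Sum>n\<in>Nu. wave2 k n * (c (Inl n))\<^sup>2)
      + P * R * (\<Sum>n\<in>Nu. c (Inl n) * vel_coeff k (\<lambda>y. \<theta>_of c y *\<^sub>R e3) n)
      - P * S * (\<Sum>n\<in>Nu. c (Inl n) * vel_coeff k (\<lambda>y. cross3 e3 (u_of c y)) n)
      - (\<Sum>n\<in>Nu. c (Inl n) * vel_coeff k (advect (u_of c) (u_of c)) n)"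
    unfolding sum_distrib_left sum.distrib[symmetric] sum_subtractf[symmetric]
    by (intro sum.cong) (auto simp: F_def algebra_simps power2_eq_square)
  also have "\<dots> = - P * (\<Sum>n\<in>Nu. wave2 k n * (c (Inl n))\<^sup>2) + P * R * flux c"
    unfolding u[OF vec_trig_poly_e3[OF trig_poly_temp_sum]] u[OF vec_trig_poly_cross3[OF vec_trig_poly_vel_sum]]
      u[OF vec_trig_poly_advect[OF vec_trig_poly_vel_sum vec_trig_poly_vel_sum]]
      avg_advect_vec_self[OF incompressible_vel_sum k] cross3_orthogonal inner_e3 flux_def
    by (simp add: avg_def)
  finally have 1: "(\<Sum>n\<in>Nu. c (Inl n) * F c (Inl n)) =
      - P * (\<Sum>n\<in>Nu. wave2 k n * (c (Inl n))\<^sup>2) + P * R * flux c" .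
  have "(\<Sum>n\<in>Nt. c (Inr n) * F c (Inr n)) = - (\<Sum>n\<in>Nt. wave2 k n * (c (Inr n))\<^sup>2)
      + (\<Sum>n\<in>Nt. c (Inr n) * temp_coeff k (\<lambda>y. u_of c y $ 3) n)
      - (\<Sum>n\<in>Nt. c (Inr n) * temp_coeff k (advect (u_of c) (\<theta>_of c)) n)"
    unfolding sum_negf[symmetric] sum.distrib[symmetric] sum_subtractf[symmetric]
    by (intro sum.cong) (auto simp: F_def algebra_simps power2_eq_square)
  also have "\<dots> = - (\<Sum>n\<in>Nt. wave2 k n * (c (Inr n))\<^sup>2) + flux c"
    unfolding t[OF vec_trig_poly_nth[OF vec_trig_poly_vel_sum]]
      t[OF trig_poly_advect[OF vec_trig_poly_vel_sum trig_poly_temp_sum]]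
      avg_advect_self[OF incompressible_vel_sum trig_poly_temp_sum k] flux_def by simp
  finally show ?thesis unfolding sum_I 1 by (simp add: algebra_simps)
qed

lemma avg_state_of_squared:
  "avg k (\<lambda>x. (norm (u_of c x))\<^sup>2 + (\<theta>_of c x)\<^sup>2) = (\<Sum>i\<in>I. (c i)\<^sup>2)"
proof -
  have "avg k (\<lambda>x. (norm (u_of c x))\<^sup>2 + (\<theta>_of c x)\<^sup>2) =
      avg k (\<lambda>x. u_of c x \<bullet> u_of c x) + avg k (\<lambda>x. \<theta>_of c x * \<theta>_of c x)"
    unfolding power2_norm_eq_inner power2_eq_square[of "\<theta>_of c x" for x]
    by (intro avg_add trig_poly_continuous[of k] trig_poly_inner trig_poly.mult
        vec_trig_poly_vel_sum trig_poly_temp_sum)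
  also have "\<dots> = (\<Sum>i\<in>I. (c i)\<^sup>2)"
    unfolding avg_inner_vel_sum[OF finNu vec_trig_poly_vel_sum]
      avg_mult_temp_sum[OF finNt trig_poly_continuous[OF trig_poly_temp_sum]] sum_I
    by (simp add: vel_coeff_vel_sum temp_coeff_temp_sum power2_eq_square)
  finally show ?thesis .
qed

lemma continuous_on_state_norm: "continuous_on A (\<lambda>x. (norm (u_of c x))\<^sup>2 + (\<theta>_of c x)\<^sup>2)"
  unfolding power2_norm_eq_inner power2_eq_square[of "\<theta>_of c x" for x]
  by (intro trig_poly_continuous[of k] trig_poly.add trig_poly_inner trig_poly.mult
      vec_trig_poly_vel_sum trig_poly_temp_sum)

lemma flux_le: "flux c \<le> (\<Sum>i\<in>I. (c i)\<^sup>2) / 2"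
proof -
  have "flux c \<le> avg k (\<lambda>x. 1 / 2 * ((norm (u_of c x))\<^sup>2 + (\<theta>_of c x)\<^sup>2))"
    unfolding flux_def
  proof (rule avg_mono)
    show "continuous_on UNIV (\<lambda>x. u_of c x $ 3 * \<theta>_of c x)"
      by (intro trig_poly_continuous[of k] trig_poly.mult vec_trig_poly_nth vec_trig_poly_vel_sum trig_poly_temp_sum)
    show "continuous_on UNIV (\<lambda>x. 1 / 2 * ((norm (u_of c x))\<^sup>2 + (\<theta>_of c x)\<^sup>2))"
      by (intro continuous_on_mult continuous_on_const continuous_on_state_norm)
    fix x
    have "(u_of c x $ 3)\<^sup>2 \<le> (norm (u_of c x))\<^sup>2"
      using component_le_norm_cart[of "u_of c x" 3] abs_le_square_iff[of "u_of c x $ 3" "norm (u_of c x)"] by simp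
    moreover have "2 * (u_of c x $ 3 * \<theta>_of c x) \<le> (u_of c x $ 3)\<^sup>2 + (\<theta>_of c x)\<^sup>2"
      using sum_squares_bound[of "u_of c x $ 3" "\<theta>_of c x"] by simp
    ultimately show "u_of c x $ 3 * \<theta>_of c x \<le> 1 / 2 * ((norm (u_of c x))\<^sup>2 + (\<theta>_of c x)\<^sup>2)" by simp
  qed
  then show ?thesis unfolding avg_cmult avg_state_of_squared by simp
qed

text \<open>Young's inequality bounds \<open>flux\<close> by half the squared norm, and the two
  dissipative sums have the favourable sign; this explains the rate.\<close>

sublocale poly_ode I F "(P * R + 1) / 2"
proof
  show "(\<Sum>i\<in>I. c i * F c i) \<le> (P * R + 1) / 2 * (\<Sum>i\<in>I. (c i)\<^sup>2)" for c
  proof -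
    have "0 \<le> P * (\<Sum>n\<in>Nu. wave2 k n * (c (Inl n))\<^sup>2)" "0 \<le> (\<Sum>n\<in>Nt. wave2 k n * (c (Inr n))\<^sup>2)"
      using P by (auto intro!: mult_nonneg_nonneg sum_nonneg wave2_nonneg)
    moreover have "(P * R + 1) * flux c \<le> (P * R + 1) * ((\<Sum>i\<in>I. (c i)\<^sup>2) / 2)"
      using P RS by (intro mult_left_mono flux_le) auto
    ultimately show ?thesis unfolding energy_identity by simp
  qed
qed (rule finI polyfun_F; assumption?)+

text \<open>By orthonormality a mode sum determines its coefficients, so the derivatives quantified
  existentially in \<open>solves\<close> can only be the components of \<open>F\<close>.\<close>

lemma solves_iff:
  "solves R S P k Nu Nt T X \<longleftrightarrow>
     (\<forall>t\<in>time_interval T. X t \<in> phase_space k Nu Nt) \<and> is_sol (time_interval T) (\<lambda>t. coords (X t))"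
    (is "?L \<longleftrightarrow> ?R")
proof
  assume L: ?L
  then obtain a b where M: "\<And>t. t \<in> time_interval T \<Longrightarrow> X t \<in> phase_space k Nu Nt"
    and ab: "\<And>t n. t \<in> time_interval T \<Longrightarrow> n \<in> Nu \<Longrightarrow>
        ((\<lambda>s. vel_coeff k (fst (X s)) n) has_real_derivative a t n) (at t within time_interval T)"
      "\<And>t n. t \<in> time_interval T \<Longrightarrow> n \<in> Nt \<Longrightarrow>
        ((\<lambda>s. temp_coeff k (snd (X s)) n) has_real_derivative b t n) (at t within time_interval T)"
      "\<And>t. t \<in> time_interval T \<Longrightarrow> vel_sum k Nu (a t) = rhs_u R S P k Nu (X t)"
      "\<And>t. t \<in> time_interval T \<Longrightarrow> temp_sum k Nt (b t) = rhs_t k Nt (X t)"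
    unfolding solves_def by blast
  have a_eq: "a t n = F (coords (X t)) (Inl n)" if "t \<in> time_interval T" "n \<in> Nu" for t n
  proof -
    have "vel_sum k Nu (a t) = vel_sum k Nu (\<lambda>n. F (coords (X t)) (Inl n))"
      using ab(3)[OF that(1)] rhs_u_state_of[of "coords (X t)"] state_of_coords[OF M[OF that(1)]] by simp
    then show ?thesis using vel_coeff_vel_sum[OF that(2)] by metis
  qed
  have b_eq: "b t n = F (coords (X t)) (Inr n)" if "t \<in> time_interval T" "n \<in> Nt" for t n
  proof -
    have "temp_sum k Nt (b t) = temp_sum k Nt (\<lambda>n. F (coords (X t)) (Inr n))"
      using ab(4)[OF that(1)] rhs_t_state_of[of "coords (X t)"] state_of_coords[OF M[OF that(1)]] by simp
    then show ?thesis using temp_coeff_temp_sum[OF that(2)] by metis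
  qed
  have "((\<lambda>s. coords (X s) i) has_real_derivative F (coords (X t)) i) (at t within time_interval T)"
    if t: "t \<in> time_interval T" and i: "i \<in> I" for t i
  proof (cases i)
    case (Inl n)
    then have n: "n \<in> Nu" using i by (auto simp: I_def)
    show ?thesis using ab(1)[OF t n] unfolding a_eq[OF t n] Inl coords_def[of "X s" for s] by simp
  next
    case (Inr n)
    then have n: "n \<in> Nt" using i by (auto simp: I_def)
    show ?thesis using ab(2)[OF t n] unfolding b_eq[OF t n] Inr coords_def[of "X s" for s] by simp
  qed
  then show ?R using M by (simp add: is_sol_def)
next
  assume R: ?R
  then have M: "\<And>t. t \<in> time_interval T \<Longrightarrow> X t \<in> phase_space k Nu Nt" by blast
  show ?L
    unfolding solves_def
  proof (rule conjI[OF ballI[OF M]], assumption, rule exI[of _ "\<lambda>t n. F (coords (X t)) (Inl n)"],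
      rule exI[of _ "\<lambda>t n. F (coords (X t)) (Inr n)"], intro ballI conjI)
    fix t assume t: "t \<in> time_interval T"
    show "vel_sum k Nu (\<lambda>n. F (coords (X t)) (Inl n)) = rhs_u R S P k Nu (X t)"
      using rhs_u_state_of[of "coords (X t)"] state_of_coords[OF M[OF t]] by simp
    show "temp_sum k Nt (\<lambda>n. F (coords (X t)) (Inr n)) = rhs_t k Nt (X t)"
      using rhs_t_state_of[of "coords (X t)"] state_of_coords[OF M[OF t]] by simp
    have d: "((\<lambda>s. coords (X s) i) has_real_derivative F (coords (X t)) i) (at t within time_interval T)"
      if "i \<in> I" for i
      using R t that by (simp add: is_sol_def)
    show "((\<lambda>s. vel_coeff k (fst (X s)) n) has_real_derivative F (coords (X t)) (Inl n)) (at t within time_interval T)"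
      if "n \<in> Nu" for n
      using d[of "Inl n"] that by (auto simp: I_def coords_def)
    show "((\<lambda>s. temp_coeff k (snd (X s)) n) has_real_derivative F (coords (X t)) (Inr n)) (at t within time_interval T)"
      if "n \<in> Nt" for n
      using d[of "Inr n"] that by (auto simp: I_def coords_def)
  qed
qed

end

section \<open>Potential energy balance\<close>

lemma time_interval_infinity: "time_interval \<infinity> = {0..}"
  by (auto simp: time_interval_def)

lemma time_interval_closed: "t \<in> time_interval T \<Longrightarrow> {0..t} \<subseteq> time_interval T"
  by (auto simp: time_interval_def) (metis ereal_less_eq(3) order.strict_trans1)

text \<open>This function is continuous but no trigonometric polynomial, hence outside the
  temperature space; the model sees it only through its coefficients.\<close>

definition weight :: sfield where
  "weight x = 1 - snd x / pi"

lemma continuous_on_weight: "continuous_on S weight"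
  unfolding weight_def by (intro continuous_intros) auto

text \<open>Length of the period times the amplitude of the modes independent of \<open>x1\<close>;
  dividing by j gives the coefficient of the weight on (0, j, 1, 1).\<close>

definition weight_scale :: "real \<Rightarrow> real" where
  "weight_scale k = 2 * pi / k * (1 / sqrt 2 / Vol k)"

lemma temp_coeff_weight:
  assumes "k > 0" "(a, j, p, c) \<in> temp_indices"
  shows "temp_coeff k weight (a, j, p, c) = (if a = 0 then weight_scale k / real j else 0)"
proof -
  have j: "j > 0" using assms(2) by (auto simp: temp_indices_def)
  have V: "Vol k \<noteq> 0" using Vol_pos[OF assms(1)] by simp
  have "temp_coeff k weight (a, j, p, c) = avg k (\<lambda>x. ((if p = 1 then - 1 else 1) * (eta2 a j / Vol k) *
      phase_U p (k * real a * fst x)) * ((1 - snd x / pi) * sin (real j * snd x)))"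
    unfolding temp_coeff_def temp_mode_phase weight_def by (simp add: mult_ac)
  also have "\<dots> = integral {0..2 * pi / k} (\<lambda>s. (if p = 1 then - 1 else 1) * (eta2 a j / Vol k) * phase_U p (k * real a * s)) *
      (1 / real j)"
    by (subst avg_product) (auto intro!: continuous_intros simp: V integral_unique[OF has_integral_linear_times_sin[OF j]])
  also have "\<dots> = (if p = 1 then - 1 else 1) * (eta2 a j / Vol k) *
      integral {0..2 * pi / k} (\<lambda>s. phase_U p (k * real a * s)) * (1 / real j)"
    by simp
  also have "integral {0..2 * pi / k} (\<lambda>s. phase_U p (k * real a * s)) =
      (if a = 0 then - 2 * pi / k else 0)"
  proof (cases "p = 1")
    case True
    show ?thesis
      using integral_unique[OF has_integral_cos_period[OF assms(1), of "int a"]] by (simp add: True phase_U_def)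
  next
    case False
    then have "a \<noteq> 0" using assms(2) by (auto simp: temp_indices_def split: if_splits)
    then show ?thesis
      using integral_unique[OF has_integral_sin_period[OF assms(1), of "int a"]] False by (simp add: phase_U_def)
  qed
  finally show ?thesis
    using assms(2) j Vol_pos[OF assms(1)] by (auto simp: weight_scale_def temp_indices_def eta2_def eta_def)
qed

lemma d3_d3_temp_sum:
  "d3 (d3 (temp_sum k N b)) = temp_sum k N (\<lambda>n. - (real (fst (snd n)))\<^sup>2 * b n)"
proof
  fix x
  have m: "d3 (d3 (temp_mode k n)) x = - (real (fst (snd n)))\<^sup>2 * temp_mode k n x" for n
    using d3_d3_temp_mode by (cases n) simp
  show "d3 (d3 (temp_sum k N b)) x = temp_sum k N (\<lambda>n. - (real (fst (snd n)))\<^sup>2 * b n) x"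
    by (simp add: temp_sum_def d3_linear_sum[OF trig_poly_temp_mode]
        d3_linear_sum[OF trig_poly_d3[OF trig_poly_temp_mode]] m mult_ac)
qed

context truncated_model
begin

lemma is_sol_cong:
  assumes "is_sol J x" "\<And>t i. t \<in> J \<Longrightarrow> i \<in> I \<Longrightarrow> x t i = y t i"
  shows "is_sol J y"
  unfolding is_sol_def
proof (intro ballI)
  fix t i assume t: "t \<in> J" and i: "i \<in> I"
  have "((\<lambda>s. x s i) has_real_derivative F (x t) i) (at t within J)"
    using assms(1) t i by (simp add: is_sol_def)
  moreover have "F (x t) i = F (y t) i" by (rule F_cong[OF i]) (use assms(2) t in auto)
  ultimately have "((\<lambda>s. x s i) has_real_derivative F (y t) i) (at t within J)" by simp
  then show "((\<lambda>s. y s i) has_real_derivative F (y t) i) (at t within J)"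
    by (rule has_field_derivative_transform_within[of _ _ _ _ 1]) (use t i assms(2) in auto)
qed

lemma solution_exists:
  assumes "X0 \<in> phase_space k Nu Nt"
  obtains X where "solves R S P k Nu Nt \<infinity> X" "smooth_curve k Nu Nt \<infinity> X" "X 0 = X0"
proof -
  obtain x where x: "\<And>i. i \<in> I \<Longrightarrow> x 0 i = coords X0 i" "is_sol {0..} x"
    by (rule exists_global[of "coords X0"]) blast
  define X where "X t = state_of (x t)" for t
  have sol: "is_sol {0..} (\<lambda>t. coords (X t))"
    by (rule is_sol_cong[OF x(2)]) (simp add: X_def coords_state_of)
  have "solves R S P k Nu Nt \<infinity> X"
    unfolding solves_iff time_interval_infinity using sol by (simp add: X_def state_of_in)
  moreover have "smooth_curve k Nu Nt \<infinity> X"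
    unfolding smooth_curve_def time_interval_infinity
    using sol_smooth[OF sol, of "Inl _"] sol_smooth[OF sol, of "Inr _"] by (simp add: coords_def)
  moreover have "X 0 = X0"
    unfolding X_def using state_of_cong[of "x 0" "coords X0"] x(1) state_of_coords[OF assms] by simp
  ultimately show ?thesis by (rule that)
qed

lemma solution_unique:
  assumes "solves R S P k Nu Nt T X" "solves R S P k Nu Nt T' Y" "X 0 = Y 0"
    "t \<in> time_interval T" "t \<in> time_interval T'"
  shows "X t = Y t"
proof -
  have "is_sol {0..t} (\<lambda>t. coords (X t))" "is_sol {0..t} (\<lambda>t. coords (Y t))"
    using assms time_interval_closed unfolding solves_iff by (blast intro: is_sol_subset)+
  then have "coords (X t) i = coords (Y t) i" if "i \<in> I" for i
    by (rule sol_unique[of t]) (use assms that in \<open>auto simp: time_interval_def\<close>)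
  then have "state_of (coords (X t)) = state_of (coords (Y t))" by (rule state_of_cong)
  moreover have "X t \<in> phase_space k Nu Nt" "Y t \<in> phase_space k Nu Nt"
    using assms unfolding solves_iff by blast+
  ultimately show ?thesis by (simp add: state_of_coords)
qed

abbreviation phi :: "idx \<Rightarrow> real" where "phi \<equiv> temp_coeff k weight"

lemma phi: "(a, j, p, c) \<in> Nt \<Longrightarrow> phi (a, j, p, c) = (if a = 0 then weight_scale k / real j else 0)"
  using temp_coeff_weight[OF k] Nt by blast

definition balance_modes :: "nat set" where
  "balance_modes = {j. (0, j, 1, 1) \<in> Nt}"

lemma finite_balance_modes: "finite balance_modes"
proof -
  have "(\<lambda>j. (0 :: nat, j, 1 :: nat, 1 :: nat)) ` balance_modes \<subseteq> Nt" by (auto simp: balance_modes_def)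
  then have "finite ((\<lambda>j. (0 :: nat, j, 1 :: nat, 1 :: nat)) ` balance_modes)"
    using finNt finite_subset by blast
  then show ?thesis by (rule finite_imageD) (auto simp: inj_on_def)
qed

lemma balance_modes_pos: "j \<in> balance_modes \<Longrightarrow> j > 0"
  using subsetD[OF Nt, of "(0, j, 1, 1)"] by (auto simp: balance_modes_def temp_indices_def)

text \<open>Only the modes independent of \<open>x1\<close> are seen by the weight.\<close>

lemma sum_phi:
  "(\<Sum>n\<in>Nt. phi n * g n) = (\<Sum>j\<in>balance_modes. weight_scale k / real j * g (0, j, 1, 1))"
proof -
  have "(\<Sum>n\<in>Nt. phi n * g n) = (\<Sum>n\<in>(\<lambda>j. (0, j, 1, 1)) ` balance_modes. phi n * g n)"
  proof (rule sum.mono_neutral_right[OF finNt])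
    show "(\<lambda>j. (0, j, 1, 1)) ` balance_modes \<subseteq> Nt" by (auto simp: balance_modes_def)
    show "\<forall>n\<in>Nt - (\<lambda>j. (0, j, 1, 1)) ` balance_modes. phi n * g n = 0"
    proof
      fix n assume n: "n \<in> Nt - (\<lambda>j. (0, j, 1, 1)) ` balance_modes"
      obtain a j p c where nn: "n = (a, j, p, c)" by (metis prod_cases4)
      have "a \<noteq> 0"
      proof
        assume "a = 0"
        then have "p = 1" "c = 1" using n subsetD[OF Nt, of n] by (auto simp: nn temp_indices_def)
        then show False using n \<open>a = 0\<close> by (auto simp: nn balance_modes_def)
      qed
      then show "phi n * g n = 0" using n phi by (simp add: nn)
    qed
  qed
  also have "\<dots> = (\<Sum>j\<in>balance_modes. phi (0, j, 1, 1) * g (0, j, 1, 1))"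
    by (rule sum.reindex_cong[of "\<lambda>j. (0, j, 1, 1)"]) (auto simp: inj_on_def)
  also have "\<dots> = (\<Sum>j\<in>balance_modes. weight_scale k / real j * g (0, j, 1, 1))"
    by (rule sum.cong) (auto simp: balance_modes_def phi)
  finally show ?thesis .
qed

text \<open>A Dirichlet kernel with gaps. Summed over all positive wave numbers it would formally be
  a Dirac comb, supported in the cell at \<open>x3 = 0\<close>, where u3 vanishes. This is why the
  untruncated equations satisfy the balance and why a truncation may violate it.\<close>

definition balance_fun :: "real \<Rightarrow> real" where
  "balance_fun s = 1 + 2 * (\<Sum>j\<in>balance_modes. cos (real j * s))"

definition defect :: "(idx + idx \<Rightarrow> real) \<Rightarrow> real" where
  "defect c = avg k (\<lambda>x. u_of c x $ 3 * \<theta>_of c x * balance_fun (snd x))"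

text \<open>A mode has vertical velocity only if it depends on \<open>x1\<close>, and then its mean
  over \<open>x1\<close> is zero.\<close>

lemma temp_coeff_u3: "temp_coeff k (\<lambda>y. u_of c y $ 3) (0, j, 1, 1) = 0"
proof -
  have "temp_coeff k (\<lambda>y. vel_mode k m y $ 3) (0, j, 1, 1) = 0" for m
  proof -
    obtain b l q e where m: "m = (b, l, q, e)" by (metis prod_cases4)
    show ?thesis
      unfolding temp_coeff_def m vel_mode_nth temp_mode_phase avg_phase_U_sin[OF k] by simp
  qed
  then show ?thesis
    unfolding vel_sum_nth by (simp add: temp_coeff_linear_sum[OF finNu trig_poly_vel_mode_nth])
qed

text \<open>Integration by parts moves the derivative to the temperature mode and produces a factor
  j. It cancels the 1/j in the coefficient of the weight, so all wave numbers enter with the same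
  constant.\<close>

lemma temp_coeff_advect:
  "weight_scale k / real j * temp_coeff k (advect (u_of c) (\<theta>_of c)) (0, j, 1, 1) =
     - 2 / pi * avg k (\<lambda>x. u_of c x $ 3 * \<theta>_of c x * cos (real j * snd x))" if "j > 0"
proof -
  define A where "A = 1 / sqrt 2 / Vol k"
  have f: "temp_mode k (0, j, 1, 1) = (\<lambda>x. - A * phase_U 1 (k * real 0 * fst x) * sin (real j * snd x))"
    using that by (simp add: temp_mode_phase A_def eta2_def eta_def fun_eq_iff)
  have "d1 (temp_mode k (0, j, 1, 1)) x = 0" for x
    unfolding f d_phase_U_sin by simp
  moreover have "d3 (temp_mode k (0, j, 1, 1)) x = A * real j * cos (real j * snd x)" for x
    unfolding f d_phase_U_sin by (simp add: phase_U_def)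
  ultimately have adv: "advect (u_of c) (temp_mode k (0, j, 1, 1)) x = u_of c x $ 3 * (A * real j * cos (real j * snd x))" for x
    by (simp add: advect_def)
  have "temp_coeff k (advect (u_of c) (\<theta>_of c)) (0, j, 1, 1) =
      - avg k (\<lambda>x. \<theta>_of c x * (u_of c x $ 3 * (A * real j * cos (real j * snd x))))"
    unfolding temp_coeff_def adv[symmetric]
    by (rule avg_advect_by_parts[OF incompressible_vel_sum trig_poly_temp_sum trig_poly_temp_mode k])
  also have "\<dots> = - (A * real j * avg k (\<lambda>x. u_of c x $ 3 * \<theta>_of c x * cos (real j * snd x)))"
    unfolding avg_cmult[symmetric] by (simp add: mult_ac)
  finally have "weight_scale k / real j * temp_coeff k (advect (u_of c) (\<theta>_of c)) (0, j, 1, 1) =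
      - (weight_scale k * A) * avg k (\<lambda>x. u_of c x $ 3 * \<theta>_of c x * cos (real j * snd x))"
    using that by simp
  moreover have "weight_scale k * A = 2 / pi"
  proof -
    have "weight_scale k * A = 2 * pi / k * A\<^sup>2"
      by (simp add: weight_scale_def A_def power2_eq_square)
    also have "A\<^sup>2 = 1 / 2 / (Vol k)\<^sup>2" by (simp add: A_def power_divide power_mult_distrib)
    also have "2 * pi / k * (1 / 2 / (Vol k)\<^sup>2) = 2 / pi"
      unfolding Vol_squared[OF k] using k by (simp add: power2_eq_square)
    finally show ?thesis .
  qed
  ultimately show ?thesis by simp
qed

lemma defect_expand:
  "defect c = flux c + 2 * (\<Sum>j\<in>balance_modes. avg k (\<lambda>x. u_of c x $ 3 * \<theta>_of c x * cos (real j * snd x)))"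
proof -
  have tp: "trig_poly k (\<lambda>x. u_of c x $ 3 * \<theta>_of c x)"
    by (intro trig_poly.mult vec_trig_poly_nth vec_trig_poly_vel_sum trig_poly_temp_sum)
  have "defect c = avg k (\<lambda>x. u_of c x $ 3 * \<theta>_of c x +
      (\<Sum>j\<in>balance_modes. 2 * (u_of c x $ 3 * \<theta>_of c x * cos (real j * snd x))))"
    unfolding defect_def balance_fun_def by (simp add: distrib_left sum_distrib_left mult_ac)
  also have "\<dots> = flux c + avg k (\<lambda>x. \<Sum>j\<in>balance_modes. 2 * (u_of c x $ 3 * \<theta>_of c x * cos (real j * snd x)))"
    unfolding flux_def
    by (intro avg_add trig_poly_continuous[of k] trig_poly_sum trig_poly.mult tp trig_poly.cos3 trig_poly.const)
  also have "avg k (\<lambda>x. \<Sum>j\<in>balance_modes. 2 * (u_of c x $ 3 * \<theta>_of c x * cos (real j * snd x))) =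
      (\<Sum>j\<in>balance_modes. 2 * avg k (\<lambda>x. u_of c x $ 3 * \<theta>_of c x * cos (real j * snd x)))"
    by (intro avg_linear_sum finite_balance_modes trig_poly_continuous[of k] trig_poly.mult tp trig_poly.cos3)
  finally show ?thesis by (simp add: sum_distrib_left)
qed

text \<open>The cosines summed over \<open>balance_modes\<close> equal half of
  \<open>balance_fun\<close> minus 1. The constant splits off exactly the flux term of the potential
  energy equation, and what remains is the defect.\<close>

lemma potential_energy_rate:
  "(\<Sum>n\<in>Nt. phi n * F c (Inr n)) =
     - (\<Sum>n\<in>Nt. phi n * (wave2 k n * c (Inr n))) - flux c / pi + defect c / pi"
proof -
  have "(\<Sum>n\<in>Nt. phi n * F c (Inr n)) = - (\<Sum>n\<in>Nt. phi n * (wave2 k n * c (Inr n)))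
      + (\<Sum>n\<in>Nt. phi n * temp_coeff k (\<lambda>y. u_of c y $ 3) n)
      - (\<Sum>n\<in>Nt. phi n * temp_coeff k (advect (u_of c) (\<theta>_of c)) n)"
    unfolding sum_negf[symmetric] sum.distrib[symmetric] sum_subtractf[symmetric]
    by (intro sum.cong) (auto simp: F_def algebra_simps)
  also have "(\<Sum>n\<in>Nt. phi n * temp_coeff k (\<lambda>y. u_of c y $ 3) n) = 0"
    unfolding sum_phi temp_coeff_u3 by simp
  also have "(\<Sum>n\<in>Nt. phi n * temp_coeff k (advect (u_of c) (\<theta>_of c)) n) =
      (\<Sum>j\<in>balance_modes. - 2 / pi * avg k (\<lambda>x. u_of c x $ 3 * \<theta>_of c x * cos (real j * snd x)))"
    unfolding sum_phi by (intro sum.cong refl temp_coeff_advect balance_modes_pos)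
  also have "\<dots> = (flux c - defect c) / pi"
    unfolding sum_distrib_left[symmetric] defect_expand by simp
  finally show ?thesis by (simp add: diff_divide_distrib)
qed

lemma avg_weight_temp_sum: "avg k (\<lambda>x. weight x * temp_sum k Nt b x) = (\<Sum>n\<in>Nt. b n * phi n)"
  by (rule avg_mult_temp_sum[OF finNt continuous_on_weight])

text \<open>The full Laplacian may replace the second derivative in \<open>x3\<close>, because
  \<open>phi\<close> vanishes on all modes that depend on \<open>x1\<close>.\<close>

lemma avg_weight_d3_d3: "avg k (\<lambda>x. weight x * d3 (d3 (\<theta>_of c)) x) = - (\<Sum>n\<in>Nt. phi n * (wave2 k n * c (Inr n)))"
proof -
  have "avg k (\<lambda>x. weight x * d3 (d3 (\<theta>_of c)) x) = (\<Sum>n\<in>Nt. - (real (fst (snd n)))\<^sup>2 * c (Inr n) * phi n)"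
    unfolding d3_d3_temp_sum by (rule avg_weight_temp_sum)
  also have "\<dots> = (\<Sum>n\<in>Nt. - (phi n * (wave2 k n * c (Inr n))))"
  proof (intro sum.cong refl)
    fix n assume n: "n \<in> Nt"
    obtain a j p e where nn: "n = (a, j, p, e)" by (metis prod_cases4)
    show "- (real (fst (snd n)))\<^sup>2 * c (Inr n) * phi n = - (phi n * (wave2 k n * c (Inr n)))"
      using phi[of a j p e] n by (simp add: nn wave2_def)
  qed
  finally show ?thesis by (simp add: sum_negf)
qed

lemma potential_energy_derivative:
  assumes X: "solves R S P k Nu Nt T X" and t: "t \<in> time_interval T"
  shows "((\<lambda>s. avg k (\<lambda>x. (1 - snd x / pi) * snd (X s) x)) has_real_derivative
     (avg k (\<lambda>x. (1 - snd x / pi) * d3 (d3 (snd (X t))) x)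
      - 1 / pi * avg k (\<lambda>x. (fst (X t) x $ 3) * snd (X t) x) + defect (coords (X t)) / pi))
     (at t within time_interval T)"
proof -
  have M: "X s \<in> phase_space k Nu Nt" if "s \<in> time_interval T" for s
    using X that unfolding solves_iff by blast
  have st: "X s = (u_of (coords (X s)), \<theta>_of (coords (X s)))" if "s \<in> time_interval T" for s
    using state_of_coords[OF M[OF that]] by (simp add: state_of_def)
  have "((\<lambda>s. coords (X s) (Inr n)) has_real_derivative F (coords (X t)) (Inr n)) (at t within time_interval T)"
    if "n \<in> Nt" for n
    using X t that unfolding solves_iff is_sol_def by (auto simp: I_def)
  then have "((\<lambda>s. \<Sum>n\<in>Nt. coords (X s) (Inr n) * phi n) has_real_derivative
      (\<Sum>n\<in>Nt. F (coords (X t)) (Inr n) * phi n)) (at t within time_interval T)"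
    by (intro DERIV_sum DERIV_cmult_right) auto
  then have "((\<lambda>s. avg k (\<lambda>x. weight x * snd (X s) x)) has_real_derivative
      (\<Sum>n\<in>Nt. F (coords (X t)) (Inr n) * phi n)) (at t within time_interval T)"
  proof (rule has_field_derivative_transform_within[of _ _ _ _ 1])
    fix s assume "s \<in> time_interval T"
    then have "snd (X s) = \<theta>_of (coords (X s))" using st by (metis snd_conv)
    then show "(\<Sum>n\<in>Nt. coords (X s) (Inr n) * phi n) = avg k (\<lambda>x. weight x * snd (X s) x)"
      by (simp add: avg_weight_temp_sum)
  qed (use t in auto)
  moreover have "(\<Sum>n\<in>Nt. F (coords (X t)) (Inr n) * phi n) =
      avg k (\<lambda>x. weight x * d3 (d3 (snd (X t))) x)
      - 1 / pi * avg k (\<lambda>x. (fst (X t) x $ 3) * snd (X t) x) + defect (coords (X t)) / pi"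
  proof -
    have 1: "snd (X t) = \<theta>_of (coords (X t))" "fst (X t) = u_of (coords (X t))"
      using st[OF t] by (metis snd_conv, metis fst_conv)
    have "(\<Sum>n\<in>Nt. F (coords (X t)) (Inr n) * phi n) = (\<Sum>n\<in>Nt. phi n * F (coords (X t)) (Inr n))"
      by (simp add: mult.commute)
    then show ?thesis
      unfolding 1 avg_weight_d3_d3 flux_def[symmetric] potential_energy_rate by simp
  qed
  ultimately show ?thesis by (simp add: weight_def)
qed

text \<open>Along every solution the derivative misses the required value by
  \<open>defect / pi\<close>. Since each coefficient vector occurs as initial datum and the
  one-sided derivative at time 0 is unique, the equation forces the defect to vanish on all
  vectors.\<close>

lemma potential_energy_equation_iff_defect:
  "potential_energy_equation R S P k Nu Nt \<longleftrightarrow> (\<forall>c. defect c = 0)"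
proof
  assume "\<forall>c. defect c = 0"
  then show "potential_energy_equation R S P k Nu Nt"
    unfolding potential_energy_equation_def using potential_energy_derivative by simp
next
  assume L: "potential_energy_equation R S P k Nu Nt"
  show "\<forall>c. defect c = 0"
  proof
    fix c
    obtain X where X: "solves R S P k Nu Nt \<infinity> X" "X 0 = state_of c"
      using solution_exists[OF state_of_in] by metis
    have 0: "0 \<in> time_interval \<infinity>" by (simp add: time_interval_infinity)
    have nb: "at 0 within time_interval \<infinity> \<noteq> bot"
      unfolding time_interval_infinity by (simp add: at_within_Ici_at_right)
    let ?d = "avg k (\<lambda>x. (1 - snd x / pi) * d3 (d3 (snd (X 0))) x)
      - 1 / pi * avg k (\<lambda>x. (fst (X 0) x $ 3) * snd (X 0) x)"
    have "((\<lambda>s. avg k (\<lambda>x. (1 - snd x / pi) * snd (X s) x)) has_real_derivative ?d) (at 0 within time_interval \<infinity>)"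
      using L X(1) 0 unfolding potential_energy_equation_def by blast
    with potential_energy_derivative[OF X(1) 0]
    have "?d + defect (coords (X 0)) / pi = ?d"
      unfolding has_real_derivative_iff_has_vector_derivative by (rule vector_derivative_unique_within[OF nb])
    then have "defect (coords (state_of c)) = 0" using X(2) by simp
    moreover have "u_of (coords (state_of c)) = u_of c" "\<theta>_of (coords (state_of c)) = \<theta>_of c"
      using state_of_coords[OF state_of_in[of c]] by (simp_all add: state_of_def)
    ultimately show "defect c = 0" by (simp add: defect_def)
  qed
qed

section \<open>From vanishing defect to the Energy Balance Criterion\<close>

definition coupling :: "idx \<Rightarrow> idx \<Rightarrow> real" where
  "coupling n m = avg k (\<lambda>x. vel_mode k n x $ 3 * temp_mode k m x * balance_fun (snd x))"

lemma trig_poly_balance_fun: "trig_poly k (\<lambda>x. balance_fun (snd x))"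
  unfolding balance_fun_def by (intro trig_poly.add trig_poly.mult trig_poly_sum trig_poly.cos3 trig_poly.const)

lemma defect_coupling: "defect c = (\<Sum>n\<in>Nu. c (Inl n) * (\<Sum>m\<in>Nt. c (Inr m) * coupling n m))"
proof -
  have "defect c = avg k (\<lambda>x. \<Sum>n\<in>Nu. c (Inl n) * (\<Sum>m\<in>Nt. c (Inr m) *
      (vel_mode k n x $ 3 * temp_mode k m x * balance_fun (snd x))))"
    unfolding defect_def vel_sum_nth temp_sum_def
    by (simp add: sum_distrib_left sum_distrib_right mult_ac)
  also have "\<dots> = (\<Sum>n\<in>Nu. c (Inl n) * avg k (\<lambda>x. \<Sum>m\<in>Nt. c (Inr m) *
      (vel_mode k n x $ 3 * temp_mode k m x * balance_fun (snd x))))"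
    by (intro avg_linear_sum finNu trig_poly_continuous[of k] trig_poly_sum trig_poly.mult trig_poly.const
        trig_poly_vel_mode_nth trig_poly_temp_mode trig_poly_balance_fun)
  also have "\<dots> = (\<Sum>n\<in>Nu. c (Inl n) * (\<Sum>m\<in>Nt. c (Inr m) * coupling n m))"
    unfolding coupling_def
    by (subst avg_linear_sum) (auto intro!: finNt trig_poly_continuous[of k] trig_poly.mult
        trig_poly_vel_mode_nth trig_poly_temp_mode trig_poly_balance_fun)
  finally show ?thesis .
qed

lemma defect_iff_coupling: "(\<forall>c. defect c = 0) \<longleftrightarrow> (\<forall>n\<in>Nu. \<forall>m\<in>Nt. coupling n m = 0)"
proof (intro iffI ballI allI)
  fix n m assume d: "\<forall>c. defect c = 0" and n: "n \<in> Nu" and m: "m \<in> Nt"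
  let ?c = "\<lambda>i. case i of Inl l \<Rightarrow> (if l = n then 1 else 0) | Inr l \<Rightarrow> (if l = m then 1 else 0 :: real)"
  have "defect ?c = (\<Sum>l\<in>Nu. if l = n then (\<Sum>i\<in>Nt. if i = m then coupling l i else 0) else 0)"
    unfolding defect_coupling by (intro sum.cong) (auto intro!: sum.cong)
  also have "\<dots> = coupling n m" using n m finNu finNt by simp
  finally show "coupling n m = 0" using d by simp
qed (simp add: defect_coupling)

text \<open>The constant part of \<open>balance_fun\<close> contributes the diagonal term, its
  cosines the terms at the difference and at the sum of the wave numbers.\<close>

lemma integral_sin_sin_balance:
  assumes "l > 0"
  shows "integral {0..pi} (\<lambda>s. sin (real j * s) * sin (real l * s) * balance_fun s) =
    pi / 2 * ((if j = l then 1 else 0) + (if nat \<bar>int j - int l\<bar> \<in> balance_modes then 1 else 0)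
      - (if j + l \<in> balance_modes then 1 else 0))"
proof -
  have "continuous_on {0..pi} (\<lambda>s. sin (real j * s) * sin (real l * s))" by (intro continuous_intros)
  from integrable_integral[OF integrable_continuous_interval[OF this]]
  have 1: "((\<lambda>s. sin (real j * s) * sin (real l * s)) has_integral (if j = l then pi / 2 else 0)) {0..pi}"
    by (rule has_integral_eq_rhs) (use assms in \<open>simp add: integral_sin_sin_half_period\<close>)
  have 2: "((\<lambda>s. \<Sum>m\<in>balance_modes. sin (real j * s) * sin (real l * s) * cos (real m * s)) has_integral
      (\<Sum>m\<in>balance_modes. pi / 4 * ((if m = nat \<bar>int j - int l\<bar> then 1 else 0) - (if m = j + l then 1 else 0)))) {0..pi}"
    by (intro has_integral_sum finite_balance_modes integral_sin_sin_cos_half_period balance_modes_pos)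
  have 3: "(\<Sum>m\<in>balance_modes. pi / 4 * ((if m = nat \<bar>int j - int l\<bar> then 1 else 0) - (if m = j + l then 1 else 0))) =
      pi / 4 * ((if nat \<bar>int j - int l\<bar> \<in> balance_modes then 1 else 0) - (if j + l \<in> balance_modes then 1 else 0))"
    unfolding sum_distrib_left[symmetric] sum_subtractf by (simp add: finite_balance_modes)
  have eq: "sin (real j * s) * sin (real l * s) * balance_fun s = sin (real j * s) * sin (real l * s) +
      2 * (\<Sum>m\<in>balance_modes. sin (real j * s) * sin (real l * s) * cos (real m * s))" for s
    by (simp add: balance_fun_def distrib_left sum_distrib_left mult_ac)
  show ?thesis
    unfolding eq
    by (rule integral_unique, rule has_integral_eq_rhs[OF has_integral_add[OF 1 has_integral_mult_right[OF 2[unfolded 3]]]])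
      (auto simp: field_simps)
qed

text \<open>Amplitudes and the integral over \<open>x1\<close> are nonzero exactly for equal
  positive wave numbers in \<open>x1\<close>, equal phases and c = 1. There the vertical integral
  decides: for j = l it is a multiple of 1 minus the indicator of 2j, as 0 is never a balance mode;
  otherwise it compares the indicators of the difference and the sum.\<close>

lemma coupling_eq_0_iff:
  assumes n: "(a, j, p, c) \<in> Nu" and m: "(b, l, q, e) \<in> Nt"
  shows "coupling (a, j, p, c) (b, l, q, e) = 0 \<longleftrightarrow>
    (a = b \<and> b > 0 \<and> p = q \<and> c = 1 \<longrightarrow>
      (j = l \<longrightarrow> 2 * j \<in> balance_modes) \<and>
      (j \<noteq> l \<longrightarrow> (nat \<bar>int j - int l\<bar> \<in> balance_modes \<longleftrightarrow> j + l \<in> balance_modes)))"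
proof -
  define A where "A = (if c = 1 then eta2 a j / (Kabs k a j * Vol k) * (k * real a) else 0)"
  define B where "B = (if q = 1 then - 1 else 1) * (eta2 b l / Vol k)"
  have nI: "(a, j, p, c) \<in> vel_indices" and mI: "(b, l, q, e) \<in> temp_indices" using n m Nu Nt by blast+
  have l: "l > 0" using mI by (auto simp: temp_indices_def)
  have cb: "continuous_on UNIV balance_fun" unfolding balance_fun_def by (intro continuous_intros)
  have "coupling (a, j, p, c) (b, l, q, e) = A * B * avg k (\<lambda>x.
      (phase_U p (k * real a * fst x) * phase_U q (k * real b * fst x)) *
      (sin (real j * snd x) * sin (real l * snd x) * balance_fun (snd x)))"
    unfolding coupling_def vel_mode_nth temp_mode_phase A_def[symmetric] B_def[symmetric] avg_cmult[symmetric]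
    by (simp add: mult_ac)
  also have "\<dots> = A * B * (integral {0..2 * pi / k} (\<lambda>s. phase_U p (k * real a * s) * phase_U q (k * real b * s)) *
      integral {0..pi} (\<lambda>s. sin (real j * s) * sin (real l * s) * balance_fun s))"
    by (subst avg_product) (auto intro!: continuous_intros cb)
  finally have E: "coupling (a, j, p, c) (b, l, q, e) = A * B * (
      (if a = b \<and> (p = 1 \<longleftrightarrow> q = 1) then (if a = 0 then (if p = 1 then 2 * pi / k else 0) else pi / k) else 0) *
      (pi / 2 * ((if j = l then 1 else 0) + (if nat \<bar>int j - int l\<bar> \<in> balance_modes then 1 else 0)
      - (if j + l \<in> balance_modes then 1 else 0))))"
    unfolding integral_phase_U[OF k] integral_sin_sin_balance[OF l] .
  have B: "B \<noteq> 0" using Vol_pos[OF k] by (auto simp: B_def eta2_def eta_def)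
  show ?thesis
  proof (cases "a = b \<and> b > 0 \<and> p = q \<and> c = 1")
    case True
    then have "Kabs k a j > 0" using k by (simp add: Kabs_def add_pos_nonneg)
    then have A: "A \<noteq> 0" using True k Vol_pos[OF k] by (auto simp: A_def eta2_def eta_def)
    have "0 \<notin> balance_modes" using balance_modes_pos by blast
    then show ?thesis using True A B k unfolding E by (auto simp: mult_2)
  next
    case False
    then have "A = 0 \<or> \<not> (a = b \<and> (p = 1 \<longleftrightarrow> q = 1))"
      using nI mI by (auto simp: A_def vel_indices_def temp_indices_def split: if_splits)
    then show ?thesis using False unfolding E by auto
  qed
qed

theorem potential_energy_equation_iff:
  "potential_energy_equation R S P k Nu Nt \<longleftrightarrow> energy_balance_criterion Nu Nt"
proof -
  have c1: "e = 1" if "(b, l, q, e) \<in> Nt" for b l q e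
    using subsetD[OF Nt that] by (simp add: temp_indices_def)
  have "(\<forall>n\<in>Nu. \<forall>m\<in>Nt. coupling n m = 0) \<longleftrightarrow>
    (\<forall>a j p c b l q e. (a, j, p, c) \<in> Nu \<longrightarrow> (b, l, q, e) \<in> Nt \<longrightarrow> coupling (a, j, p, c) (b, l, q, e) = 0)"
    by (auto simp only: split_paired_all Ball_def split_paired_All)
  also have "\<dots> \<longleftrightarrow> energy_balance_criterion Nu Nt"
    unfolding energy_balance_criterion_def
    using c1 by (simp add: coupling_eq_0_iff balance_modes_def cong: imp_cong conj_cong) blast
  finally show ?thesis
    unfolding potential_energy_equation_iff_defect defect_iff_coupling .
qed

end

section \<open>The absorbing ball\<close>

lemma convergent_subsequence_coordinatewise:
  fixes x :: "nat \<Rightarrow> 'i \<Rightarrow> real"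
  assumes "finite I" "\<And>i. i \<in> I \<Longrightarrow> bounded (range (\<lambda>n. x n i))"
  shows "\<exists>l r. strict_mono (r :: nat \<Rightarrow> nat) \<and> (\<forall>i\<in>I. (\<lambda>n. x (r n) i) \<longlonglongrightarrow> l i)"
  using assms
proof (induction I rule: finite_induct)
  case empty
  show ?case by (intro exI[of _ "\<lambda>_. 0"] exI[of _ id]) (auto simp: strict_mono_def)
next
  case (insert j I)
  then obtain l r where lr: "strict_mono (r :: nat \<Rightarrow> nat)" "\<And>i. i \<in> I \<Longrightarrow> (\<lambda>n. x (r n) i) \<longlonglongrightarrow> l i"
    by (metis insertCI)
  have "bounded (range (\<lambda>n. x (r n) j))"
    by (rule bounded_subset[OF insert.prems[of j]]) auto
  then obtain y s where s: "strict_mono (s :: nat \<Rightarrow> nat)" "((\<lambda>n. x (r n) j) \<circ> s) \<longlonglongrightarrow> y"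
    using bounded_imp_convergent_subsequence by blast
  have "(\<lambda>n. x ((r \<circ> s) n) i) \<longlonglongrightarrow> (l(j := y)) i" if "i \<in> insert j I" for i
  proof (cases "i = j")
    case False
    then have "((\<lambda>n. x (r n) i) \<circ> s) \<longlonglongrightarrow> l i"
      using lr(2) that s(1) by (intro LIMSEQ_subseq_LIMSEQ) auto
    then show ?thesis using False by (simp add: o_def)
  qed (use s in \<open>simp add: o_def\<close>)
  then show ?case using strict_mono_o[OF lr(1) s(1)] by (intro exI[of _ "l(j := y)"] exI[of _ "r \<circ> s"]) blast
qed

text \<open>Chosen to cancel the heat flux: the energy identity produces it with factor 1 + P R, the
  potential energy with factor -1/pi.\<close>

definition center_shift :: "real \<Rightarrow> real \<Rightarrow> real" where
  "center_shift P R = pi * (1 + P * R)"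

text \<open>The projection of this profile to the temperature modes would depend on more of the
  index set than its cardinality; the unprojected profile does not.\<close>

definition ball_center :: "real \<Rightarrow> real \<Rightarrow> real \<Rightarrow> nat \<Rightarrow> state" where
  "ball_center P R k N = (\<lambda>_. 0, \<lambda>x. - center_shift P R * weight x)"

definition center_norm2 :: "real \<Rightarrow> real \<Rightarrow> real \<Rightarrow> real" where
  "center_norm2 P R k = (center_shift P R)\<^sup>2 * avg k (\<lambda>x. (weight x)\<^sup>2)"

text \<open>The eigenvalues are at least \<open>min 1 (k\<^sup>2)\<close> on velocity modes and at
  least 1 on temperature modes; of the latter only one half remains after the boundary term has been
  absorbed.\<close>

definition decay_rate :: "real \<Rightarrow> real \<Rightarrow> real" where
  "decay_rate P k = min (P * min 1 (k\<^sup>2)) (1 / 2)"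

text \<open>The first term pays for passing from the size of the state to its distance from the
  center, by (x - y)^2 \<le> 2 x^2 + 2 y^2. The second collects the cost of completing the square,
  charged to every temperature mode so that only their number enters.\<close>

definition decay_level :: "real \<Rightarrow> real \<Rightarrow> real \<Rightarrow> nat \<Rightarrow> real" where
  "decay_level P R k N = 2 * center_norm2 P R k
     + real N * (center_shift P R * weight_scale k)\<^sup>2 / decay_rate P k"

text \<open>The summand \<open>center_norm2\<close> dominates the squared distance of the center
  from the phase space, which the cardinality does not determine. The summand 1 leaves a margin
  above the decay level, so that solutions enter the ball in finite time.\<close>

definition ball_radius :: "real \<Rightarrow> real \<Rightarrow> real \<Rightarrow> nat \<Rightarrow> real" where
  "ball_radius P R k N = sqrt (center_norm2 P R k + decay_level P R k N + 1)"

lemma L2_state_ball_center: "L2_state k (ball_center P R k N)"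
proof -
  have c: "compact (Omega k)" by (simp add: Omega_cbox)
  have s: "set_integrable lborel (Omega k) g" if "continuous_on UNIV g" for g :: sfield
    unfolding set_integrable_def
    by (rule borel_integrable_compact[OF c]) (rule continuous_on_subset[OF that], simp)
  have 1: "continuous_on UNIV (\<lambda>x. - center_shift P R * weight x)"
    by (intro continuous_intros continuous_on_weight)
  have 2: "continuous_on UNIV (\<lambda>x. (- center_shift P R * weight x)\<^sup>2)"
    by (intro continuous_intros continuous_on_weight)
  have 3: "set_borel_measurable lborel (Omega k) (\<lambda>x. - center_shift P R * weight x)"
    using s[OF 1] unfolding set_integrable_def set_borel_measurable_def by (rule borel_measurable_integrable)
  show ?thesis
    unfolding L2_state_def ball_center_def using s[OF 2] 3
    by (simp add: set_borel_measurable_def set_integrable_def)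
qed

lemma L2_dist_nonneg: "L2_dist k X Y \<ge> 0"
proof -
  have "avg k (\<lambda>x. (norm (fst X x - fst Y x))\<^sup>2 + (snd X x - snd Y x)\<^sup>2) \<ge> 0"
    unfolding avg_def
    by (cases "(\<lambda>x. (norm (fst X x - fst Y x))\<^sup>2 + (snd X x - snd Y x)\<^sup>2) integrable_on Omega k")
      (auto intro: integral_nonneg simp: not_integrable_integral)
  then show ?thesis by (simp add: L2_dist_def)
qed

lemma L2_dist_commute: "L2_dist k X Y = L2_dist k Y X"
  by (simp add: L2_dist_def norm_minus_commute power2_commute)

context truncated_model
begin

text \<open>Coordinates of the orthogonal projection of the center to the phase space.\<close>

definition center_coord :: "idx + idx \<Rightarrow> real" where
  "center_coord = (\<lambda>i. case i of Inl n \<Rightarrow> 0 | Inr n \<Rightarrow> - center_shift P R * phi n)"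

definition dev :: "(idx + idx \<Rightarrow> real) \<Rightarrow> real" where
  "dev c = (\<Sum>i\<in>I. (c i - center_coord i)\<^sup>2)"

text \<open>Squared distance between the center and its projection, in Pythagorean form.\<close>

definition center_excess :: real where
  "center_excess = center_norm2 P R k - (\<Sum>i\<in>I. (center_coord i)\<^sup>2)"

abbreviation "M \<equiv> phase_space k Nu Nt"
abbreviation "\<gamma> \<equiv> center_shift P R"
abbreviation "level \<equiv> decay_level P R k (card Nt)"
abbreviation "rate \<equiv> decay_rate P k"
abbreviation "B \<equiv> phase_ball k Nu Nt (ball_center P R k (card Nt)) (ball_radius P R k (card Nt))"

lemma L2_dist_state_of: "L2_dist k (state_of c) (state_of d) = L2_set (\<lambda>i. c i - d i) I"
proof -
  have "u_of c x - u_of d x = u_of (\<lambda>i. c i - d i) x" "\<theta>_of c x - \<theta>_of d x = \<theta>_of (\<lambda>i. c i - d i) x" for x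
    by (simp_all add: vel_sum_combine temp_sum_combine)
  then show ?thesis
    using avg_state_of_squared[of "\<lambda>i. c i - d i"] by (simp add: L2_dist_def state_of_def L2_set_def)
qed

lemma dev_L2_set: "dev c = (L2_set (\<lambda>i. c i - center_coord i) I)\<^sup>2"
  by (simp add: dev_def L2_set_def sum_nonneg)

lemma dev_nonneg: "dev c \<ge> 0"
  by (simp add: dev_def sum_nonneg)

text \<open>Pythagoras for a center outside the phase space: up to a constant, distances to the
  center are distances to its projection, so the intersected ball is a Euclidean ball in
  coordinates.\<close>

lemma avg_dist_center:
  "avg k (\<lambda>x. (norm (u_of c x - 0))\<^sup>2 + (\<theta>_of c x - (- \<gamma> * weight x))\<^sup>2) = dev c + center_excess"
proof -
  have ct: "continuous_on UNIV (\<lambda>x. weight x * \<theta>_of c x)"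
    by (intro continuous_on_mult continuous_on_weight trig_poly_continuous[OF trig_poly_temp_sum])
  have cw: "continuous_on UNIV (\<lambda>x. (weight x)\<^sup>2)" by (intro continuous_intros continuous_on_weight)
  have "avg k (\<lambda>x. (norm (u_of c x - 0))\<^sup>2 + (\<theta>_of c x - (- \<gamma> * weight x))\<^sup>2) =
     avg k (\<lambda>x. ((norm (u_of c x))\<^sup>2 + (\<theta>_of c x)\<^sup>2) + (2 * \<gamma> * (weight x * \<theta>_of c x) + \<gamma>\<^sup>2 * (weight x)\<^sup>2))"
    by (simp add: power2_sum power_mult_distrib algebra_simps)
  also have "\<dots> = avg k (\<lambda>x. (norm (u_of c x))\<^sup>2 + (\<theta>_of c x)\<^sup>2)
      + (avg k (\<lambda>x. 2 * \<gamma> * (weight x * \<theta>_of c x)) + avg k (\<lambda>x. \<gamma>\<^sup>2 * (weight x)\<^sup>2))"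
    by (subst avg_add[OF continuous_on_state_norm], intro continuous_on_add continuous_on_mult[OF continuous_on_const] ct cw)
      (subst avg_add; intro refl continuous_on_mult[OF continuous_on_const] ct cw)
  also have "\<dots> = (\<Sum>i\<in>I. (c i)\<^sup>2) + 2 * \<gamma> * (\<Sum>n\<in>Nt. c (Inr n) * phi n) + center_norm2 P R k"
    unfolding avg_state_of_squared avg_cmult avg_weight_temp_sum center_norm2_def by simp
  also have "\<dots> = dev c + center_excess"
  proof -
    have "dev c = (\<Sum>i\<in>I. (c i)\<^sup>2) - 2 * (\<Sum>i\<in>I. c i * center_coord i) + (\<Sum>i\<in>I. (center_coord i)\<^sup>2)"
      unfolding dev_def by (simp add: power2_diff sum.distrib sum_subtractf sum_distrib_left mult.assoc)
    moreover have "(\<Sum>i\<in>I. c i * center_coord i) = - \<gamma> * (\<Sum>n\<in>Nt. c (Inr n) * phi n)"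
      unfolding sum_I by (simp add: center_coord_def sum_distrib_left mult_ac sum_negf)
    ultimately show ?thesis by (simp add: center_excess_def)
  qed
  finally show ?thesis .
qed

lemma L2_dist_center: "L2_dist k (state_of c) (ball_center P R k N) = sqrt (dev c + center_excess)"
  unfolding L2_dist_def state_of_def ball_center_def fst_conv snd_conv avg_dist_center ..

text \<open>Bessel's inequality, read off from the distance between the center and its projection.
  As \<open>sqrt\<close> is negative on negative reals, \<open>0 \<le> sqrt s\<close> does imply
  \<open>0 \<le> s\<close>.\<close>

lemma center_excess_nonneg: "center_excess \<ge> 0"
proof -
  have "dev center_coord = 0" by (simp add: dev_def)
  moreover have "0 \<le> L2_dist k (state_of center_coord) (ball_center P R k 0)" by (rule L2_dist_nonneg)
  ultimately show ?thesis unfolding L2_dist_center by simp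
qed

lemma rate_pos: "rate > 0"
  using P k by (simp add: decay_rate_def)

lemma center_norm2_bound: "(\<Sum>i\<in>I. (center_coord i)\<^sup>2) \<le> center_norm2 P R k"
  using center_excess_nonneg by (simp add: center_excess_def)

lemma center_norm2_nonneg: "0 \<le> center_norm2 P R k"
  using center_norm2_bound by (meson order_trans sum_nonneg zero_le_power2)

lemma level_nonneg: "0 \<le> level"
  unfolding decay_level_def using center_norm2_nonneg rate_pos by simp

lemma vel_dissipation:
  assumes "n \<in> Nu" shows "rate * s\<^sup>2 \<le> P * (wave2 k n * s\<^sup>2)"
proof -
  obtain a j p c where n: "n = (a, j, p, c)" by (metis prod_cases4)
  have "a \<ge> 1 \<or> j \<ge> 1" using subsetD[OF Nu assms] by (auto simp: n vel_indices_def)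
  then have "min 1 (k\<^sup>2) \<le> wave2 k n"
  proof
    assume "a \<ge> 1"
    then have "k\<^sup>2 * 1 \<le> k\<^sup>2 * (real a)\<^sup>2" by (intro mult_left_mono) auto
    then show ?thesis by (simp add: n wave2_def min_le_iff_disj add_increasing2)
  next
    assume "j \<ge> 1"
    then have "1 \<le> (real j)\<^sup>2" by simp
    then show ?thesis by (simp add: n wave2_def min_le_iff_disj add_increasing)
  qed
  then have "P * min 1 (k\<^sup>2) \<le> P * wave2 k n" using P by simp
  then have "rate \<le> P * wave2 k n" unfolding decay_rate_def by linarith
  then have "rate * s\<^sup>2 \<le> P * wave2 k n * s\<^sup>2" by (rule mult_right_mono) simp
  then show ?thesis by (simp add: mult.assoc)
qed

text \<open>Completing the square pays for the linear boundary term with half of the dissipation.\<close>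

lemma temp_dissipation:
  assumes "n \<in> Nt"
  shows "rate * s\<^sup>2 \<le> wave2 k n * s\<^sup>2 + \<gamma> * (phi n * (wave2 k n * s)) + (\<gamma> * weight_scale k)\<^sup>2 / 2"
proof -
  obtain a j p c where n: "n = (a, j, p, c)" by (metis prod_cases4)
  have j: "j \<ge> 1" using subsetD[OF Nt assms] by (auto simp: n temp_indices_def)
  then have "1 \<le> (real j)\<^sup>2" by simp
  then have w: "1 \<le> wave2 k n" by (simp add: n wave2_def add_increasing)
  have "rate * s\<^sup>2 \<le> 1 / 2 * s\<^sup>2" unfolding decay_rate_def by (intro mult_right_mono) auto
  also have "\<dots> \<le> 1 / 2 * (wave2 k n * s\<^sup>2)" using mult_right_mono[OF w, of "s\<^sup>2"] by simp
  also have "\<dots> \<le> wave2 k n * s\<^sup>2 + \<gamma> * (phi n * (wave2 k n * s)) + (\<gamma> * weight_scale k)\<^sup>2 / 2"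
  proof (cases "a = 0")
    case True
    define u w where "u = real j * s" and "w = \<gamma> * weight_scale k"
    have "\<gamma> * (phi n * (wave2 k n * s)) = u * w"
      using phi[of a j p c] assms True j by (simp add: n wave2_def power2_eq_square u_def w_def)
    moreover have "wave2 k n * s\<^sup>2 = u\<^sup>2" by (simp add: n wave2_def True power_mult_distrib u_def)
    moreover have "0 \<le> u\<^sup>2 + w\<^sup>2 + 2 * u * w" unfolding power2_sum[symmetric] by simp
    ultimately show ?thesis unfolding w_def[symmetric] by simp
  next
    case False
    then have "phi n = 0" using phi[of a j p c] assms by (simp add: n)
    moreover have "0 \<le> wave2 k n * s\<^sup>2" using w by simp
    ultimately show ?thesis by simp
  qed
  finally show ?thesis .
qed

text \<open>The left-hand side is the derivative of \<open>dev\<close> along a solution. By the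
  choice of \<open>center_shift\<close> the flux disappears, leaving the dissipation and the linear
  boundary term.\<close>

lemma dissipation:
  assumes "defect c = 0"
  shows "(\<Sum>i\<in>I. 2 * (c i - center_coord i) * F c i) \<le> - rate * (dev c - level)"
proof -
  have "(\<Sum>i\<in>I. (c i - center_coord i) * F c i) = (\<Sum>i\<in>I. c i * F c i) - (\<Sum>i\<in>I. center_coord i * F c i)"
    by (simp add: left_diff_distrib sum_subtractf)
  also have "(\<Sum>i\<in>I. center_coord i * F c i) = - \<gamma> * (\<Sum>n\<in>Nt. phi n * F c (Inr n))"
    unfolding sum_I by (simp add: center_coord_def sum_distrib_left mult_ac sum_negf)
  also have "(\<Sum>i\<in>I. c i * F c i) - - \<gamma> * (\<Sum>n\<in>Nt. phi n * F c (Inr n)) =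
      - (\<Sum>n\<in>Nu. P * (wave2 k n * (c (Inl n))\<^sup>2)) - (\<Sum>n\<in>Nt. wave2 k n * (c (Inr n))\<^sup>2)
      - (\<Sum>n\<in>Nt. \<gamma> * (phi n * (wave2 k n * c (Inr n))))"
    unfolding energy_identity potential_energy_rate assms sum_distrib_left[symmetric]
    by (simp add: center_shift_def algebra_simps)
  also have "\<dots> \<le> - (\<Sum>n\<in>Nu. rate * (c (Inl n))\<^sup>2)
      - (\<Sum>n\<in>Nt. rate * (c (Inr n))\<^sup>2 - (\<gamma> * weight_scale k)\<^sup>2 / 2)"
  proof -
    have "(\<Sum>n\<in>Nu. rate * (c (Inl n))\<^sup>2) \<le> (\<Sum>n\<in>Nu. P * (wave2 k n * (c (Inl n))\<^sup>2))"
      by (intro sum_mono vel_dissipation)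
    moreover have "(\<Sum>n\<in>Nt. rate * (c (Inr n))\<^sup>2 - (\<gamma> * weight_scale k)\<^sup>2 / 2) \<le>
        (\<Sum>n\<in>Nt. wave2 k n * (c (Inr n))\<^sup>2 + \<gamma> * (phi n * (wave2 k n * c (Inr n))))"
    proof (rule sum_mono)
      fix n assume "n \<in> Nt"
      from temp_dissipation[OF this, of "c (Inr n)"]
      show "rate * (c (Inr n))\<^sup>2 - (\<gamma> * weight_scale k)\<^sup>2 / 2 \<le>
          wave2 k n * (c (Inr n))\<^sup>2 + \<gamma> * (phi n * (wave2 k n * c (Inr n)))" by linarith
    qed
    ultimately show ?thesis by (simp add: sum.distrib)
  qed
  also have "\<dots> = - rate * (\<Sum>i\<in>I. (c i)\<^sup>2) + real (card Nt) * (\<gamma> * weight_scale k)\<^sup>2 / 2"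
    unfolding sum_I by (simp add: sum_subtractf sum_distrib_left[symmetric] algebra_simps)
  finally have 1: "(\<Sum>i\<in>I. (c i - center_coord i) * F c i) \<le>
      - rate * (\<Sum>i\<in>I. (c i)\<^sup>2) + real (card Nt) * (\<gamma> * weight_scale k)\<^sup>2 / 2" .
  have "dev c \<le> (\<Sum>i\<in>I. 2 * (c i)\<^sup>2 + 2 * (center_coord i)\<^sup>2)"
    unfolding dev_def
  proof (rule sum_mono)
    fix i show "(c i - center_coord i)\<^sup>2 \<le> 2 * (c i)\<^sup>2 + 2 * (center_coord i)\<^sup>2"
      using zero_le_power2[of "c i + center_coord i"] unfolding power2_sum power2_diff by linarith
  qed
  also have "\<dots> \<le> 2 * (\<Sum>i\<in>I. (c i)\<^sup>2) + 2 * center_norm2 P R k"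
    using center_norm2_bound by (simp add: sum.distrib sum_distrib_left[symmetric])
  finally have "rate * dev c \<le> rate * (2 * (\<Sum>i\<in>I. (c i)\<^sup>2) + 2 * center_norm2 P R k)"
    using rate_pos by (intro mult_left_mono) auto
  moreover have "rate * level = rate * (2 * center_norm2 P R k) + real (card Nt) * (\<gamma> * weight_scale k)\<^sup>2"
    using rate_pos by (simp add: decay_level_def distrib_left)
  moreover have "(\<Sum>i\<in>I. 2 * (c i - center_coord i) * F c i) = 2 * (\<Sum>i\<in>I. (c i - center_coord i) * F c i)"
    unfolding sum_distrib_left mult.assoc ..
  ultimately show ?thesis using 1 by (simp add: algebra_simps)
qed

lemma dev_decay:
  assumes pee: "\<And>c. defect c = 0" and x: "is_sol J x" "{s..t} \<subseteq> J" "s \<le> t"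
  shows "dev (x t) - level \<le> (dev (x s) - level) * exp (- rate * (t - s))"
proof (rule gronwall[where a = s and b = t])
  fix r assume r: "r \<in> {s..t}"
  have "is_sol {s..t} x" by (rule is_sol_subset[OF x(1,2)])
  then have "((\<lambda>s. x s i) has_real_derivative F (x r) i) (at r within {s..t})" if "i \<in> I" for i
    using r that by (simp add: is_sol_def)
  then show "((\<lambda>t. dev (x t) - level) has_real_derivative
      (\<Sum>i\<in>I. 2 * (x r i - center_coord i) * F (x r) i)) (at r within {s..t})"
    unfolding dev_def by (auto intro!: derivative_eq_intros sum.cong)
  show "(\<Sum>i\<in>I. 2 * (x r i - center_coord i) * F (x r) i) \<le> - rate * (dev (x r) - level)"
    by (rule dissipation[OF pee])
qed (use x in auto)

text \<open>Squared radius of the ball in coordinates around \<open>center_coord\<close>: the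
  squared \<open>ball_radius\<close> without the part due to the distance of the center from the
  phase space.\<close>

definition ball_dev :: real where
  "ball_dev = center_norm2 P R k + level + 1 - center_excess"

lemma ball_dev: "level + 1 \<le> ball_dev" "0 < ball_dev"
proof -
  have "center_excess \<le> center_norm2 P R k" unfolding center_excess_def by (simp add: sum_nonneg)
  then show "level + 1 \<le> ball_dev" by (simp add: ball_dev_def)
  then show "0 < ball_dev" using level_nonneg by simp
qed

lemma state_of_in_ball: "state_of c \<in> B \<longleftrightarrow> dev c \<le> ball_dev"
  unfolding phase_ball_def ball_radius_def ball_dev_def
  by (auto simp: state_of_in L2_dist_center)

lemma in_ball: "X \<in> B \<longleftrightarrow> X \<in> M \<and> dev (coords X) \<le> ball_dev"
proof (cases "X \<in> M")
  case True
  then show ?thesis using state_of_in_ball[of "coords X"] by (simp add: state_of_coords)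
qed (simp add: phase_ball_def)

lemma B_subset: "B \<subseteq> M" by (auto simp: phase_ball_def)

lemma center_in_ball: "state_of center_coord \<in> B"
  unfolding state_of_in_ball using ball_dev(2) by (simp add: dev_def)

text \<open>The nearest point of the ball lies on the segment to its center, at the fraction
  \<open>q\<close>; the triangle inequality gives the reverse bound. The formula reduces monotone
  attraction to the decrease of \<open>dev\<close>.\<close>

lemma dist_to_outside:
  assumes "ball_dev < dev c"
  shows "dist_to (L2_dist k) (state_of c) B = sqrt (dev c) - sqrt ball_dev"
proof (rule antisym)
  define q where "q = sqrt ball_dev / sqrt (dev c)"
  have q: "0 \<le> q" "q \<le> 1" "q * sqrt (dev c) = sqrt ball_dev"
    using assms ball_dev(2) by (auto simp: q_def)
  define e where "e i = center_coord i + q * (c i - center_coord i)" for i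
  have Lc: "L2_set (\<lambda>i. c i - center_coord i) I = sqrt (dev c)" by (simp add: dev_def L2_set_def)
  have "dev e = (q * sqrt (dev c))\<^sup>2"
    unfolding dev_L2_set[of e] Lc[symmetric] by (simp add: e_def L2_set_right_distrib[OF q(1)])
  then have "dev e = ball_dev" using q(3) ball_dev(2) by simp
  then have "dist_to (L2_dist k) (state_of c) B \<le> L2_dist k (state_of c) (state_of e)"
    by (intro dist_to_le L2_dist_nonneg) (simp add: state_of_in_ball)
  also have "\<dots> = L2_set (\<lambda>i. (1 - q) * (c i - center_coord i)) I"
    unfolding L2_dist_state_of e_def by (simp add: algebra_simps)
  also have "\<dots> = (1 - q) * sqrt (dev c)" 
    unfolding Lc[symmetric] by (rule L2_set_right_distrib[symmetric]) (use q(2) in simp)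
  finally show "dist_to (L2_dist k) (state_of c) B \<le> sqrt (dev c) - sqrt ball_dev"
    using q(3) by (simp add: left_diff_distrib)
  show "sqrt (dev c) - sqrt ball_dev \<le> dist_to (L2_dist k) (state_of c) B"
  proof (rule dist_to_ge)
    show "B \<noteq> {}" using center_in_ball by blast
    fix Y assume Y: "Y \<in> B"
    then obtain d where d: "Y = state_of d" using B_subset by (meson phase_spaceE subsetD)
    have "L2_set (\<lambda>i. (c i - d i) + (d i - center_coord i)) I \<le>
        L2_set (\<lambda>i. c i - d i) I + L2_set (\<lambda>i. d i - center_coord i) I" by (rule L2_set_triangle_ineq)
    moreover have "L2_set (\<lambda>i. d i - center_coord i) I \<le> sqrt ball_dev"
      using Y unfolding d state_of_in_ball by (simp add: dev_def L2_set_def)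
    ultimately show "sqrt (dev c) - sqrt ball_dev \<le> L2_dist k (state_of c) Y"
      unfolding d L2_dist_state_of using Lc by simp
  qed
qed

lemma dist_to_inside: "X \<in> B \<Longrightarrow> dist_to (L2_dist k) X B = 0"
proof (rule antisym)
  assume X: "X \<in> B"
  then obtain d where d: "X = state_of d" using B_subset by (meson phase_spaceE subsetD)
  show "dist_to (L2_dist k) X B \<le> 0"
    using dist_to_le[where d = "L2_dist k" and z = X, OF L2_dist_nonneg X] by (simp add: d L2_dist_state_of L2_set_def)
  show "0 \<le> dist_to (L2_dist k) X B"
    using X by (intro dist_to_ge L2_dist_nonneg) auto
qed

end

section \<open>Dynamics under the potential energy equation\<close>

locale balanced_model = truncated_model +
  assumes balanced: "potential_energy_equation R S P k Nu Nt"
begin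

lemma no_defect: "defect c = 0"
  using balanced potential_energy_equation_iff_defect by blast

lemma solution_decay:
  assumes "solves R S P k Nu Nt T X" "s \<in> time_interval T" "t \<in> time_interval T" "s \<le> t"
  shows "dev (coords (X t)) - level \<le> (dev (coords (X s)) - level) * exp (- rate * (t - s))"
proof (rule dev_decay[OF no_defect])
  show "is_sol (time_interval T) (\<lambda>t. coords (X t))" using assms(1) by (simp add: solves_iff)
  have "{s..t} \<subseteq> {0..t}" using assms(2) by (auto simp: time_interval_def)
  then show "{s..t} \<subseteq> time_interval T" using time_interval_closed[OF assms(3)] by blast
qed fact

lemma ball_invariant:
  assumes X: "solves R S P k Nu Nt T X" and st: "s \<in> time_interval T" "t \<in> time_interval T" "s \<le> t"
    and B: "X s \<in> B"
  shows "X t \<in> B"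
proof -
  have "dev (coords (X t)) - level \<le> (dev (coords (X s)) - level) * exp (- rate * (t - s))"
    by (rule solution_decay[OF X st])
  also have "\<dots> \<le> (ball_dev - level) * exp (- rate * (t - s))"
    using B by (intro mult_right_mono) (auto simp: in_ball)
  also have "\<dots> \<le> (ball_dev - level) * 1"
    using ball_dev(1) rate_pos st(3) by (intro mult_left_mono) auto
  finally show ?thesis using X st(2) by (simp add: in_ball solves_iff)
qed

text \<open>From exp(s) \<ge> 1 + s with s = rate * t, the excess of \<open>dev\<close> over the
  decay level has shrunk to at most 1 by time t, which is the margin built into the radius. The
  waiting time depends on the initial state only through \<open>dev\<close>.\<close>

lemma ball_entered:
  assumes X: "solves R S P k Nu Nt \<infinity> X" and t: "dev (coords (X 0)) \<le> rate * t" "0 \<le> t"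
  shows "X t \<in> B"
proof -
  have "dev (coords (X t)) - level \<le> (dev (coords (X 0)) - level) * exp (- rate * (t - 0))"
    by (rule solution_decay[OF X]) (use t in \<open>auto simp: time_interval_infinity\<close>)
  also have "dev (coords (X 0)) - level \<le> exp (rate * t)"
    using t(1) exp_ge_add_one_self[of "rate * t"] level_nonneg by linarith
  then have "(dev (coords (X 0)) - level) * exp (- rate * (t - 0)) \<le> exp (rate * t) * exp (- rate * (t - 0))"
    by (rule mult_right_mono) simp
  also have "\<dots> = 1" by (simp add: exp_minus)
  finally show ?thesis
    using X t(2) ball_dev(1) by (simp add: in_ball solves_iff time_interval_infinity)
qed

lemma ball_forward_invariant: "forward_invariant R S P k Nu Nt B"
  unfolding forward_invariant_def
proof (intro allI impI ballI)
  fix T X t assume X: "solves R S P k Nu Nt T X \<and> X 0 \<in> B" and t: "t \<in> time_interval T"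
  have "0 \<in> time_interval T" using time_interval_closed[OF t] t by (auto simp: time_interval_def)
  then show "X t \<in> B" using X t by (intro ball_invariant[of T X 0 t]) (auto simp: time_interval_def)
qed

lemma ball_monotonically_attracts: "monotonically_attracts R S P k Nu Nt B"
  unfolding monotonically_attracts_def
proof (intro conjI allI impI ballI)
  show "B \<noteq> {}" using center_in_ball by blast
  fix T X s t assume X: "solves R S P k Nu Nt T X" and s: "s \<in> time_interval T" and t: "t \<in> time_interval T"
    and *: "s < t \<and> X s \<notin> B"
  have Xs: "X s = state_of (coords (X s))" and Xt: "X t = state_of (coords (X t))"
    using X s t by (simp_all add: solves_iff state_of_coords)
  have ds: "ball_dev < dev (coords (X s))" using * state_of_in_ball[of "coords (X s)"] Xs by simp
  have out: "dist_to (L2_dist k) (X s) B = sqrt (dev (coords (X s))) - sqrt ball_dev"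
    using dist_to_outside[OF ds] Xs by simp
  show "dist_to (L2_dist k) (X t) B < dist_to (L2_dist k) (X s) B"
  proof (cases "X t \<in> B")
    case True
    then show ?thesis using dist_to_inside[OF True] out ds by simp
  next
    case False
    then have dt: "ball_dev < dev (coords (X t))" using state_of_in_ball[of "coords (X t)"] Xt by simp
    have "dev (coords (X t)) - level \<le> (dev (coords (X s)) - level) * exp (- rate * (t - s))"
      by (rule solution_decay[OF X s t]) (use * in auto)
    \<comment> \<open>Strictness holds because outside the ball \<open>dev\<close> exceeds the decay
      level by more than 1, so the exponential factor acts on a positive quantity.\<close>
    also have "\<dots> < (dev (coords (X s)) - level) * 1"
      using ds ball_dev(1) rate_pos * by (intro mult_strict_left_mono) auto
    finally have "dev (coords (X t)) < dev (coords (X s))" by simp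
    then show ?thesis using dist_to_outside[OF dt] Xt out by simp
  qed
next
  fix X assume X: "solves R S P k Nu Nt \<infinity> X"
  show "((\<lambda>t. dist_to (L2_dist k) (X t) B) \<longlongrightarrow> 0) at_top"
  proof (rule tendsto_eventually, rule eventually_at_top_linorderI)
    \<comment> \<open>From this time on the distance is exactly 0, as the solution has entered the
      ball.\<close>
    fix t assume "dev (coords (X 0)) / rate \<le> t"
    then have "dev (coords (X 0)) \<le> rate * t" "0 \<le> t"
      using rate_pos order_trans[OF divide_nonneg_pos[OF dev_nonneg rate_pos]]
      by (auto simp: pos_divide_le_eq mult.commute)
    then show "dist_to (L2_dist k) (X t) B = 0" by (intro dist_to_inside ball_entered[OF X])
  qed
qed

section \<open>The flow on the metric phase space and its attractor\<close>

lemma Metric_space_phase_space: "Metric_space M (L2_dist k)"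
proof
  show "0 \<le> L2_dist k X Y" for X Y by (rule L2_dist_nonneg)
  show "L2_dist k X Y = L2_dist k Y X" for X Y by (rule L2_dist_commute)
next
  fix X Y assume "X \<in> M" "Y \<in> M"
  then obtain c d where X: "X = state_of c" and Y: "Y = state_of d" by (meson phase_spaceE)
  have "L2_set (\<lambda>i. c i - d i) I = 0 \<longleftrightarrow> (\<forall>i\<in>I. c i - d i = 0)" by (rule L2_set_eq_0_iff[OF finI])
  moreover have "state_of c = state_of d \<longleftrightarrow> (\<forall>i\<in>I. c i - d i = 0)"
  proof
    assume "state_of c = state_of d"
    then show "\<forall>i\<in>I. c i - d i = 0" using coords_state_of by (metis diff_self)
  qed (auto intro: state_of_cong)
  ultimately show "L2_dist k X Y = 0 \<longleftrightarrow> X = Y" by (simp add: X Y L2_dist_state_of)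
next
  fix X Y Z assume "X \<in> M" "Y \<in> M" "Z \<in> M"
  then obtain c d e where "X = state_of c" "Y = state_of d" "Z = state_of e" by (meson phase_spaceE)
  then show "L2_dist k X Z \<le> L2_dist k X Y + L2_dist k Y Z"
    using L2_set_triangle_ineq[of "\<lambda>i. c i - d i" "\<lambda>i. d i - e i" I] by (simp add: L2_dist_state_of)
qed

interpretation Met: Metric_space M "L2_dist k" by (rule Metric_space_phase_space)

lemma coord_le_L2_set: "i \<in> I \<Longrightarrow> \<bar>c i\<bar> \<le> L2_set c I"
  using member_le_L2_set[OF finI, of i "\<lambda>i. \<bar>c i\<bar>"] by (simp add: L2_set_def)

lemma ball_coords_bounded:
  assumes "dev c \<le> ball_dev" "i \<in> I"
  shows "\<bar>c i\<bar> \<le> sqrt ball_dev + L2_set center_coord I"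
proof -
  have "\<bar>c i - center_coord i\<bar> \<le> sqrt (dev c)"
    using coord_le_L2_set[OF assms(2), of "\<lambda>i. c i - center_coord i"] by (simp add: dev_def L2_set_def)
  also have "\<dots> \<le> sqrt ball_dev" using assms(1) by simp
  finally show ?thesis using coord_le_L2_set[OF assms(2), of center_coord] by linarith
qed

text \<open>Coordinates are bounded on the ball, so Bolzano-Weierstrass yields coordinatewise
  limits; with finitely many coordinates this is convergence in the \<open>L2\<close> metric, and
  \<open>dev\<close> is continuous.\<close>

lemma compactin_ball: "compactin Met.mtopology B"
  unfolding Met.compactin_sequentially
proof (intro conjI allI impI B_subset)
  fix \<sigma> :: "nat \<Rightarrow> state" assume "range \<sigma> \<subseteq> B"
  then have \<sigma>: "\<sigma> n \<in> M" "dev (coords (\<sigma> n)) \<le> ball_dev" for n by (auto simp: in_ball image_subset_iff)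
  have bdd: "bounded (range (\<lambda>n. coords (\<sigma> n) i))" if "i \<in> I" for i
    using ball_coords_bounded[OF \<sigma>(2) that] unfolding bounded_iff by auto
  obtain l r where r: "strict_mono (r :: nat \<Rightarrow> nat)"
    and l: "\<And>i. i \<in> I \<Longrightarrow> (\<lambda>n. coords (\<sigma> (r n)) i) \<longlonglongrightarrow> l i"
    using convergent_subsequence_coordinatewise[where x = "\<lambda>n. coords (\<sigma> n)", OF finI bdd] by blast
  have "(\<lambda>n. dev (coords (\<sigma> (r n)))) \<longlonglongrightarrow> dev l"
    unfolding dev_def by (intro tendsto_intros l)
  then have "dev l \<le> ball_dev" by (rule LIMSEQ_le_const2) (use \<sigma>(2) in blast)
  then have lB: "state_of l \<in> B" by (simp add: state_of_in_ball)
  have d: "L2_dist k (\<sigma> n) (state_of l) = L2_set (\<lambda>i. coords (\<sigma> n) i - l i) I" for n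
    using L2_dist_state_of[of "coords (\<sigma> n)" l] state_of_coords[OF \<sigma>(1)] by simp
  have "(\<lambda>n. sqrt (\<Sum>i\<in>I. (coords (\<sigma> (r n)) i - l i)\<^sup>2)) \<longlonglongrightarrow> sqrt (\<Sum>i\<in>I. (l i - l i)\<^sup>2)"
    by (intro tendsto_intros l)
  then have "(\<lambda>n. L2_dist k (\<sigma> (r n)) (state_of l)) \<longlonglongrightarrow> 0"
    by (simp add: d L2_set_def)
  then have "limitin Met.mtopology (\<sigma> \<circ> r) (state_of l) sequentially"
    by (simp add: Met.limitin_metric_dist_null \<sigma>(1) state_of_in)
  then show "\<exists>l r. l \<in> B \<and> strict_mono r \<and> limitin Met.mtopology (\<sigma> \<circ> r) l sequentially"
    using lB r by blast
qed

abbreviation "S\<^sub>t \<equiv> flow R S P k Nu Nt"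

text \<open>Uniqueness of solutions is what gives the definite description in \<open>flow\<close>
  its value.\<close>

lemma flow_eq:
  assumes "solves R S P k Nu Nt \<infinity> X" "t \<ge> 0"
  shows "S\<^sub>t t (X 0) = X t"
  unfolding flow_def
proof (rule the_equality)
  show "\<exists>Y. solves R S P k Nu Nt \<infinity> Y \<and> Y 0 = X 0 \<and> X t = Y t" using assms(1) by blast
  fix Z assume "\<exists>Y. solves R S P k Nu Nt \<infinity> Y \<and> Y 0 = X 0 \<and> Z = Y t"
  then show "Z = X t"
    using solution_unique[OF _ assms(1), of \<infinity> _ t] assms(2) by (auto simp: time_interval_infinity)
qed

lemma solves_shift:
  assumes "solves R S P k Nu Nt \<infinity> X" "t \<ge> 0"
  shows "solves R S P k Nu Nt \<infinity> (\<lambda>s. X (t + s))"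
proof -
  have "((\<lambda>s. coords (X (t + s)) i) has_real_derivative F (coords (X (t + s))) i) (at s within {0..})"
    if "s \<ge> 0" "i \<in> I" for s i
  proof -
    have "((\<lambda>s. coords (X s) i) has_real_derivative F (coords (X (t + s))) i) (at (t + s) within {0..})"
      using assms that by (simp add: solves_iff is_sol_def time_interval_infinity)
    then have "((\<lambda>s. coords (X s) i) has_real_derivative F (coords (X (t + s))) i) (at (t + s) within (\<lambda>s. t + s) ` {0..})"
      by (rule DERIV_subset) (use assms(2) in auto)
    then have "((\<lambda>s. coords (X s) i) \<circ> (\<lambda>s. t + s) has_real_derivative F (coords (X (t + s))) i * 1) (at s within {0..})"
      by (rule DERIV_image_chain) (auto intro!: derivative_eq_intros)
    then show ?thesis by (simp add: o_def)
  qed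
  then show ?thesis using assms by (auto simp: solves_iff is_sol_def time_interval_infinity)
qed

lemma solutionE:
  assumes "X0 \<in> M"
  obtains X where "solves R S P k Nu Nt \<infinity> X" "X 0 = X0" "\<And>t. t \<ge> 0 \<Longrightarrow> S\<^sub>t t X0 = X t"
  using solution_exists[OF assms] flow_eq by metis

lemma semigroup_flow: "semigroup_on M S\<^sub>t"
  unfolding semigroup_on_def
proof (intro conjI allI impI ballI)
  fix t :: real assume "t \<ge> 0"
  show "S\<^sub>t t ` M \<subseteq> M"
  proof
    fix Y assume "Y \<in> S\<^sub>t t ` M"
    then obtain X0 where "X0 \<in> M" "Y = S\<^sub>t t X0" by blast
    then show "Y \<in> M"
      using \<open>t \<ge> 0\<close> by (elim solutionE) (auto simp: solves_iff time_interval_infinity)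
  qed
next
  fix X0 assume "X0 \<in> M"
  then show "S\<^sub>t 0 X0 = X0" by (elim solutionE) auto
next
  fix s t :: real and X0 assume st: "s \<ge> 0" "t \<ge> 0" and X0: "X0 \<in> M"
  obtain X where X: "solves R S P k Nu Nt \<infinity> X" "X 0 = X0" "\<And>t. t \<ge> 0 \<Longrightarrow> S\<^sub>t t X0 = X t"
    by (rule solutionE[OF X0]) blast
  have "S\<^sub>t s (X (t + 0)) = X (t + s)" by (rule flow_eq[OF solves_shift[OF X(1) st(2)] st(1)])
  then show "S\<^sub>t (s + t) X0 = S\<^sub>t s (S\<^sub>t t X0)" using X(3) st by (simp add: add.commute)
qed

lemma flow_ball: "t \<ge> 0 \<Longrightarrow> S\<^sub>t t ` B \<subseteq> B"
proof
  fix Y assume t: "t \<ge> 0" and "Y \<in> S\<^sub>t t ` B"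
  then obtain X0 where X0: "X0 \<in> B" "Y = S\<^sub>t t X0" by blast
  obtain X where X: "solves R S P k Nu Nt \<infinity> X" "X 0 = X0" "\<And>t. t \<ge> 0 \<Longrightarrow> S\<^sub>t t X0 = X t"
    by (rule solutionE[of X0]) (use X0 B_subset in blast)+
  have "X t \<in> B"
    by (rule ball_invariant[OF X(1), of 0]) (use t X0 X(2) in \<open>auto simp: time_interval_infinity\<close>)
  then show "Y \<in> B" using X(3)[OF t] X0(2) by simp
qed

text \<open>Invariance keeps both orbits inside the ball, hence under one bound on the coordinates,
  and \<open>sol_distance\<close> then supplies a constant common to all pairs of initial
  states.\<close>

lemma flow_lipschitz:
  assumes t: "t \<ge> 0"
  shows "\<exists>L. \<forall>x\<in>B. \<forall>y\<in>B. L2_dist k (S\<^sub>t t x) (S\<^sub>t t y) \<le> L * L2_dist k x y"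
proof -
  define r where "r = sqrt ball_dev + L2_set center_coord I"
  obtain K where K: "\<And>T x y t. is_sol {0..T} x \<Longrightarrow> is_sol {0..T} y \<Longrightarrow>
      (\<And>s i. s \<in> {0..T} \<Longrightarrow> i \<in> I \<Longrightarrow> \<bar>x s i\<bar> \<le> r \<and> \<bar>y s i\<bar> \<le> r) \<Longrightarrow> t \<in> {0..T} \<Longrightarrow>
      (\<Sum>i\<in>I. (x t i - y t i)\<^sup>2) \<le> (\<Sum>i\<in>I. (x 0 i - y 0 i)\<^sup>2) * exp (K * t)"
    by (rule sol_distance[of r]) blast
  have "L2_dist k (S\<^sub>t t x0) (S\<^sub>t t y0) \<le> sqrt (exp (K * t)) * L2_dist k x0 y0" if xy: "x0 \<in> B" "y0 \<in> B" for x0 y0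
  proof -
    obtain X where X: "solves R S P k Nu Nt \<infinity> X" "X 0 = x0" "\<And>t. t \<ge> 0 \<Longrightarrow> S\<^sub>t t x0 = X t"
      by (rule solutionE[of x0]) (use xy B_subset in blast)+
    obtain Y where Y: "solves R S P k Nu Nt \<infinity> Y" "Y 0 = y0" "\<And>t. t \<ge> 0 \<Longrightarrow> S\<^sub>t t y0 = Y t"
      by (rule solutionE[of y0]) (use xy B_subset in blast)+
    have b: "\<bar>coords (Z s) i\<bar> \<le> r" if "solves R S P k Nu Nt \<infinity> Z" "Z 0 \<in> B" "s \<ge> 0" "i \<in> I" for Z s i
    proof -
      have "Z s \<in> B"
        by (rule ball_invariant[OF that(1), of 0]) (use that in \<open>auto simp: time_interval_infinity\<close>)
      then show ?thesis unfolding r_def using ball_coords_bounded that(4) by (simp add: in_ball)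
    qed
    have s: "is_sol {0..t} (\<lambda>t. coords (Z t))" if "solves R S P k Nu Nt \<infinity> Z" for Z
      using that unfolding solves_iff time_interval_infinity by (auto elim!: is_sol_subset)
    have "(\<Sum>i\<in>I. (coords (X t) i - coords (Y t) i)\<^sup>2) \<le> (\<Sum>i\<in>I. (coords (X 0) i - coords (Y 0) i)\<^sup>2) * exp (K * t)"
      by (rule K[OF s[OF X(1)] s[OF Y(1)]]) (use b[OF X(1)] b[OF Y(1)] X(2) Y(2) xy t in auto)
    then have *: "sqrt (\<Sum>i\<in>I. (coords (X t) i - coords (Y t) i)\<^sup>2) \<le>
        sqrt (\<Sum>i\<in>I. (coords (X 0) i - coords (Y 0) i)\<^sup>2) * sqrt (exp (K * t))"
      unfolding real_sqrt_mult[symmetric] by (rule real_sqrt_le_mono)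
    have L2: "sqrt (\<Sum>i\<in>I. (coords (X s) i - coords (Y s) i)\<^sup>2) = L2_dist k (X s) (Y s)" if "s \<ge> 0" for s
    proof -
      have "X s \<in> M" "Y s \<in> M" using X(1) Y(1) that by (simp_all add: solves_iff time_interval_infinity)
      then show ?thesis
        using L2_dist_state_of[of "coords (X s)" "coords (Y s)"] by (simp add: state_of_coords L2_set_def)
    qed
    have "L2_dist k (X t) (Y t) \<le> L2_dist k (X 0) (Y 0) * sqrt (exp (K * t))"
      using * L2[OF t] L2[OF order_refl] by simp
    then show ?thesis using X(2) X(3)[OF t] Y(2) Y(3)[OF t] by (simp add: mult.commute)
  qed
  then show ?thesis by blast
qed

text \<open>A set bounded in the metric has uniformly bounded \<open>dev\<close>, and since the
  waiting time is governed by \<open>dev\<close>, one time serves the whole set.\<close>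

lemma ball_absorbs:
  assumes Z: "Met.mbounded Z"
  shows "\<exists>\<tau>\<ge>0. \<forall>z\<in>Z. \<forall>t\<ge>\<tau>. S\<^sub>t t z \<in> B"
proof -
  obtain Y b where Y: "Y \<in> M" and b: "\<And>z. z \<in> Z \<Longrightarrow> L2_dist k Y z \<le> b"
    using Z state_of_in unfolding Met.mbounded by (metis empty_iff)
  obtain e where e: "Y = state_of e" using Y by (rule phase_spaceE)
  define D where "D = (\<bar>b\<bar> + sqrt (dev e))\<^sup>2"
  have dev: "dev (coords z) \<le> D" if z: "z \<in> Z" for z
  proof -
    have zM: "z \<in> M" using Met.mbounded_subset_mspace[OF Z] z by blast
    have "L2_set (\<lambda>i. (coords z i - e i) + (e i - center_coord i)) I \<le>
        L2_set (\<lambda>i. coords z i - e i) I + L2_set (\<lambda>i. e i - center_coord i) I"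
      by (rule L2_set_triangle_ineq)
    also have "L2_set (\<lambda>i. coords z i - e i) I = L2_dist k Y z"
      using L2_dist_state_of[of "coords z" e] zM by (simp add: state_of_coords e L2_dist_commute)
    also have "L2_dist k Y z \<le> \<bar>b\<bar>" using b[OF z] by linarith
    also have "L2_set (\<lambda>i. e i - center_coord i) I = sqrt (dev e)" by (simp add: dev_def L2_set_def)
    finally have "L2_set (\<lambda>i. coords z i - center_coord i) I \<le> \<bar>b\<bar> + sqrt (dev e)" by simp
    then show ?thesis unfolding dev_L2_set D_def by (intro power_mono L2_set_nonneg)
  qed
  show ?thesis
  proof (intro exI[of _ "D / rate"] conjI ballI allI impI)
    show "0 \<le> D / rate" using rate_pos by (simp add: D_def)
    fix z t assume z: "z \<in> Z" and t: "D / rate \<le> t"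
    have "z \<in> M" using Met.mbounded_subset_mspace[OF Z] z by blast
    then obtain X where X: "solves R S P k Nu Nt \<infinity> X" "X 0 = z" "\<And>t. t \<ge> 0 \<Longrightarrow> S\<^sub>t t z = X t"
      by (rule solutionE) blast
    have t0: "t \<ge> 0" using t \<open>0 \<le> D / rate\<close> by linarith
    have "D \<le> rate * t" using t rate_pos by (simp add: pos_divide_le_eq mult.commute)
    then have "X t \<in> B" using dev[OF z] X(2) t0 by (intro ball_entered[OF X(1)]) auto
    then show "S\<^sub>t t z \<in> B" using X(3)[OF t0] by simp
  qed
qed

lemma compact_global_attractor:
  "\<exists>A. compactin Met.mtopology A \<and> global_attractor M (L2_dist k) S\<^sub>t A"
  by (rule Met.global_attractor_exists[OF semigroup_flow compactin_ball _ flow_ball flow_lipschitz ball_absorbs])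
    (use center_in_ball in auto)

lemma ball_nondegenerate:
  "\<exists>Y\<in>M. L2_dist k Y (ball_center P R k (card Nt)) < ball_radius P R k (card Nt)"
proof (rule bexI[OF _ state_of_in])
  show "L2_dist k (state_of center_coord) (ball_center P R k (card Nt)) < ball_radius P R k (card Nt)"
    unfolding L2_dist_center ball_radius_def
    using ball_dev(2) by (simp add: dev_def ball_dev_def)
qed

end

theorem proposition2p2:
  shows
    "(\<forall>R S P k1 Nu Nt. admissible R S P k1 \<and> index_sets Nu Nt \<longrightarrow>
        (\<forall>X0 \<in> phase_space k1 Nu Nt.
           \<exists>T X. 0 < T \<and> solves R S P k1 Nu Nt T X \<and> smooth_curve k1 Nu Nt T X \<and> X 0 = X0 \<and>
             (\<forall>T' Y. solves R S P k1 Nu Nt T' Y \<and> Y 0 = X0 \<longrightarrow>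
                T' \<le> T \<and> (\<forall>t\<in>time_interval T'. Y t = X t))) \<and>
        (potential_energy_equation R S P k1 Nu Nt \<longleftrightarrow> energy_balance_criterion Nu Nt)) \<and>
     (\<exists>ctr :: real \<Rightarrow> real \<Rightarrow> real \<Rightarrow> nat \<Rightarrow> state. \<exists>rad :: real \<Rightarrow> real \<Rightarrow> real \<Rightarrow> nat \<Rightarrow> real.
        \<forall>R S P k1 Nu Nt. admissible R S P k1 \<and> index_sets Nu Nt \<and>
            potential_energy_equation R S P k1 Nu Nt \<longrightarrow>
          (let C = ctr P R k1 (card Nt); r = rad P R k1 (card Nt);
               B = phase_ball k1 Nu Nt C r;
               M = phase_space k1 Nu Nt; F = flow R S P k1 Nu Nt
           in L2_state k1 C \<and> (\<exists>Y\<in>M. L2_dist k1 Y C < r) \<and>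
              forward_invariant R S P k1 Nu Nt B \<and>
              monotonically_attracts R S P k1 Nu Nt B \<and>
              (\<forall>X0\<in>M. \<exists>X. solves R S P k1 Nu Nt \<infinity> X \<and> X 0 = X0) \<and>
              semigroup_on M F \<and>
              (\<exists>A. compactin (Metric_space.mtopology M (L2_dist k1)) A \<and>
                   global_attractor M (L2_dist k1) F A)))"
    (is "(\<forall>R S P k1 Nu Nt. _ R S P k1 Nu Nt \<longrightarrow> (\<forall>X0\<in>_ k1 Nu Nt. ?sol R S P k1 Nu Nt X0) \<and> _ R S P k1 Nu Nt) \<and>
      (\<exists>ctr rad. \<forall>R S P k1 Nu Nt. _ R S P k1 Nu Nt \<longrightarrow> ?ball ctr rad R S P k1 Nu Nt)")
proof (intro conjI allI impI ballI, elim conjE)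
  fix R S P k1 Nu Nt X0
  assume a: "admissible R S P k1" "index_sets Nu Nt" and X0: "X0 \<in> phase_space k1 Nu Nt"
  interpret truncated_model R S P k1 Nu Nt by unfold_locales fact+
  obtain X where X: "solves R S P k1 Nu Nt \<infinity> X" "smooth_curve k1 Nu Nt \<infinity> X" "X 0 = X0"
    by (rule solution_exists[OF X0])
  have "Y t = X t" if "solves R S P k1 Nu Nt T' Y" "Y 0 = X0" "t \<in> time_interval T'" for T' Y t
    by (rule solution_unique[OF that(1) X(1)])
      (use that X(3) in \<open>auto simp: time_interval_infinity time_interval_def\<close>)
  \<comment> \<open>The maximal time of existence is infinite, so every other interval of existence
    is trivially contained in it.\<close>
  then show "?sol R S P k1 Nu Nt X0"
    using X by (intro exI[of _ \<infinity>] exI[of _ X]) auto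
next
  fix R S P k1 Nu Nt
  assume "admissible R S P k1 \<and> index_sets Nu Nt"
  then interpret truncated_model R S P k1 Nu Nt by unfold_locales blast+
  show "potential_energy_equation R S P k1 Nu Nt \<longleftrightarrow> energy_balance_criterion Nu Nt"
    by (rule potential_energy_equation_iff)
next
  \<comment> \<open>The witnesses are fixed before the parameters and index sets; this order of
    quantifiers expresses on what the ball may depend.\<close>
  show "\<exists>ctr rad. \<forall>R S P k1 Nu Nt. admissible R S P k1 \<and> index_sets Nu Nt \<and>
      potential_energy_equation R S P k1 Nu Nt \<longrightarrow> ?ball ctr rad R S P k1 Nu Nt"
  proof (intro exI[of _ ball_center] exI[of _ ball_radius] allI impI)
    fix R S P k1 Nu Nt
    assume "admissible R S P k1 \<and> index_sets Nu Nt \<and> potential_energy_equation R S P k1 Nu Nt"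
    then interpret balanced_model R S P k1 Nu Nt by unfold_locales blast+
    have global: "\<forall>X0\<in>phase_space k1 Nu Nt. \<exists>X. solves R S P k1 Nu Nt \<infinity> X \<and> X 0 = X0"
      using solution_exists by metis
    show "?ball ball_center ball_radius R S P k1 Nu Nt"
      unfolding Let_def
      by (intro conjI L2_state_ball_center ball_nondegenerate ball_forward_invariant
          ball_monotonically_attracts global semigroup_flow compact_global_attractor)
  qed
qed

end
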